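(* Let $X$ and $Y$ be Banach spaces, and assume that either (i) there exists a coarse solvent map $X\to Y$, or (ii) there exists a uniformly continuous almost uncollapsed map $X\to Y$. Then: (a) if $Y$ is reflexive, then $X$ is reflexive or $X$ has a spreading model equivalent to the $\ell_1$-basis; (b) if $Y$ is super-reflexive, then $X$ is super-reflexive or $X$ has trivial type.
   Context: All Banach spaces are over the reals. Let $f:(M,d)\to(N,\partial)$ be a map between metric spaces. Set $\omega_f(t)=\sup\{\partial(f(x),f(y)): d(x,y)\le t\}$ and $\overline{\rho}_f(t)=\inf\{\partial(f(x),f(y)): d(x,y)=t\}$ for $t\ge 0$ (with $\inf\emptyset=+\infty$). The map $f$ is coarse if $\omega_f(t)<\infty$ for all $t\ge0$; solvent if for each $n\in\mathbb{N}$ there is $R>0$ such that for all $x,y\in M$, $d(x,y)\in[R,R+n]$ implies $\partial(f(x),f(y))>n$; almost uncollapsed if $\overline{\rho}_f(t)>0$ for some $t>0$. A Banach space $X$ has type $p\in(1,2]$ if there is $T>0$ such that for all $n$ and all $x_1,\dots,x_n\in X$, $\mathbb{E}_\varepsilon\|\sum_{j}\varepsilon_jx_j\|^p\le T^p\sum_{j}\|x_j\|^p$, with expectation over uniformly chosen signs $\varepsilon\in\{-1,1\}^n$; $X$ has trivial type if it has type $p$ for no $p\in(1,2]$. $X$ is super-reflexive if every ultrapower of $X$ is reflexive. A sequence $(e_j)_j$ in a (semi)normed space is a spreading model of $X$ if it is generated by a bounded sequence $(x_n)_n$ in $X$, i.e. for all $k$ and all scalars $a_1,\dots,a_k$, $\|\sum_{j=1}^ka_je_j\|=\lim_{n_1<\dots<n_k,\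 n_1\to\infty}\|\sum_{j=1}^ka_jx_{n_j}\|$; it is equivalent to the $\ell_1$-basis if there is $c>0$ with $\|\sum_{j=1}^k a_je_j\|\ge c\sum_{j=1}^k|a_j|$ for all $k$ and all scalars. *)

theory Defs
  imports "HOL-Analysis.Analysis" "HOL-Analysis.Finite_Function_Topology"
    "HOL-Library.Infinite_Typeclass"
begin

definition expansion_modulus :: "('a::metric_space \<Rightarrow> 'b::metric_space) \<Rightarrow> real \<Rightarrow> ereal" where
  "expansion_modulus f t = Sup {ereal (dist (f x) (f y)) | x y. dist x y \<le> t}"

text \<open>In \<^typ>\<open>ereal\<close>, the infimum of the empty set is \<open>\<infinity>\<close>.\<close>

definition exact_compression_modulus ::
    "('a::metric_space \<Rightarrow> 'b::metric_space) \<Rightarrow> real \<Rightarrow> ereal" where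
  "exact_compression_modulus f t = Inf {ereal (dist (f x) (f y)) | x y. dist x y = t}"

definition coarse_map :: "('a::metric_space \<Rightarrow> 'b::metric_space) \<Rightarrow> bool" where
  "coarse_map f \<longleftrightarrow> (\<forall>t\<ge>0. expansion_modulus f t < \<infinity>)"

definition solvent_map :: "('a::metric_space \<Rightarrow> 'b::metric_space) \<Rightarrow> bool" where
  "solvent_map f \<longleftrightarrow>
     (\<forall>n::nat. \<exists>R>0. \<forall>x y. dist x y \<in> {R..R + real n} \<longrightarrow> dist (f x) (f y) > real n)"

definition almost_uncollapsed :: "('a::metric_space \<Rightarrow> 'b::metric_space) \<Rightarrow> bool" where
  "almost_uncollapsed f \<longleftrightarrow> (\<exists>t>0. exact_compression_modulus f t > 0)"

text \<open>An ultrapower depends on the ultrafilter, so it cannot be a type. Normed spaces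
  are therefore also represented by records with an explicit carrier.\<close>

record 'v nspace =
  ncarrier :: "'v set"
  nadd :: "'v \<Rightarrow> 'v \<Rightarrow> 'v"
  nscale :: "real \<Rightarrow> 'v \<Rightarrow> 'v"
  nnorm :: "'v \<Rightarrow> real"

definition space_of :: "'a::real_normed_vector itself \<Rightarrow> 'a nspace" where
  "space_of _ = \<lparr>ncarrier = UNIV, nadd = (+), nscale = (*\<^sub>R), nnorm = norm\<rparr>"

text \<open>Functionals are \<^const>\<open>extensional\<close> outside the carrier, so that two functionals which
  agree on the space are equal.\<close>

definition bounded_functional :: "'v nspace \<Rightarrow> ('v \<Rightarrow> real) \<Rightarrow> bool" where
  "bounded_functional V f \<longleftrightarrow>
     f \<in> extensional (ncarrier V) \<and>
     (\<forall>x\<in>ncarrier V. \<forall>y\<in>ncarrier V. f (nadd V x y) = f x + f y) \<and>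
     (\<forall>c. \<forall>x\<in>ncarrier V. f (nscale V c x) = c * f x) \<and>
     (\<exists>C. \<forall>x\<in>ncarrier V. \<bar>f x\<bar> \<le> C * nnorm V x)"

definition dual_space :: "'v nspace \<Rightarrow> ('v \<Rightarrow> real) nspace" where
  "dual_space V =
     \<lparr>ncarrier = {f. bounded_functional V f},
      nadd = (\<lambda>f g. restrict (\<lambda>x. f x + g x) (ncarrier V)),
      nscale = (\<lambda>c f. restrict (\<lambda>x. c * f x) (ncarrier V)),
      nnorm = (\<lambda>f. SUP x\<in>{x\<in>ncarrier V. nnorm V x \<le> 1}. \<bar>f x\<bar>)\<rparr>"

definition reflexive_space :: "'v nspace \<Rightarrow> bool" where
  "reflexive_space V \<longleftrightarrow>
     (\<forall>\<phi>\<in>ncarrier (dual_space (dual_space V)).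
        \<exists>x\<in>ncarrier V. \<forall>f\<in>ncarrier (dual_space V). \<phi> f = f x)"

definition reflexive :: "'a::real_normed_vector itself \<Rightarrow> bool" where
  "reflexive X \<longleftrightarrow> reflexive_space (space_of X)"

text \<open>For a type, this is surjectivity of the canonical embedding into the bidual
  formed with \<^type>\<open>blinfun\<close>.\<close>

lemma bounded_functional_space_of:
  "bounded_functional (space_of TYPE('a::real_normed_vector)) f \<longleftrightarrow> bounded_linear f"
proof
  assume "bounded_functional (space_of TYPE('a)) f"
  then obtain C where "\<And>x y. f (x + y) = f x + f y" "\<And>c x. f (c *\<^sub>R x) = c * f x"
    "\<And>x. \<bar>f x\<bar> \<le> C * norm x"
    by (auto simp: bounded_functional_def space_of_def)
  then show "bounded_linear f"
    by (intro bounded_linear_intro[where K = C]) (auto simp: mult.commute)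
next
  assume f: "bounded_linear f"
  interpret bounded_linear f by (rule f)
  obtain K where "\<And>x. norm (f x) \<le> norm x * K" using bounded by auto
  then show "bounded_functional (space_of TYPE('a)) f"
    by (auto simp: bounded_functional_def space_of_def add scale mult.commute intro!: exI[of _ K])
qed

lemma nnorm_dual_space_of:
  fixes f :: "'a::real_normed_vector \<Rightarrow>\<^sub>L real"
  shows "nnorm (dual_space (space_of TYPE('a))) (blinfun_apply f) = norm f"
proof -
  let ?S = "(\<lambda>x. \<bar>blinfun_apply f x\<bar>) ` {x. norm x \<le> 1}"
  have bd: "\<bar>blinfun_apply f x\<bar> \<le> norm f" if "norm x \<le> 1" for x
    using norm_blinfun[of f x] that mult_left_le[of "norm x" "norm f"] by simp
  have "norm f \<le> Sup ?S"
  proof (rule norm_blinfun_bound)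
    show "0 \<le> Sup ?S"
      using bd by (intro cSup_upper2[of "\<bar>blinfun_apply f 0\<bar>"] bdd_aboveI[of _ "norm f"] imageI) auto
    fix x
    show "norm (blinfun_apply f x) \<le> Sup ?S * norm x"
    proof (cases "x = 0")
      case False
      have "\<bar>blinfun_apply f (x /\<^sub>R norm x)\<bar> \<le> Sup ?S"
        using bd False by (intro cSup_upper bdd_aboveI[of _ "norm f"] imageI) auto
      with False show ?thesis by (simp add: blinfun.scaleR_right abs_mult field_simps)
    qed simp
  qed
  moreover have "Sup ?S \<le> norm f"
    using bd by (intro cSup_least) (auto intro: exI[of _ "0 :: 'a"])
  ultimately show ?thesis by (simp add: dual_space_def space_of_def)
qed

lemma reflexive_iff_blinfun:
  "reflexive TYPE('a::real_normed_vector) \<longleftrightarrow>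
     (\<forall>\<phi> :: ('a \<Rightarrow>\<^sub>L real) \<Rightarrow>\<^sub>L real. \<exists>x. \<forall>f. blinfun_apply \<phi> f = blinfun_apply f x)"
  (is "_ \<longleftrightarrow> ?R")
proof -
  let ?V = "space_of TYPE('a)"
  let ?D = "dual_space ?V"
  have car: "ncarrier ?D = {f. bounded_linear f}"
    by (simp add: dual_space_def bounded_functional_space_of)
  have add: "nadd ?D f g = (\<lambda>x. f x + g x)" and scl: "nscale ?D c f = (\<lambda>x. c * f x)" for f g c
    by (auto simp: dual_space_def space_of_def)
  show ?thesis
  proof
    assume L: "reflexive TYPE('a)"
    show ?R
    proof
      fix \<phi> :: "('a \<Rightarrow>\<^sub>L real) \<Rightarrow>\<^sub>L real"
      define \<psi> where "\<psi> = restrict (\<lambda>f. blinfun_apply \<phi> (Blinfun f)) {f. bounded_linear f}"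
      have "bounded_functional ?D \<psi>"
        unfolding bounded_functional_def car add scl
      proof (intro conjI ballI allI exI[of _ "norm \<phi>"])
        show "\<psi> \<in> extensional {f. bounded_linear f}" by (simp add: \<psi>_def)
      next
        fix f g :: "'a \<Rightarrow> real"
        assume fg: "f \<in> {f. bounded_linear f}" "g \<in> {f. bounded_linear f}"
        then have "Blinfun (\<lambda>x. f x + g x) = Blinfun f + Blinfun g"
          by (auto intro!: blinfun_eqI
              simp: blinfun.add_left bounded_linear_Blinfun_apply bounded_linear_add)
        with fg show "\<psi> (\<lambda>x. f x + g x) = \<psi> f + \<psi> g"
          by (simp add: \<psi>_def bounded_linear_add blinfun.add_right)
      next
        fix c and f :: "'a \<Rightarrow> real"
        assume f: "f \<in> {f. bounded_linear f}"
        have bl: "bounded_linear (\<lambda>x. c * f x)"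
          using f by (auto intro: bounded_linear_const_mult)
        then have "Blinfun (\<lambda>x. c * f x) = c *\<^sub>R Blinfun f"
          using f by (auto intro!: blinfun_eqI
              simp: blinfun.scaleR_left bounded_linear_Blinfun_apply)
        with f bl show "\<psi> (\<lambda>x. c * f x) = c * \<psi> f"
          by (simp add: \<psi>_def blinfun.scaleR_right)
      next
        fix f :: "'a \<Rightarrow> real"
        assume f: "f \<in> {f. bounded_linear f}"
        then have "nnorm ?D f = norm (Blinfun f)"
          using nnorm_dual_space_of[of "Blinfun f"] by (simp add: bounded_linear_Blinfun_apply)
        with f norm_blinfun[of \<phi> "Blinfun f"] show "\<bar>\<psi> f\<bar> \<le> norm \<phi> * nnorm ?D f"
          by (simp add: \<psi>_def)
      qed
      then have "\<psi> \<in> ncarrier (dual_space ?D)"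
        by (simp add: dual_space_def[of ?D])
      with L obtain x where x: "\<And>f. f \<in> ncarrier ?D \<Longrightarrow> \<psi> f = f x"
        unfolding reflexive_def reflexive_space_def by blast
      have "blinfun_apply \<phi> f = blinfun_apply f x" for f
        using x[of "blinfun_apply f"]
        by (simp add: car \<psi>_def blinfun.bounded_linear_right blinfun_apply_inverse)
      then show "\<exists>x. \<forall>f. blinfun_apply \<phi> f = blinfun_apply f x" by blast
    qed
  next
    assume R: ?R
    show "reflexive TYPE('a)"
      unfolding reflexive_def reflexive_space_def
    proof
      fix \<psi> assume "\<psi> \<in> ncarrier (dual_space ?D)"
      then have "bounded_functional ?D \<psi>" by (simp add: dual_space_def[of ?D])
      then obtain C where \<psi>:
        "\<And>f g. bounded_linear f \<Longrightarrow> bounded_linear g \<Longrightarrow> \<psi> (\<lambda>x. f x + g x) = \<psi> f + \<psi> g"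
        "\<And>c f. bounded_linear f \<Longrightarrow> \<psi> (\<lambda>x. c * f x) = c * \<psi> f"
        "\<And>f. bounded_linear f \<Longrightarrow> \<bar>\<psi> f\<bar> \<le> C * nnorm ?D f"
        unfolding bounded_functional_def car add scl by auto
      have bl: "bounded_linear (\<lambda>f. \<psi> (blinfun_apply f))"
      proof (rule bounded_linear_intro[where K = C])
        fix f g :: "'a \<Rightarrow>\<^sub>L real" and c :: real
        show "\<psi> (blinfun_apply (f + g)) = \<psi> (blinfun_apply f) + \<psi> (blinfun_apply g)"
          using \<psi>(1)[OF blinfun.bounded_linear_right blinfun.bounded_linear_right, of f g]
          by (simp add: plus_blinfun.rep_eq)
        show "\<psi> (blinfun_apply (c *\<^sub>R f)) = c *\<^sub>R \<psi> (blinfun_apply f)"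
          using \<psi>(2)[OF blinfun.bounded_linear_right, of c f]
          by (simp add: scaleR_blinfun.rep_eq)
        show "norm (\<psi> (blinfun_apply f)) \<le> norm f * C"
          using \<psi>(3)[OF blinfun.bounded_linear_right, of f]
          by (simp add: nnorm_dual_space_of mult.commute)
      qed
      from R obtain x where x: "\<And>f. blinfun_apply (Blinfun (\<lambda>f. \<psi> (blinfun_apply f))) f = blinfun_apply f x"
        by blast
      have "\<psi> f = f x" if "bounded_linear f" for f
        using x[of "Blinfun f"] that by (simp add: bounded_linear_Blinfun_apply bl)
      then show "\<exists>x\<in>ncarrier ?V. \<forall>f\<in>ncarrier ?D. \<psi> f = f x"
        unfolding car by (intro bexI[of _ x]) (auto simp: space_of_def)
    qed
  qed
qed

definition is_ultrafilter :: "'i filter \<Rightarrow> bool" where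
  "is_ultrafilter U \<longleftrightarrow>
     U \<noteq> bot \<and> (\<forall>P. eventually P U \<or> eventually (\<lambda>i. \<not> P i) U)"

definition ultrapower_rel ::
    "'i filter \<Rightarrow> (('i \<Rightarrow> 'a::real_normed_vector) \<times> ('i \<Rightarrow> 'a)) set" where
  "ultrapower_rel U =
     {(x, y). bounded (range x) \<and> bounded (range y) \<and> ((\<lambda>i. norm (x i - y i)) \<longlongrightarrow> 0) U}"

text \<open>The quotient of the bounded families by the \<open>U\<close>-null families, normed by the
  limit of \<open>\<parallel>x\<^sub>i\<parallel>\<close> along \<open>U\<close>.\<close>

definition ultrapower :: "'i filter \<Rightarrow> ('i \<Rightarrow> 'a::real_normed_vector) set nspace" where
  "ultrapower U =
     \<lparr>ncarrier = {x. bounded (range x)} // ultrapower_rel U,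
      nadd = (\<lambda>A B. \<Union>x\<in>A. \<Union>y\<in>B. ultrapower_rel U `` {\<lambda>i. x i + y i}),
      nscale = (\<lambda>c A. \<Union>x\<in>A. ultrapower_rel U `` {\<lambda>i. c *\<^sub>R x i}),
      nnorm = (\<lambda>A. THE r. \<forall>x\<in>A. ((\<lambda>i. norm (x i)) \<longlongrightarrow> r) U)\<rparr>"

lemma ultrafilter_tendsto:
  fixes g :: "'i \<Rightarrow> real"
  assumes "is_ultrafilter U" "bounded (range g)"
  shows "\<exists>r. (g \<longlongrightarrow> r) U"
proof -
  obtain B where B: "\<And>i. \<bar>g i\<bar> \<le> B" using assms(2) by (auto simp: bounded_iff)
  let ?F = "filtermap g U"
  have "?F \<noteq> bot" using assms(1) by (simp add: is_ultrafilter_def filtermap_bot_iff)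
  moreover have "eventually (\<lambda>t. t \<in> {-B..B}) ?F"
    using B by (auto simp: eventually_filtermap abs_le_iff minus_le_iff)
  ultimately obtain r where r: "inf (nhds r) ?F \<noteq> bot"
    using compact_Icc[of "-B" B] unfolding compact_filter by blast
  have "eventually (\<lambda>i. g i \<in> S) U" if S: "open S" "r \<in> S" for S
  proof (rule ccontr)
    assume "\<not> ?thesis"
    then have "eventually (\<lambda>i. g i \<notin> S) U" using assms(1) unfolding is_ultrafilter_def by blast
    then have "eventually (\<lambda>t. t \<notin> S) ?F" by (simp add: eventually_filtermap)
    moreover have "eventually (\<lambda>t. t \<in> S) (nhds r)" using S by (rule eventually_nhds_in_open)
    ultimately have "inf (nhds r) ?F = bot"
      unfolding trivial_limit_def eventually_inf by blast
    with r show False by simp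
  qed
  then show ?thesis by (intro exI[of _ r] topological_tendstoI) auto
qed

lemma equiv_ultrapower_rel:
  "equiv {x :: 'i \<Rightarrow> 'a::real_normed_vector. bounded (range x)} (ultrapower_rel U)"
proof (rule equivI)
  show "ultrapower_rel U \<subseteq> {x. bounded (range x)} \<times> {x. bounded (range x)}"
    by (auto simp: ultrapower_rel_def)
  show "refl_on {x. bounded (range x)} (ultrapower_rel U)"
    by (auto simp: refl_on_def ultrapower_rel_def)
  show "sym (ultrapower_rel U)"
    by (auto simp: sym_def ultrapower_rel_def norm_minus_commute)
  show "trans (ultrapower_rel U :: (('i \<Rightarrow> 'a) \<times> ('i \<Rightarrow> 'a)) set)"
  proof (rule transI)
    fix x y z :: "'i \<Rightarrow> 'a"
    assume xy: "(x, y) \<in> ultrapower_rel U" and yz: "(y, z) \<in> ultrapower_rel U"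
    have tri: "norm (x i - z i) \<le> norm (x i - y i) + norm (y i - z i)" for i
      using norm_triangle_ineq[of "x i - y i" "y i - z i"] by simp
    have "((\<lambda>i. norm (x i - y i) + norm (y i - z i)) \<longlongrightarrow> 0) U"
      using xy yz by (auto simp: ultrapower_rel_def intro: tendsto_add_zero)
    then have "((\<lambda>i. norm (x i - z i)) \<longlongrightarrow> 0) U"
      by (rule Lim_null_comparison[rotated])
         (auto intro!: always_eventually tri)
    with xy yz show "(x, z) \<in> ultrapower_rel U" by (simp add: ultrapower_rel_def)
  qed
qed

lemma nadd_ultrapower:
  fixes x y :: "'i \<Rightarrow> 'a::real_normed_vector"
  assumes "bounded (range x)" "bounded (range y)"
  shows "nadd (ultrapower U) (ultrapower_rel U `` {x}) (ultrapower_rel U `` {y}) =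
    ultrapower_rel U `` {\<lambda>i. x i + y i}"
proof -
  have "congruent2 (ultrapower_rel U) (ultrapower_rel U)
      (\<lambda>x y :: 'i \<Rightarrow> 'a. ultrapower_rel U `` {\<lambda>i. x i + y i})"
  proof (rule congruent2I')
    fix x x' y y' :: "'i \<Rightarrow> 'a"
    assume x: "(x, x') \<in> ultrapower_rel U" and y: "(y, y') \<in> ultrapower_rel U"
    have "((\<lambda>i. norm (x i - x' i) + norm (y i - y' i)) \<longlongrightarrow> 0) U"
      using x y by (auto simp: ultrapower_rel_def intro: tendsto_add_zero)
    then have "((\<lambda>i. norm ((x i + y i) - (x' i + y' i))) \<longlongrightarrow> 0) U"
      by (rule Lim_null_comparison[rotated])
         (auto intro!: always_eventually simp: norm_diff_triangle_ineq)
    moreover have "bounded (range (\<lambda>i. u i + v i))"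
      if "bounded (range u)" "bounded (range v)" for u v :: "'i \<Rightarrow> 'a"
      using that by (rule bounded_plus_comp)
    ultimately have "((\<lambda>i. x i + y i), (\<lambda>i. x' i + y' i)) \<in> ultrapower_rel U"
      using x y by (simp add: ultrapower_rel_def)
    then show "ultrapower_rel U `` {\<lambda>i. x i + y i} = ultrapower_rel U `` {\<lambda>i. x' i + y' i}"
      by (rule equiv_class_eq[OF equiv_ultrapower_rel])
  qed
  from UN_equiv_class2[OF equiv_ultrapower_rel equiv_ultrapower_rel this] assms
  show ?thesis by (simp add: ultrapower_def)
qed

lemma nscale_ultrapower:
  fixes x :: "'i \<Rightarrow> 'a::real_normed_vector"
  assumes "bounded (range x)"
  shows "nscale (ultrapower U) c (ultrapower_rel U `` {x}) = ultrapower_rel U `` {\<lambda>i. c *\<^sub>R x i}"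
proof -
  have "congruent (ultrapower_rel U) (\<lambda>x :: 'i \<Rightarrow> 'a. ultrapower_rel U `` {\<lambda>i. c *\<^sub>R x i})"
  proof (rule congruentI)
    fix x x' :: "'i \<Rightarrow> 'a"
    assume x: "(x, x') \<in> ultrapower_rel U"
    then have "((\<lambda>i. norm (c *\<^sub>R x i - c *\<^sub>R x' i)) \<longlongrightarrow> 0) U"
      using tendsto_mult_right_zero[of "\<lambda>i. norm (x i - x' i)" U "\<bar>c\<bar>"]
      by (simp add: ultrapower_rel_def flip: scaleR_diff_right)
    with x have "((\<lambda>i. c *\<^sub>R x i), (\<lambda>i. c *\<^sub>R x' i)) \<in> ultrapower_rel U"
      by (simp add: ultrapower_rel_def bounded_scaleR_comp)
    then show "ultrapower_rel U `` {\<lambda>i. c *\<^sub>R x i} = ultrapower_rel U `` {\<lambda>i. c *\<^sub>R x' i}"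
      by (rule equiv_class_eq[OF equiv_ultrapower_rel])
  qed
  from UN_equiv_class[OF equiv_ultrapower_rel this] assms
  show ?thesis by (simp add: ultrapower_def)
qed

lemma nnorm_ultrapower:
  fixes x :: "'i \<Rightarrow> 'a::real_normed_vector"
  assumes U: "is_ultrafilter U" and x: "bounded (range x)"
  shows "((\<lambda>i. norm (x i)) \<longlongrightarrow> nnorm (ultrapower U) (ultrapower_rel U `` {x})) U"
proof -
  have "bounded (range (\<lambda>i. norm (x i)))"
    using x by (auto simp: bounded_iff)
  then obtain r where r: "((\<lambda>i. norm (x i)) \<longlongrightarrow> r) U"
    using ultrafilter_tendsto[OF U] by blast
  have "\<forall>y\<in>ultrapower_rel U `` {x}. ((\<lambda>i. norm (y i)) \<longlongrightarrow> r) U"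
  proof
    fix y assume "y \<in> ultrapower_rel U `` {x}"
    then have "((\<lambda>i. norm (x i - y i)) \<longlongrightarrow> 0) U" by (simp add: ultrapower_rel_def)
    then have "((\<lambda>i. norm (y i) - norm (x i)) \<longlongrightarrow> 0) U"
      by (rule Lim_null_comparison[rotated])
         (auto intro!: always_eventually simp: norm_minus_commute[of "x _"] norm_triangle_ineq3)
    from tendsto_add[OF this r] show "((\<lambda>i. norm (y i)) \<longlongrightarrow> r) U" by simp
  qed
  moreover have "s = r" if "\<forall>y\<in>ultrapower_rel U `` {x}. ((\<lambda>i. norm (y i)) \<longlongrightarrow> s) U" for s
  proof -
    have "x \<in> ultrapower_rel U `` {x}" using x by (simp add: ultrapower_rel_def)
    with that have "((\<lambda>i. norm (x i)) \<longlongrightarrow> s) U" by blast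
    with r U show ?thesis using tendsto_unique by (auto simp: is_ultrafilter_def)
  qed
  ultimately have "(THE s. \<forall>y\<in>ultrapower_rel U `` {x}. ((\<lambda>i. norm (y i)) \<longlongrightarrow> s) U) = r"
    by (rule the_equality)
  then have "nnorm (ultrapower U) (ultrapower_rel U `` {x}) = r"
    unfolding ultrapower_def nspace.simps .
  with r show ?thesis by simp
qed

text \<open>HOL cannot quantify over all index types inside a formula, so the index type is a
  parameter; super-reflexivity proper is the conjunction over all index types. Index sets
  smaller than the type are covered by ultrafilters concentrated on a subset. Over a finite type every ultrapower is
  the space itself, so as a hypothesis the notion is only meaningful for infinite types.\<close>

definition super_reflexive ::
    "'i itself \<Rightarrow> 'a::real_normed_vector itself \<Rightarrow> bool" where
  "super_reflexive I X \<longleftrightarrow>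
     (\<forall>U :: 'i filter. is_ultrafilter U \<longrightarrow>
        reflexive_space (ultrapower U :: ('i \<Rightarrow> 'a) set nspace))"

text \<open>Signs are functions on \<open>{..<n}\<close> with values in \<open>{-1, 1}\<close>; there are \<open>2 ^ n\<close> of them.\<close>

definition has_type :: "real \<Rightarrow> 'a::real_normed_vector itself \<Rightarrow> bool" where
  "has_type p X \<longleftrightarrow>
     (\<exists>T>0. \<forall>n. \<forall>x :: nat \<Rightarrow> 'a.
        (\<Sum>\<epsilon>\<in>{..<n} \<rightarrow>\<^sub>E {-1, 1}. norm (\<Sum>j<n. \<epsilon> j *\<^sub>R x j) powr p) / 2 ^ n
          \<le> T powr p * (\<Sum>j<n. norm (x j) powr p))"

definition trivial_type :: "'a::real_normed_vector itself \<Rightarrow> bool" where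
  "trivial_type X \<longleftrightarrow> \<not> (\<exists>p. 1 < p \<and> p \<le> 2 \<and> has_type p X)"

definition is_seminorm :: "('e::real_vector \<Rightarrow> real) \<Rightarrow> bool" where
  "is_seminorm \<nu> \<longleftrightarrow>
     (\<forall>a b. \<nu> (a + b) \<le> \<nu> a + \<nu> b) \<and> (\<forall>c a. \<nu> (c *\<^sub>R a) = \<bar>c\<bar> * \<nu> a)"

definition generates_spreading_model ::
    "(nat \<Rightarrow> 'a::real_normed_vector) \<Rightarrow> ('e::real_vector \<Rightarrow> real) \<Rightarrow> (nat \<Rightarrow> 'e) \<Rightarrow> bool" where
  "generates_spreading_model x \<nu> e \<longleftrightarrow>
     bounded (range x) \<and> is_seminorm \<nu> \<and>
     (\<forall>k. \<forall>a :: nat \<Rightarrow> real. \<forall>\<delta>>0. \<exists>m. \<forall>n :: nat \<Rightarrow> nat.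
        strict_mono_on {..<k} n \<and> (\<forall>j<k. m \<le> n j) \<longrightarrow>
        \<bar>norm (\<Sum>j<k. a j *\<^sub>R x (n j)) - \<nu> (\<Sum>j<k. a j *\<^sub>R e j)\<bar> < \<delta>)"

definition equivalent_l1_basis :: "('e::real_vector \<Rightarrow> real) \<Rightarrow> (nat \<Rightarrow> 'e) \<Rightarrow> bool" where
  "equivalent_l1_basis \<nu> e \<longleftrightarrow>
     (\<exists>c>0. \<forall>k. \<forall>a :: nat \<Rightarrow> real. \<nu> (\<Sum>j<k. a j *\<^sub>R e j) \<ge> c * (\<Sum>j<k. \<bar>a j\<bar>))"

text \<open>The ambient seminormed space is taken to be the space of finitely supported real
  sequences with an arbitrary seminorm. This loses nothing: a sequence \<open>e\<close> in any seminormed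
  space can be replaced by the unit vectors, with the seminorm
  \<open>a \<mapsto> \<nu> (\<Sum>j. a j *\<^sub>R e j)\<close>.\<close>

definition has_l1_spreading_model :: "'a::real_normed_vector itself \<Rightarrow> bool" where
  "has_l1_spreading_model X \<longleftrightarrow>
     (\<exists>(x :: nat \<Rightarrow> 'a) (\<nu> :: (nat, real) poly_mapping \<Rightarrow> real) e.
        generates_spreading_model x \<nu> e \<and> equivalent_l1_basis \<nu> e)"

end

theory Submission
  imports Defs "HOL-Library.Ramsey" "HOL-Library.Diagonal_Subsequence"
    "HOL-Probability.Discrete_Topology"
begin

text \<open>
  Suppose that \<open>X\<close> is not reflexive. By James it contains a bounded sequence \<open>x\<close> whose separated
  differences \<open>x n\<^sub>1 + \<dots> + x n\<^sub>k - (x m\<^sub>1 + \<dots> + x m\<^sub>k)\<close>, with all \<open>n\<^sub>i\<close> before all \<open>m\<^sub>i\<close>, have norm at least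
  a multiple of \<open>k\<close>. Compare them with the interlaced ones, where \<open>n\<^sub>1 < m\<^sub>1 < n\<^sub>2 < m\<^sub>2 < \<dots>\<close>. After
  passing to a subsequence with a spreading model, either the norms of the interlaced differences
  grow linearly in \<open>k\<close>, and then the consecutive differences \<open>x (2 * n) - x (2 * n + 1)\<close> generate a
  spreading model equivalent to the \<open>\<ell>\<^sub>1\<close>-basis, or for suitable \<open>k\<close> they are arbitrarily small compared
  with the separated ones. This is \<open>nonreflexive_alternative\<close>.

  In the second case the sums of \<open>k\<close> terms can be scaled so that interlaced sums are very close and
  separated sums are at a prescribed distance \<open>t\<close>. A map \<open>f\<close> as in either hypothesis, with \<open>t\<close>
  chosen for \<open>f\<close>, takes interlaced sums to points at distance at most \<open>W\<close>, and separated ones to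
  points at distance more than \<open>2 * W\<close> (\<open>separating_map\<close>). A reflexive target does not allow
  this, by Kalton's argument in \<open>interlaced_close_imp_separated_close\<close>: let \<open>L\<close> be the iterated weak
  limit of the images \<open>F n\<close> of \<open>k\<close>-tuples \<open>n\<close> along an ultrafilter and let \<open>\<phi> n\<close> be a functional norming
  \<open>F n - L\<close>. For interlaced \<open>n\<close> and \<open>m\<close> the numbers \<open>\<phi> n (F n - F m)\<close> are at most \<open>W\<close>, while the
  iterated limits of \<open>\<phi> n (F m)\<close> and of \<open>\<phi> n L\<close> agree. Hence \<open>F n\<close> is within about \<open>W\<close> of \<open>L\<close>
  for most \<open>n\<close>, and two separated tuples of this kind have images at distance about \<open>2 * W\<close> at most.
  This proves (a).

  For (b), suppose that an ultrapower of \<open>X\<close> is not reflexive and apply the alternative to it. In the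
  first case \<open>X\<close> contains, for every \<open>k\<close>, vectors \<open>x\<^sub>1, \<dots>, x\<^sub>k\<close> of norm at most \<open>2\<close> all of
  whose signed sums have norm at least a fixed multiple of \<open>k\<close>, so \<open>X\<close> has trivial type. In the second case the
  tuples in the ultrapower are approximated by tuples in \<open>X\<close>, finitely many at a time, and their images
  under \<open>f\<close> are reassembled in an ultrapower of \<open>Y\<close>, which is reflexive.

  Ultrapowers and Banach spaces are handled together by working with a seminorm on a real vector
  space, such as the limit seminorm on bounded families, instead of with its quotient.
\<close>

section \<open>Seminorms and the Hahn-Banach theorem\<close>

lemma is_seminormD:
  assumes "is_seminorm p"
  shows "p (a + b) \<le> p a + p b" "p (c *\<^sub>R a) = \<bar>c\<bar> * p a" "p 0 = 0" "p (- a) = p a"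
    "0 \<le> p a" "p (a - b) \<le> p a + p b" "p (a - b) = p (b - a)" "\<bar>p a - p b\<bar> \<le> p (a - b)"
proof -
  have tri: "p (u + v) \<le> p u + p v" and hom: "p (r *\<^sub>R u) = \<bar>r\<bar> * p u" for u v r
    using assms unfolding is_seminorm_def by auto
  show "p (a + b) \<le> p a + p b" "p (c *\<^sub>R a) = \<bar>c\<bar> * p a"
    by (rule tri hom)+
  show zero: "p 0 = 0" using hom[of 0 0] by simp
  have minus: "p (- u) = p u" for u using hom[of "- 1" u] by simp
  then show "p (- a) = p a" .
  show "0 \<le> p a" using tri[of a "- a"] by (simp add: minus zero)
  show "p (a - b) \<le> p a + p b" using tri[of a "- b"] by (simp add: minus)
  show "p (a - b) = p (b - a)" using minus[of "a - b"] by simp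
  then show "\<bar>p a - p b\<bar> \<le> p (a - b)"
    using tri[of "a - b" b] tri[of "b - a" a] by auto
qed

lemma is_seminorm_norm: "is_seminorm (norm :: 'a::real_normed_vector \<Rightarrow> real)"
  by (simp add: is_seminorm_def norm_triangle_ineq)

lemma is_seminorm_sum:
  assumes "is_seminorm p"
  shows "p (\<Sum>i\<in>A. f i) \<le> (\<Sum>i\<in>A. p (f i))"
proof (induction A rule: infinite_finite_induct)
  case (insert i A)
  then show ?case using is_seminormD(1)[OF assms, of "f i" "sum f A"] by simp
qed (simp_all add: is_seminormD(3)[OF assms])

definition sublinear :: "('v::real_vector \<Rightarrow> real) \<Rightarrow> bool" where
  "sublinear q \<longleftrightarrow> (\<forall>x y. q (x + y) \<le> q x + q y) \<and> (\<forall>c x. 0 \<le> c \<longrightarrow> q (c *\<^sub>R x) = c * q x)"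

lemma sublinearD:
  assumes "sublinear q"
  shows "q (x + y) \<le> q x + q y" "0 \<le> c \<Longrightarrow> q (c *\<^sub>R x) = c * q x" "q 0 = 0" "- q (- x) \<le> q x"
proof -
  have *: "q (x + y) \<le> q x + q y" "0 \<le> c \<Longrightarrow> q (c *\<^sub>R x) = c * q x" for x y c
    using assms unfolding sublinear_def by auto
  then show "q (x + y) \<le> q x + q y" "0 \<le> c \<Longrightarrow> q (c *\<^sub>R x) = c * q x" by auto
  show z: "q 0 = 0" using *(2)[of 0 0] by simp
  show "- q (- x) \<le> q x" using *(1)[of x "- x"] z by simp
qed

lemma sublinear_seminorm: "is_seminorm p \<Longrightarrow> sublinear p"
  by (simp add: sublinear_def is_seminormD)

text \<open>By subadditivity \<open>q (x + t *\<^sub>R z) - t * q z\<close> is at most \<open>q x\<close>. Its infimum over \<open>t \<ge> 0\<close> is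
  again sublinear, and \<open>t = 1\<close> gives the value \<open>- q z\<close> at \<open>- z\<close>. This turns \<open>q\<close> into a functional
  that behaves linearly in the direction \<open>z\<close>.\<close>
lemma sublinear_push_down:
  fixes q :: "'v::real_vector \<Rightarrow> real"
  assumes q: "sublinear q"
  obtains r where "sublinear r" "\<And>x. r x \<le> q x" "r (- z) \<le> - q z"
proof
  let ?S = "\<lambda>x. (\<lambda>t. q (x + t *\<^sub>R z) - t * q z) ` {0..}"
  define r where "r x = Inf (?S x)" for x
  have lower: "- q (- x) \<le> q (x + t *\<^sub>R z) - t * q z" if "0 \<le> t" for x t
    using sublinearD(1)[OF q, of "x + t *\<^sub>R z" "- x"] sublinearD(2)[OF q that, of z] by simp
  have bdd: "bdd_below (?S x)" for x
    by (rule bdd_belowI[of _ "- q (- x)"]) (use lower in auto)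
  have r_le: "r x \<le> q (x + t *\<^sub>R z) - t * q z" if "0 \<le> t" for x t
    unfolding r_def by (rule cInf_lower) (use that bdd in auto)
  have le_r: "c \<le> r x" if "\<And>t. 0 \<le> t \<Longrightarrow> c \<le> q (x + t *\<^sub>R z) - t * q z" for c x
    unfolding r_def by (rule cInf_greatest) (use that in auto)
  show rq: "r x \<le> q x" for x using r_le[of 0 x] by simp
  show "r (- z) \<le> - q z" using r_le[of 1 "- z"] by (simp add: sublinearD(3)[OF q])
  have add: "r (x + y) \<le> r x + r y" for x y
  proof -
    have step: "r (x + y) - (q (y + u *\<^sub>R z) - u * q z) \<le> r x" if u: "0 \<le> u" for u
    proof (rule le_r)
      fix t :: real assume "0 \<le> t"
      then show "r (x + y) - (q (y + u *\<^sub>R z) - u * q z) \<le> q (x + t *\<^sub>R z) - t * q z"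
        using r_le[of "t + u" "x + y"] u
          sublinearD(1)[OF q, of "x + t *\<^sub>R z" "y + u *\<^sub>R z"]
        by (simp add: algebra_simps)
    qed
    have "r (x + y) - r x \<le> r y" by (rule le_r) (use step in \<open>auto simp: algebra_simps\<close>)
    then show ?thesis by simp
  qed
  have zero: "r 0 = 0"
  proof (rule antisym)
    show "r 0 \<le> 0" using rq[of 0] by (simp add: sublinearD(3)[OF q])
    show "0 \<le> r 0" by (rule le_r) (simp add: sublinearD(2)[OF q])
  qed
  have hom_le: "r (c *\<^sub>R x) \<le> c * r x" if c: "0 < c" for c x
  proof -
    have "r (c *\<^sub>R x) / c \<le> r x"
    proof (rule le_r)
      fix t :: real assume t: "0 \<le> t"
      have "r (c *\<^sub>R x) \<le> q (c *\<^sub>R (x + t *\<^sub>R z)) - (c * t) * q z"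
        using r_le[of "c * t" "c *\<^sub>R x"] c t by (simp add: scaleR_add_right)
      also have "\<dots> = c * (q (x + t *\<^sub>R z) - t * q z)"
        unfolding sublinearD(2)[OF q less_imp_le[OF c]] by (simp add: right_diff_distrib)
      finally show "r (c *\<^sub>R x) / c \<le> q (x + t *\<^sub>R z) - t * q z"
        using c by (simp add: field_simps)
    qed
    then show ?thesis using c by (simp add: field_simps)
  qed
  have "r (c *\<^sub>R x) = c * r x" if c: "0 \<le> c" for c x
  proof (cases "c = 0")
    case False
    with c have c: "0 < c" by simp
    have "r x \<le> r (c *\<^sub>R x) / c" using hom_le[of "1 / c" "c *\<^sub>R x"] c by simp
    with hom_le[OF c, of x] c show ?thesis by (simp add: field_simps)
  qed (simp add: zero)
  with add show "sublinear r" by (auto simp: sublinear_def)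
qed

text \<open>Infima of chains of sublinear functionals are sublinear, so Zorn's lemma gives a minimal
  one; it is linear because it cannot be pushed down further.\<close>
lemma linear_below_sublinear:
  fixes q :: "'v::real_vector \<Rightarrow> real"
  assumes q: "sublinear q"
  obtains g where "linear g" "\<And>x. g x \<le> q x"
proof -
  let ?A = "{r. sublinear r \<and> r \<le> q}"
  let ?P = "\<lambda>a b :: 'v \<Rightarrow> real. b \<le> a"
  have "\<exists>m\<in>?A. \<forall>a\<in>?A. ?P m a \<longrightarrow> a = m"
  proof (rule predicate_Zorn)
    show "partial_order_on ?A (relation_of ?P ?A)"
      by (auto simp: partial_order_on_def preorder_on_def refl_on_def trans_def antisym_def
          relation_of_def)
  next
    fix C assume "C \<in> Chains (relation_of ?P ?A)"
    then have sub: "C \<subseteq> ?A" and total: "\<And>a b. a \<in> C \<Longrightarrow> b \<in> C \<Longrightarrow> a \<le> b \<or> b \<le> a"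
      by (auto simp: Chains_def relation_of_def)
    show "\<exists>u\<in>?A. \<forall>a\<in>C. ?P a u"
    proof (cases "C = {}")
      case True
      then show ?thesis using q by auto
    next
      case False
      define r where "r x = (INF a\<in>C. a x)" for x
      have lower: "- q (- x) \<le> a x" if "a \<in> C" for a x
      proof -
        have "sublinear a" "a (- x) \<le> q (- x)" using sub that by (auto simp: le_fun_def)
        then show ?thesis using sublinearD(4)[of a x] by linarith
      qed
      have r_le: "r x \<le> a x" if "a \<in> C" for a x
        unfolding r_def by (rule cINF_lower) (use that lower in \<open>auto intro!: bdd_belowI\<close>)
      have le_r: "c \<le> r x" if "\<And>a. a \<in> C \<Longrightarrow> c \<le> a x" for c x
        unfolding r_def by (rule cINF_greatest) (use that False in auto)
      have add: "r (x + y) \<le> r x + r y" for x y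
      proof -
        have mixed: "r (x + y) \<le> a x + b y" if ab: "a \<in> C" "b \<in> C" for a b
        proof -
          obtain c where c: "c \<in> C" "c \<le> a" "c \<le> b" using total[OF ab] ab by auto
          have "r (x + y) \<le> c x + c y"
            using r_le[OF c(1), of "x + y"] sublinearD(1)[of c x y] sub c(1) by auto
          also have "\<dots> \<le> a x + b y" using c by (intro add_mono) (auto simp: le_fun_def)
          finally show ?thesis .
        qed
        have "r (x + y) - b y \<le> r x" if "b \<in> C" for b
          by (rule le_r) (use mixed that in \<open>auto simp: algebra_simps\<close>)
        then have "r (x + y) - r x \<le> r y"
          by (intro le_r) (auto simp: algebra_simps)
        then show ?thesis by simp
      qed
      have hom: "r (c *\<^sub>R x) = c * r x" if c: "0 \<le> c" for c x
      proof (cases "c = 0")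
        case True
        have "(\<lambda>a. a (0::'v)) ` C = {0}" using False sub sublinearD(3) by force
        with True show ?thesis by (simp add: r_def)
      next
        case nz: False
        have ac: "a (c *\<^sub>R x) = c * a x" if "a \<in> C" for a
          using sub that sublinearD(2)[OF _ c] by auto
        show ?thesis
        proof (rule antisym)
          have "r (c *\<^sub>R x) / c \<le> r x"
            using r_le[of _ "c *\<^sub>R x"] ac c nz by (intro le_r) (simp add: field_simps)
          then show "r (c *\<^sub>R x) \<le> c * r x" using c nz by (simp add: field_simps)
          show "c * r x \<le> r (c *\<^sub>R x)"
          proof (rule le_r)
            fix a assume "a \<in> C"
            then show "c * r x \<le> a (c *\<^sub>R x)"
              using mult_left_mono[OF r_le c, of a x] ac[of a] by simp
          qed
        qed
      qed
      have "r \<le> q"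
      proof (rule le_funI)
        fix x
        obtain a where "a \<in> C" using False by blast
        then show "r x \<le> q x" using r_le[of a x] sub by (auto simp: le_fun_def intro: order_trans)
      qed
      then show ?thesis using add hom r_le by (intro bexI[of _ r]) (auto simp: sublinear_def le_fun_def)
    qed
  qed
  then obtain m where m: "sublinear m" "m \<le> q"
    and minimal: "\<And>r. sublinear r \<Longrightarrow> r \<le> m \<Longrightarrow> r = m"
    using order_trans by blast
  have odd: "m (- z) = - m z" for z
  proof -
    obtain r where r: "sublinear r" "\<And>x. r x \<le> m x" "r (- z) \<le> - m z"
      using sublinear_push_down[OF m(1)] by metis
    then have "r = m" by (intro minimal) (auto simp: le_fun_def)
    with r(3) sublinearD(4)[OF m(1), of z] show ?thesis by auto
  qed
  have "linear m"
  proof (rule linearI)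
    show "m (x + y) = m x + m y" for x y
      using sublinearD(1)[OF m(1), of x y] sublinearD(1)[OF m(1), of "- x" "- y"]
        odd[of x] odd[of y] odd[of "x + y"] by simp
    show "m (c *\<^sub>R x) = c *\<^sub>R m x" for c x
    proof (cases "0 \<le> c")
      case False
      have "m (c *\<^sub>R x) = - m ((- c) *\<^sub>R x)" using odd[of "c *\<^sub>R x"] by simp
      with False show ?thesis using sublinearD(2)[OF m(1), of "- c" x] by simp
    qed (simp add: sublinearD(2)[OF m(1)])
  qed
  with m(2) show thesis using that by (auto simp: le_fun_def)
qed

definition dual_ball :: "('v::real_vector \<Rightarrow> real) \<Rightarrow> real \<Rightarrow> ('v \<Rightarrow> real) set" where
  "dual_ball p r = {g. linear g \<and> (\<forall>x. \<bar>g x\<bar> \<le> r * p x)}"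

lemma dual_ballD:
  assumes "g \<in> dual_ball p r"
  shows "linear g" "\<bar>g x\<bar> \<le> r * p x" "g (x + y) = g x + g y" "g (x - y) = g x - g y"
    "g (c *\<^sub>R x) = c * g x" "g 0 = 0" "g (\<Sum>i\<in>A. f i) = (\<Sum>i\<in>A. g (f i))"
  using assms by (auto simp: dual_ball_def linear_add linear_diff linear_scale linear_0 linear_sum)

text \<open>Push the seminorm down to \<open>- p z\<close> at \<open>- z\<close> first: every linear functional below the result
  is then at least \<open>p z\<close> at \<open>z\<close>.\<close>
lemma Hahn_Banach_norming:
  fixes p :: "'v::real_vector \<Rightarrow> real"
  assumes p: "is_seminorm p"
  obtains g where "g \<in> dual_ball p 1" "g z = p z"
proof -
  obtain r where r: "sublinear r" "\<And>x. r x \<le> p x" "r (- z) \<le> - p z"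
    using sublinear_push_down[OF sublinear_seminorm[OF p]] by metis
  obtain g where g: "linear g" "\<And>x. g x \<le> r x"
    using linear_below_sublinear[OF r(1)] by blast
  have le: "g x \<le> p x" for x using g(2) r(2) order_trans by blast
  have "\<bar>g x\<bar> \<le> p x" for x
    using le[of x] le[of "- x"] by (auto simp: linear_neg[OF g(1)] is_seminormD(4)[OF p] abs_le_iff)
  moreover have "g z = p z"
    using le[of z] g(2)[of "- z"] r(3) by (auto simp: linear_neg[OF g(1)])
  ultimately show thesis using that g(1) by (auto simp: dual_ball_def)
qed

section \<open>Ultrafilters and their iterated products\<close>

lemma ultrafilter_finer:
  fixes F :: "'i filter"
  assumes "F \<noteq> bot"
  obtains U where "is_ultrafilter U" "U \<le> F"
proof -
  let ?A = "{G. G \<noteq> bot \<and> G \<le> F}"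
  let ?P = "\<lambda>a b :: 'i filter. b \<le> a"
  have "\<exists>m\<in>?A. \<forall>a\<in>?A. ?P m a \<longrightarrow> a = m"
  proof (rule predicate_Zorn)
    show "partial_order_on ?A (relation_of ?P ?A)"
      by (auto simp: partial_order_on_def preorder_on_def refl_on_def trans_def antisym_def
          relation_of_def)
  next
    fix C assume "C \<in> Chains (relation_of ?P ?A)"
    then have sub: "C \<subseteq> ?A" and total: "\<And>a b. a \<in> C \<Longrightarrow> b \<in> C \<Longrightarrow> a \<le> b \<or> b \<le> a"
      by (auto simp: Chains_def relation_of_def)
    show "\<exists>u\<in>?A. \<forall>a\<in>C. ?P a u"
    proof (cases "C = {}")
      case True
      then show ?thesis using assms by auto
    next
      case False
      have "\<not> eventually (\<lambda>_. False) (Inf C)"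
      proof (subst eventually_Inf_base)
        show "\<exists>x\<in>C. x \<le> inf a b" if "a \<in> C" "b \<in> C" for a b
          using total[OF that] that by auto
        show "\<not> (\<exists>b\<in>C. eventually (\<lambda>_. False) b)"
          using sub by (auto simp: eventually_False)
      qed (fact False)
      then have "Inf C \<noteq> bot" by (simp add: eventually_False)
      moreover have "Inf C \<le> F"
        using False sub by (auto intro: Inf_lower2)
      ultimately show ?thesis by (auto intro!: bexI[of _ "Inf C"] Inf_lower)
    qed
  qed
  then obtain U where U: "U \<noteq> bot" "U \<le> F"
    and minimal: "\<And>G. G \<noteq> bot \<Longrightarrow> G \<le> U \<Longrightarrow> G = U"
    by (auto intro: order_trans)
  have "eventually P U \<or> eventually (\<lambda>i. \<not> P i) U" for P
  proof (rule disjCI)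
    assume notP: "\<not> eventually (\<lambda>i. \<not> P i) U"
    let ?G = "inf U (principal {i. P i})"
    have "?G \<noteq> bot"
      using notP by (auto simp: trivial_limit_def eventually_inf_principal)
    then have "?G = U" by (intro minimal) auto
    moreover have "eventually P ?G" by (simp add: eventually_inf_principal)
    ultimately show "eventually P U" by simp
  qed
  with U that show thesis unfolding is_ultrafilter_def by blast
qed

lemma ultrafilter_limit:
  fixes g :: "'i \<Rightarrow> real"
  assumes "is_ultrafilter U" "\<And>i. \<bar>g i\<bar> \<le> B"
  obtains r where "(g \<longlongrightarrow> r) U"
  using ultrafilter_tendsto[OF assms(1), of g] assms(2) unfolding bounded_iff by auto

text \<open>The \<open>k\<close>-fold Fubini power of a filter, on lists of length \<open>k\<close>: a property holds eventually
  when it holds for \<open>U\<close>-almost all first entries, then for \<open>U\<close>-almost all second entries (depending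
  on the first), and so on. Limits along it are iterated limits along \<open>U\<close>.\<close>
primrec iter_filter :: "'i filter \<Rightarrow> nat \<Rightarrow> 'i list filter" where
  "iter_filter U 0 = principal {[]}"
| "iter_filter U (Suc k) =
    Abs_filter (\<lambda>P. eventually (\<lambda>n. eventually (\<lambda>l. P (n # l)) (iter_filter U k)) U)"

lemma eventually_iter_filter_0 [simp]: "eventually P (iter_filter U 0) \<longleftrightarrow> P []"
  by (simp add: eventually_principal)

lemma eventually_iter_filter_Suc [simp]:
  "eventually P (iter_filter U (Suc k)) \<longleftrightarrow>
    eventually (\<lambda>n. eventually (\<lambda>l. P (n # l)) (iter_filter U k)) U"
proof -
  have "is_filter (\<lambda>P. eventually (\<lambda>n. eventually (\<lambda>l. P (n # l)) (iter_filter U k)) U)"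
  proof (rule is_filter.intro, goal_cases)
    case (2 P Q)
    then show ?case by eventually_elim (rule eventually_conj)
  next
    case (3 P Q)
    from 3(2) show ?case
      by eventually_elim (use 3(1) in \<open>auto elim: eventually_mono\<close>)
  qed simp
  then show ?thesis by (simp add: eventually_Abs_filter)
qed

declare iter_filter.simps [simp del]

lemma is_ultrafilter_iter_filter:
  assumes U: "is_ultrafilter U"
  shows "is_ultrafilter (iter_filter U k)"
proof (induction k)
  case 0
  show ?case by (auto simp: is_ultrafilter_def trivial_limit_def)
next
  case (Suc k)
  have not: "\<not> eventually P G \<longleftrightarrow> eventually (\<lambda>i. \<not> P i) G" if "is_ultrafilter G" for P and G :: "'j filter"
    using that eventually_conj[of P G "\<lambda>i. \<not> P i"]
    by (auto simp: is_ultrafilter_def trivial_limit_def)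
  have "eventually P (iter_filter U (Suc k)) \<or> eventually (\<lambda>l. \<not> P l) (iter_filter U (Suc k))" for P
    using not[OF U, of "\<lambda>n. eventually (\<lambda>l. P (n # l)) (iter_filter U k)"] by (auto simp: not[OF Suc])
  moreover have "iter_filter U (Suc k) \<noteq> bot"
    using Suc U by (simp add: is_ultrafilter_def trivial_limit_def)
  ultimately show ?case by (simp add: is_ultrafilter_def)
qed

lemma eventually_iter_filter_increasing:
  fixes U :: "nat filter"
  assumes U: "U \<le> sequentially"
  shows "eventually (\<lambda>l. length l = k \<and> sorted_wrt (<) l \<and> (\<forall>x\<in>set l. N \<le> x)) (iter_filter U k)"
proof (induction k arbitrary: N)
  case (Suc k)
  have "eventually (\<lambda>n. N \<le> n) U"
    using U eventually_ge_at_top by (rule filter_leD)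
  then show ?case
    unfolding eventually_iter_filter_Suc
  proof eventually_elim
    case (elim n)
    from Suc.IH[of "Suc n"] show ?case
      by eventually_elim (use elim in \<open>auto simp: Suc_le_eq intro: order_trans less_imp_le\<close>)
  qed
qed simp

lemma tendsto_iter_filter_Suc:
  fixes G :: "'i list \<Rightarrow> real"
  assumes G: "\<And>n. ((\<lambda>l. G (n # l)) \<longlongrightarrow> H n) (iter_filter U k)" and H: "(H \<longlongrightarrow> h) U"
  shows "(G \<longlongrightarrow> h) (iter_filter U (Suc k))"
proof (rule tendstoI)
  fix e :: real assume e: "0 < e"
  have "eventually (\<lambda>n. dist (H n) h < e / 2) U" using tendstoD[OF H, of "e / 2"] e by simp
  then show "eventually (\<lambda>l. dist (G l) h < e) (iter_filter U (Suc k))"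
    unfolding eventually_iter_filter_Suc
  proof eventually_elim
    case (elim n)
    have "eventually (\<lambda>l. dist (G (n # l)) (H n) < e / 2) (iter_filter U k)"
      using tendstoD[OF G, of "e / 2"] e by simp
    then show ?case
      by eventually_elim (use elim in \<open>auto intro: dist_triangle_half_l simp: dist_commute\<close>)
  qed
qed

text \<open>Conversely, inner limits converge to the limit along the product, because they have some limit
  along \<open>U\<close> and \<open>tendsto_iter_filter_Suc\<close> identifies it.\<close>
lemma iter_filter_inner_limits:
  fixes G :: "'i list \<Rightarrow> real"
  assumes U: "is_ultrafilter U" and B: "\<And>l. \<bar>G l\<bar> \<le> B"
    and G: "\<And>n. ((\<lambda>l. G (n # l)) \<longlongrightarrow> H n) (iter_filter U k)"
    and h: "(G \<longlongrightarrow> h) (iter_filter U (Suc k))"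
  shows "(H \<longlongrightarrow> h) U"
proof -
  note nontriv = is_ultrafilter_iter_filter[OF U, unfolded is_ultrafilter_def, THEN conjunct1]
  have "\<bar>H n\<bar> \<le> B" for n
    by (rule tendsto_upperbound[OF tendsto_rabs[OF G]]) (use B nontriv in auto)
  then obtain h' where h': "(H \<longlongrightarrow> h') U" using ultrafilter_limit[OF U] by blast
  have "h = h'"
    using tendsto_unique[OF nontriv h tendsto_iter_filter_Suc[OF G h']] .
  with h' show ?thesis by simp
qed

section \<open>Reflexivity and weak limits\<close>

text \<open>Functionals of norm at most \<open>C\<close> on the dual. Stating the bound through the dual balls avoids
  the dual norm.\<close>
definition bidual_ball :: "('v::real_vector \<Rightarrow> real) \<Rightarrow> real \<Rightarrow> (('v \<Rightarrow> real) \<Rightarrow> real) set" where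
  "bidual_ball p C = {\<phi>.
     (\<forall>r s. \<forall>g\<in>dual_ball p r. \<forall>h\<in>dual_ball p s. \<phi> (\<lambda>x. g x + h x) = \<phi> g + \<phi> h) \<and>
     (\<forall>r c. \<forall>g\<in>dual_ball p r. \<phi> (\<lambda>x. c * g x) = c * \<phi> g) \<and>
     (\<forall>r\<ge>0. \<forall>g\<in>dual_ball p r. \<bar>\<phi> g\<bar> \<le> C * r)}"

text \<open>Reflexivity of the quotient by the null space of \<open>p\<close>, whose dual and bidual are those of \<open>p\<close>.\<close>
definition seminorm_reflexive :: "('v::real_vector \<Rightarrow> real) \<Rightarrow> bool" where
  "seminorm_reflexive p \<longleftrightarrow>
     (\<forall>C. \<forall>\<phi>\<in>bidual_ball p C. \<exists>x. \<forall>r. \<forall>g\<in>dual_ball p r. \<phi> g = g x)"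

lemma bidual_ballD:
  assumes "\<phi> \<in> bidual_ball p C"
  shows "g \<in> dual_ball p r \<Longrightarrow> h \<in> dual_ball p s \<Longrightarrow> \<phi> (\<lambda>x. g x + h x) = \<phi> g + \<phi> h"
    "g \<in> dual_ball p r \<Longrightarrow> \<phi> (\<lambda>x. c * g x) = c * \<phi> g"
    "0 \<le> r \<Longrightarrow> g \<in> dual_ball p r \<Longrightarrow> \<bar>\<phi> g\<bar> \<le> C * r"
  using assms unfolding bidual_ball_def by blast+

lemma dual_ball_add:
  assumes "g \<in> dual_ball p r" "h \<in> dual_ball p s"
  shows "(\<lambda>x. g x + h x) \<in> dual_ball p (r + s)"
proof -
  have "\<bar>g x + h x\<bar> \<le> (r + s) * p x" for x
    using dual_ballD(2)[OF assms(1), of x] dual_ballD(2)[OF assms(2), of x]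
    by (simp add: distrib_right)
  then show ?thesis
    using assms by (auto simp: dual_ball_def intro: linear_compose_add)
qed

lemma dual_ball_scale:
  assumes "g \<in> dual_ball p r"
  shows "(\<lambda>x. c * g x) \<in> dual_ball p (\<bar>c\<bar> * r)"
proof -
  have "linear (\<lambda>x. c * g x)"
    using linear_compose_scale_right[of g c] assms by (simp add: dual_ball_def)
  then show ?thesis
    using mult_left_mono[OF dual_ballD(2)[OF assms], of "\<bar>c\<bar>"]
    by (auto simp: dual_ball_def abs_mult mult.assoc)
qed

lemma dual_ball_mono:
  assumes "is_seminorm p" "r \<le> s" "g \<in> dual_ball p r"
  shows "g \<in> dual_ball p s"
  using assms(3) mult_right_mono[OF assms(2) is_seminormD(5)[OF assms(1)]]
  by (auto simp: dual_ball_def intro: order_trans)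

lemma dual_ball_limit:
  assumes "F \<noteq> bot" "\<And>l. \<phi> l \<in> dual_ball p r" "\<And>x. ((\<lambda>l. \<phi> l x) \<longlongrightarrow> \<Phi> x) F"
  shows "\<Phi> \<in> dual_ball p r"
proof -
  have "linear \<Phi>"
  proof (rule linearI)
    show "\<Phi> (x + y) = \<Phi> x + \<Phi> y" for x y
      using tendsto_unique[OF assms(1) _ tendsto_add[OF assms(3)[of x] assms(3)[of y]]]
        assms(3)[of "x + y"] by (simp add: dual_ballD(3)[OF assms(2)])
    show "\<Phi> (c *\<^sub>R x) = c *\<^sub>R \<Phi> x" for c x
      using tendsto_unique[OF assms(1) _ tendsto_mult_left[OF assms(3)[of x], of c]]
        assms(3)[of "c *\<^sub>R x"] by (simp add: dual_ballD(5)[OF assms(2)])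
  qed
  moreover have "\<bar>\<Phi> x\<bar> \<le> r * p x" for x
    by (rule tendsto_upperbound[OF tendsto_rabs[OF assms(3)]])
       (use assms(1) dual_ballD(2)[OF assms(2)] in auto)
  ultimately show ?thesis by (simp add: dual_ball_def)
qed

text \<open>Along an ultrafilter every bounded family converges weakly to a point of the bidual, which
  reflexivity moves into the space.\<close>
lemma weak_limit:
  fixes p :: "'v::real_vector \<Rightarrow> real"
  assumes p: "is_seminorm p" and refl: "seminorm_reflexive p" and U: "is_ultrafilter U"
    and C: "\<And>i. p (y i) \<le> C"
  obtains x where "\<And>g. g \<in> dual_ball p 1 \<Longrightarrow> ((\<lambda>i. g (y i)) \<longlongrightarrow> g x) U"
proof -
  have nontriv: "U \<noteq> bot" using U by (simp add: is_ultrafilter_def)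
  have bound: "\<bar>g (y i)\<bar> \<le> C * \<bar>r\<bar>" if "g \<in> dual_ball p r" for g r i
  proof -
    have "\<bar>g (y i)\<bar> \<le> \<bar>r\<bar> * p (y i)"
      using dual_ballD(2)[OF dual_ball_mono[OF p abs_ge_self that]] .
    also have "\<dots> \<le> C * \<bar>r\<bar>" using mult_left_mono[OF C[of i], of "\<bar>r\<bar>"] by (simp add: mult.commute)
    finally show ?thesis .
  qed
  define \<phi> where "\<phi> g = Lim U (\<lambda>i. g (y i))" for g :: "'v \<Rightarrow> real"
  have \<phi>: "((\<lambda>i. g (y i)) \<longlongrightarrow> \<phi> g) U" if "g \<in> dual_ball p r" for g r
    using ultrafilter_limit[OF U, of "\<lambda>i. g (y i)" "C * \<bar>r\<bar>"] bound[OF that]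
      tendsto_Lim[OF nontriv] unfolding \<phi>_def by metis
  have "\<phi> \<in> bidual_ball p C"
    unfolding bidual_ball_def
  proof (intro CollectI conjI allI ballI impI)
    fix g h r s assume gh: "g \<in> dual_ball p r" "h \<in> dual_ball p s"
    show "\<phi> (\<lambda>x. g x + h x) = \<phi> g + \<phi> h"
      using tendsto_unique[OF nontriv \<phi>[OF dual_ball_add[OF gh]] tendsto_add[OF \<phi>[OF gh(1)] \<phi>[OF gh(2)]]] .
  next
    fix g r and c :: real assume g: "g \<in> dual_ball p r"
    show "\<phi> (\<lambda>x. c * g x) = c * \<phi> g"
      using tendsto_unique[OF nontriv \<phi>[OF dual_ball_scale[OF g]] tendsto_mult_left[OF \<phi>[OF g]]] .
  next
    fix g and r :: real assume r: "0 \<le> r" and g: "g \<in> dual_ball p r"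
    show "\<bar>\<phi> g\<bar> \<le> C * r"
      by (rule tendsto_upperbound[OF tendsto_rabs[OF \<phi>[OF g]]]) (use bound[OF g] r nontriv in auto)
  qed
  then obtain x where "\<And>g. g \<in> dual_ball p 1 \<Longrightarrow> \<phi> g = g x"
    using refl unfolding seminorm_reflexive_def by blast
  with \<phi> show thesis using that by metis
qed

section \<open>Interlacing tuples in a reflexive space\<close>

fun evens :: "'i list \<Rightarrow> 'i list" and odds :: "'i list \<Rightarrow> 'i list" where
  "evens [] = []"
| "evens (x # l) = x # odds l"
| "odds [] = []"
| "odds (x # l) = evens l"

text \<open>The odd-numbered choices can be forgotten, so limits along \<open>k\<close> copies of \<open>U\<close> are limits of the
  even entries along \<open>2 k\<close> copies.\<close>
lemma eventually_evens:
  "eventually P (iter_filter U k) \<Longrightarrow> eventually (\<lambda>l. P (evens l)) (iter_filter U (2 * k))"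
proof (induction k arbitrary: P)
  case (Suc k)
  from Suc.prems have "eventually (\<lambda>m. eventually (\<lambda>l. P (m # l)) (iter_filter U k)) U" by simp
  then show ?case
    by (auto elim!: eventually_mono dest!: Suc.IH)
qed simp

text \<open>In the product of \<open>2 k\<close> copies of \<open>U\<close> the entries of \<open>evens l\<close> and \<open>odds l\<close> are chosen
  alternately. Each pair of consecutive inner limits replaces one entry of both arguments by its
  limit, so the pairing converges to the pairing of the two separate limits.\<close>
lemma interlaced_pairing_limit:
  fixes p :: "'v::real_vector \<Rightarrow> real"
  assumes p: "is_seminorm p" and refl: "seminorm_reflexive p" and U: "is_ultrafilter U"
  shows "(\<And>l. p (F l) \<le> C) \<Longrightarrow> (\<And>l. \<phi> l \<in> dual_ball p 1) \<Longrightarrow>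
    (\<And>g. g \<in> dual_ball p 1 \<Longrightarrow> ((\<lambda>l. g (F l)) \<longlongrightarrow> g L) (iter_filter U k)) \<Longrightarrow>
    (\<And>x. ((\<lambda>l. \<phi> l x) \<longlongrightarrow> \<Phi> x) (iter_filter U k)) \<Longrightarrow>
    ((\<lambda>l. \<phi> (evens l) (F (odds l))) \<longlongrightarrow> \<Phi> L) (iter_filter U (2 * k))"
proof (induction k arbitrary: F \<phi> L \<Phi>)
  case 0
  note nontriv = is_ultrafilter_iter_filter[OF U, of 0, unfolded is_ultrafilter_def, THEN conjunct1]
  have "tendsto (\<lambda>l. c []) (c []) (iter_filter U 0)" "(f \<longlongrightarrow> f []) (iter_filter U 0)"
    for c f :: "'a list \<Rightarrow> real"
    by (auto intro: tendsto_eventually)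
  then have "\<phi> [] (F []) = \<phi> [] L" "\<phi> [] L = \<Phi> L"
    using tendsto_unique[OF nontriv] 0(2-4) by metis+
  then show ?case by (auto intro: tendsto_eventually)
next
  case (Suc k)
  have ultra: "is_ultrafilter (iter_filter U j)" for j by (rule is_ultrafilter_iter_filter[OF U])
  then have nontriv: "iter_filter U j \<noteq> bot" for j by (simp add: is_ultrafilter_def)
  have "\<exists>M. \<forall>g. g \<in> dual_ball p 1 \<longrightarrow> ((\<lambda>l. g (F (n # l))) \<longlongrightarrow> g M) (iter_filter U k)" for n
    using weak_limit[OF p refl ultra, of "\<lambda>l. F (n # l)" C k] Suc.prems(1) by blast
  then obtain M where M: "\<And>n g. g \<in> dual_ball p 1 \<Longrightarrow>
      ((\<lambda>l. g (F (n # l))) \<longlongrightarrow> g (M n)) (iter_filter U k)"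
    by metis
  have phi_bound: "\<bar>\<phi> l x\<bar> \<le> p x" for l x using dual_ballD(2)[OF Suc.prems(2)] by simp
  have "\<exists>r. ((\<lambda>l. \<phi> (n # l) x) \<longlongrightarrow> r) (iter_filter U k)" for n x
    using ultrafilter_limit[OF ultra, of "\<lambda>l. \<phi> (n # l) x" "p x"] phi_bound by metis
  then obtain \<Psi> where \<Psi>: "\<And>n x. ((\<lambda>l. \<phi> (n # l) x) \<longlongrightarrow> \<Psi> n x) (iter_filter U k)"
    by metis
  have \<Psi>_dual: "\<Psi> n \<in> dual_ball p 1" for n
    by (rule dual_ball_limit[OF nontriv _ \<Psi>]) (rule Suc.prems)
  have M_lim: "((\<lambda>n. g (M n)) \<longlongrightarrow> g L) U" if g: "g \<in> dual_ball p 1" for g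
  proof (rule iter_filter_inner_limits[OF U _ M[OF g] Suc.prems(3)[OF g]])
    show "\<bar>g (F l)\<bar> \<le> C" for l
      using dual_ballD(2)[OF g, of "F l"] Suc.prems(1)[of l] by simp
  qed
  have \<Psi>_lim: "((\<lambda>n. \<Psi> n x) \<longlongrightarrow> \<Phi> x) U" for x
    by (rule iter_filter_inner_limits[OF U phi_bound \<Psi> Suc.prems(4)])
  have inner: "((\<lambda>l. \<phi> (m # evens l) (F (n # odds l))) \<longlongrightarrow> \<Psi> m (M n)) (iter_filter U (2 * k))" for m n
    by (rule Suc.IH) (use Suc.prems(1,2) M \<Psi> in auto)
  have "((\<lambda>l. \<phi> (evens (m # l)) (F (odds (m # l)))) \<longlongrightarrow> \<Psi> m L) (iter_filter U (Suc (2 * k)))" for m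
    by (rule tendsto_iter_filter_Suc[where H = "\<lambda>n. \<Psi> m (M n)"])
       (use inner M_lim[OF \<Psi>_dual] in auto)
  then have "((\<lambda>l. \<phi> (evens l) (F (odds l))) \<longlongrightarrow> \<Phi> L) (iter_filter U (Suc (Suc (2 * k))))"
    by (rule tendsto_iter_filter_Suc) (rule \<Psi>_lim)
  then show ?case by simp
qed

text \<open>Let \<open>L\<close> be the weak limit of \<open>F\<close> and let \<open>\<phi> l\<close> norm \<open>F l - L\<close>. Interlacing \<open>evens l\<close> with
  \<open>odds l\<close> bounds \<open>\<phi> (evens l) (F (evens l) - F (odds l))\<close> by \<open>W\<close>. Since the pairings
  \<open>\<phi> (evens l) (F (odds l))\<close> and \<open>\<phi> (evens l) L\<close> have the same limit, the limit of
  \<open>p (F l - L)\<close> is at most \<open>W\<close>. Two tuples near \<open>L\<close>, one after the other, are as required.\<close>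
lemma interlaced_close_imp_separated_close:
  fixes p :: "'v::real_vector \<Rightarrow> real"
  assumes p: "is_seminorm p" and refl: "seminorm_reflexive p"
    and C: "\<And>l. p (F l) \<le> C"
    and W: "\<And>l. length l = 2 * k \<Longrightarrow> sorted_wrt (<) l \<Longrightarrow> p (F (evens l) - F (odds l)) \<le> W"
    and \<epsilon>: "0 < \<epsilon>"
  obtains l :: "nat list" where "length l = 2 * k" "sorted_wrt (<) l"
    "p (F (take k l) - F (drop k l)) < 2 * W + \<epsilon>"
proof -
  obtain U :: "nat filter" where U: "is_ultrafilter U" "U \<le> sequentially"
    using ultrafilter_finer[of "sequentially"] sequentially_bot by blast
  have ultra: "is_ultrafilter (iter_filter U j)" for j by (rule is_ultrafilter_iter_filter[OF U(1)])
  then have nontriv: "iter_filter U j \<noteq> bot" for j by (simp add: is_ultrafilter_def)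
  obtain L where L: "\<And>g. g \<in> dual_ball p 1 \<Longrightarrow> ((\<lambda>l. g (F l)) \<longlongrightarrow> g L) (iter_filter U k)"
    by (rule weak_limit[OF p refl ultra, of F C k]) (use C in auto)
  have "\<exists>g\<in>dual_ball p 1. g (F l - L) = p (F l - L)" for l
    by (rule Hahn_Banach_norming[OF p, of "F l - L"]) auto
  then obtain \<phi> where \<phi>: "\<And>l. \<phi> l \<in> dual_ball p 1" "\<And>l. \<phi> l (F l - L) = p (F l - L)"
    by metis
  have "\<exists>r. ((\<lambda>l. \<phi> l x) \<longlongrightarrow> r) (iter_filter U k)" for x
    using ultrafilter_limit[OF ultra, of "\<lambda>l. \<phi> l x" "p x"] dual_ballD(2)[OF \<phi>(1)] by (metis mult_1)
  then obtain \<Phi> where \<Phi>: "\<And>x. ((\<lambda>l. \<phi> l x) \<longlongrightarrow> \<Phi> x) (iter_filter U k)" by metis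
  have "\<bar>p (F l - L)\<bar> \<le> C + p L" for l
    using is_seminormD(5)[OF p, of "F l - L"] is_seminormD(6)[OF p, of "F l" L] C[of l] by simp
  then obtain r where r: "((\<lambda>l. p (F l - L)) \<longlongrightarrow> r) (iter_filter U k)"
    by (rule ultrafilter_limit[OF ultra])
  have ev: "filterlim evens (iter_filter U k) (iter_filter U (2 * k))"
    by (rule filterlim_iff[THEN iffD2]) (auto intro: eventually_evens)
  have pairing: "((\<lambda>l. \<phi> (evens l) (F (odds l))) \<longlongrightarrow> \<Phi> L) (iter_filter U (2 * k))"
    by (rule interlaced_pairing_limit[where p = p and \<phi> = \<phi> and F = F and C = C])
       (fact p refl U(1) C \<phi>(1) L \<Phi>)+
  have "((\<lambda>l. p (F (evens l) - L) + \<phi> (evens l) L - \<phi> (evens l) (F (odds l))) \<longlongrightarrow> r + \<Phi> L - \<Phi> L)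
      (iter_filter U (2 * k))"
    by (intro tendsto_intros pairing filterlim_compose[OF r ev] filterlim_compose[OF \<Phi> ev])
  moreover have "eventually (\<lambda>l. p (F (evens l) - L) + \<phi> (evens l) L - \<phi> (evens l) (F (odds l)) \<le> W)
      (iter_filter U (2 * k))"
    using eventually_iter_filter_increasing[OF U(2), of "2 * k" 0]
  proof eventually_elim
    case (elim l)
    have "p (F (evens l) - L) + \<phi> (evens l) L - \<phi> (evens l) (F (odds l))
        = \<phi> (evens l) (F (evens l) - F (odds l))"
      using dual_ballD(4)[OF \<phi>(1)] \<phi>(2)[of "evens l"] by simp
    also have "\<dots> \<le> p (F (evens l) - F (odds l))"
      using dual_ballD(2)[OF \<phi>(1)[of "evens l"], of "F (evens l) - F (odds l)"] by simp
    also have "\<dots> \<le> W" using elim by (intro W) auto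
    finally show ?case .
  qed
  ultimately have "r + \<Phi> L - \<Phi> L \<le> W"
    by (rule tendsto_upperbound) (rule nontriv)
  then have "r < W + \<epsilon> / 2" using \<epsilon> by simp
  then have near: "eventually (\<lambda>l. p (F l - L) < W + \<epsilon> / 2) (iter_filter U k)"
    using order_tendstoD(2)[OF r] by blast
  have pick: "\<exists>l. (length l = k \<and> sorted_wrt (<) l \<and> (\<forall>x\<in>set l. N \<le> x)) \<and> p (F l - L) < W + \<epsilon> / 2" for N
    using eventually_happens[OF eventually_conj[OF eventually_iter_filter_increasing[OF U(2)] near]]
      nontriv by blast
  obtain l where l: "length l = k" "sorted_wrt (<) l" "p (F l - L) < W + \<epsilon> / 2"
    using pick by blast
  \<comment> \<open>every entry of \<open>l\<close> is at most \<open>sum_list l\<close>, so \<open>l'\<close> comes after \<open>l\<close>\<close>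
  obtain l' where l': "length l' = k" "sorted_wrt (<) l'" "\<forall>x\<in>set l'. Suc (sum_list l) \<le> x"
    "p (F l' - L) < W + \<epsilon> / 2"
    using pick by blast
  have "p (F l - F l') \<le> p (F l - L) + p (F l' - L)"
    using is_seminormD(6)[OF p, of "F l - L" "F l' - L"] by simp
  with l(3) l'(4) have "p (F l - F l') < 2 * W + \<epsilon>" by simp
  moreover have "sorted_wrt (<) (l @ l')"
    using l(2) l'(2,3) member_le_sum_list[of _ l] by (fastforce simp: sorted_wrt_append)
  ultimately show thesis
    using that[of "l @ l'"] l(1) l'(1) by simp
qed

section \<open>James sequences in nonreflexive spaces\<close>

text \<open>The quotient norm of a Banach space by a closed subspace, when norms of classes are
  attained. Working with it on the Banach space avoids a type for the quotient.\<close>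
definition quotient_seminorm :: "('v::real_normed_vector \<Rightarrow> real) \<Rightarrow> bool" where
  "quotient_seminorm p \<longleftrightarrow> is_seminorm p \<and> (\<forall>x. p x \<le> norm x) \<and>
     (\<forall>x. \<exists>y. p (x - y) = 0 \<and> norm y \<le> p x)"

lemma quotient_seminormD:
  assumes "quotient_seminorm p"
  shows "is_seminorm p" "p x \<le> norm x" "\<exists>y. p (x - y) = 0 \<and> norm y \<le> p x"
  using assms by (auto simp: quotient_seminorm_def)

lemma quotient_seminorm_norm: "quotient_seminorm (norm :: 'a::real_normed_vector \<Rightarrow> real)"
  unfolding quotient_seminorm_def using is_seminorm_norm by (auto intro: exI[where x = x for x])

text \<open>A finite-dimensional separation theorem by least squares: let \<open>v0\<close> nearly minimise the
  distance to \<open>c\<close> over the convex set \<open>S\<close>. If that distance were positive, the hypothesis for the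
  direction \<open>c - v0\<close> would give a point of \<open>S\<close> towards which the distance decreases.\<close>
lemma least_squares_approximation:
  fixes S :: "('i \<Rightarrow> real) set"
  assumes fin: "finite I" and ne: "S \<noteq> {}"
    and convex: "\<And>u v t. u \<in> S \<Longrightarrow> v \<in> S \<Longrightarrow> 0 \<le> t \<Longrightarrow> t \<le> 1 \<Longrightarrow> (\<lambda>i. (1 - t) * u i + t * v i) \<in> S"
    and bounded: "\<And>v i. v \<in> S \<Longrightarrow> i \<in> I \<Longrightarrow> \<bar>v i\<bar> \<le> M i"
    and support: "\<And>a e. 0 < e \<Longrightarrow> \<exists>v\<in>S. (\<Sum>i\<in>I. a i * c i) - e < (\<Sum>i\<in>I. a i * v i)"
    and \<epsilon>: "0 < \<epsilon>"
  shows "\<exists>v\<in>S. \<forall>i\<in>I. \<bar>v i - c i\<bar> < \<epsilon>"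
proof -
  define H where "H v = (\<Sum>i\<in>I. (v i - c i)\<^sup>2)" for v :: "'i \<Rightarrow> real"
  define h where "h = (INF v\<in>S. H v)"
  have H_nonneg: "0 \<le> H v" for v by (simp add: H_def sum_nonneg)
  have h_le: "h \<le> H v" if "v \<in> S" for v
    unfolding h_def by (rule cINF_lower) (use that H_nonneg in \<open>auto intro!: bdd_belowI\<close>)
  have near: "\<exists>v\<in>S. H v < h + d" if "0 < d" for d
  proof (rule ccontr)
    assume "\<not> ?thesis"
    then have "h + d \<le> (INF v\<in>S. H v)" using ne by (intro cINF_greatest) auto
    with that show False by (simp add: h_def)
  qed
  have "h \<le> 0"
  proof (rule ccontr)
    assume "\<not> h \<le> 0"
    then have h: "0 < h" by simp
    define K where "K = (\<Sum>i\<in>I. (2 * M i)\<^sup>2) + h"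
    have K: "0 < K" "h \<le> K" using h by (auto simp: K_def sum_nonneg intro: add_nonneg_pos)
    \<comment> \<open>moving by \<open>t\<close> changes \<open>H\<close> by at most \<open>- t * h + t\<^sup>2 * K\<close>, which is smallest here\<close>
    define t where "t = h / (2 * K)"
    have t: "0 < t" "t \<le> 1" using h K by (auto simp: t_def)
    obtain v0 where v0: "v0 \<in> S" "H v0 < h + h\<^sup>2 / (8 * K)"
      using near[of "h\<^sup>2 / (8 * K)"] h K by auto
    obtain v where v: "v \<in> S"
      "(\<Sum>i\<in>I. (c i - v0 i) * c i) - h / 2 < (\<Sum>i\<in>I. (c i - v0 i) * v i)"
      using support[of "h / 2"] h by force
    have "(\<Sum>i\<in>I. (v i - v0 i)\<^sup>2) \<le> (\<Sum>i\<in>I. (2 * M i)\<^sup>2)"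
    proof (rule sum_mono)
      fix i assume i: "i \<in> I"
      have "\<bar>v i - v0 i\<bar> \<le> \<bar>2 * M i\<bar>" using bounded[OF v(1) i] bounded[OF v0(1) i] by simp
      then show "(v i - v0 i)\<^sup>2 \<le> (2 * M i)\<^sup>2" by (simp add: abs_le_square_iff)
    qed
    then have dist: "(\<Sum>i\<in>I. (v i - v0 i)\<^sup>2) \<le> K" using h by (simp add: K_def)
    have "H v0 = (\<Sum>i\<in>I. (c i - v0 i) * c i) - (\<Sum>i\<in>I. (c i - v0 i) * v0 i)"
      by (simp add: H_def power2_eq_square algebra_simps flip: sum_subtractf)
    with v(2) have descent: "H v0 - h / 2 < (\<Sum>i\<in>I. (c i - v0 i) * (v i - v0 i))"
      by (simp add: right_diff_distrib sum_subtractf)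
    have "h \<le> H (\<lambda>i. (1 - t) * v0 i + t * v i)"
      by (intro h_le convex) (use v0 v t in auto)
    also have "\<dots> = (\<Sum>i\<in>I. (v0 i - c i)\<^sup>2 - 2 * t * ((c i - v0 i) * (v i - v0 i)) + t\<^sup>2 * (v i - v0 i)\<^sup>2)"
      unfolding H_def by (rule sum.cong) (auto simp: power2_eq_square algebra_simps)
    also have "\<dots> = H v0 - 2 * t * (\<Sum>i\<in>I. (c i - v0 i) * (v i - v0 i)) + t\<^sup>2 * (\<Sum>i\<in>I. (v i - v0 i)\<^sup>2)"
      by (simp add: H_def sum.distrib sum_subtractf sum_distrib_left)
    also have "\<dots> \<le> H v0 - 2 * t * (H v0 - h / 2) + t\<^sup>2 * K"
      using descent dist t by (intro add_mono diff_mono mult_left_mono) auto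
    also have "\<dots> \<le> H v0 - t * h + t\<^sup>2 * K"
      using h_le[OF v0(1)] t by (simp add: algebra_simps)
    also have "t\<^sup>2 * K = h\<^sup>2 / (4 * K)" using K by (simp add: t_def power2_eq_square field_simps)
    also have "t * h = h\<^sup>2 / (2 * K)" using K by (simp add: t_def power2_eq_square)
    finally have "h\<^sup>2 / (2 * K) - h\<^sup>2 / (4 * K) < h\<^sup>2 / (8 * K)" using v0(2) by linarith
    then show False using h K by (simp add: field_simps)
  qed
  then obtain v where v: "v \<in> S" "H v < \<epsilon>\<^sup>2" using near[of "\<epsilon>\<^sup>2"] \<epsilon> by force
  have "\<bar>v i - c i\<bar> < \<epsilon>" if i: "i \<in> I" for i
  proof -
    have "(v i - c i)\<^sup>2 \<le> H v"
      unfolding H_def by (rule member_le_sum[OF i _ fin]) simp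
    with v(2) have "\<bar>v i - c i\<bar>\<^sup>2 < \<epsilon>\<^sup>2" by simp
    then show ?thesis using \<epsilon> by (rule power2_less_imp_less[OF _ less_imp_le])
  qed
  with v(1) show ?thesis by blast
qed

lemma dual_ball_sum:
  assumes "finite I" "\<And>i. i \<in> I \<Longrightarrow> g i \<in> dual_ball p (r i)"
  shows "(\<lambda>x. \<Sum>i\<in>I. a i * g i x) \<in> dual_ball p (\<Sum>i\<in>I. \<bar>a i\<bar> * r i)"
  using assms
proof (induction I)
  case empty
  then show ?case by (simp add: dual_ball_def linear_zero)
next
  case (insert i I)
  then show ?case
    using dual_ball_add[OF dual_ball_scale[of "g i" p "r i" "a i"]] by simp
qed

lemma bidual_sum:
  assumes \<phi>: "\<phi> \<in> bidual_ball p C" and "finite I" "\<And>i. i \<in> I \<Longrightarrow> g i \<in> dual_ball p (r i)"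
  shows "\<phi> (\<lambda>x. \<Sum>i\<in>I. a i * g i x) = (\<Sum>i\<in>I. a i * \<phi> (g i))"
  using assms(2,3)
proof (induction I)
  case empty
  have "(\<lambda>_. 0) \<in> dual_ball p 0" by (simp add: dual_ball_def linear_zero)
  then show ?case using bidual_ballD(2)[OF \<phi>, of "\<lambda>_. 0" 0 0] by simp
next
  case (insert i I)
  then show ?case
    using bidual_ballD(1)[OF \<phi> dual_ball_scale[of "g i" p "r i" "a i"] dual_ball_sum[of I g p r a]]
      bidual_ballD(2)[OF \<phi>, of "g i" "r i" "a i"] by simp
qed

text \<open>The points of the unit ball give a convex set of value vectors on \<open>G\<close>. Its support function in the
  direction \<open>a\<close> is the norm of the functional \<open>\<Sum>g\<in>G. a g * g\<close>, which bounds the value of \<open>\<phi>\<close> there.\<close>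
lemma Goldstine:
  fixes p :: "'v::real_normed_vector \<Rightarrow> real"
  assumes p: "quotient_seminorm p" and \<phi>: "\<phi> \<in> bidual_ball p 1"
    and G: "finite G" "G \<subseteq> dual_ball p 1" and \<epsilon>: "0 < \<epsilon>"
  obtains x where "norm x \<le> 1" "\<And>g. g \<in> G \<Longrightarrow> \<bar>g x - \<phi> g\<bar> < \<epsilon>"
proof -
  note sp = quotient_seminormD(1)[OF p]
  let ?B = "{x :: 'v. norm x \<le> 1}"
  let ?S = "(\<lambda>x g. if g \<in> G then g x else 0) ` ?B"
  have G': "g \<in> dual_ball p 1" if "g \<in> G" for g using G that by blast
  have "\<exists>v\<in>?S. \<forall>g\<in>G. \<bar>v g - \<phi> g\<bar> < \<epsilon>"
  proof (rule least_squares_approximation[OF G(1) _ _ _ _ \<epsilon>, where M = "\<lambda>_. 1"])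
    show "?S \<noteq> {}" by (auto intro: exI[of _ 0])
  next
    fix u v and t :: real assume uv: "u \<in> ?S"
      "v \<in> ?S" and t: "0 \<le> t" "t \<le> 1"
    then obtain x y where xy: "u = (\<lambda>g. if g \<in> G then g x else 0)" "norm x \<le> 1"
      "v = (\<lambda>g. if g \<in> G then g y else 0)" "norm y \<le> 1" by blast
    have "norm ((1 - t) *\<^sub>R x + t *\<^sub>R y) \<le> (1 - t) * norm x + t * norm y"
      using norm_triangle_ineq[of "(1 - t) *\<^sub>R x" "t *\<^sub>R y"] t by simp
    also have "\<dots> \<le> (1 - t) * 1 + t * 1" using xy t by (intro add_mono mult_left_mono) auto
    finally have "(1 - t) *\<^sub>R x + t *\<^sub>R y \<in> ?B" by simp
    moreover have "(\<lambda>g. (1 - t) * u g + t * v g) =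
        (\<lambda>g. if g \<in> G then g ((1 - t) *\<^sub>R x + t *\<^sub>R y) else 0)"
      using xy(1,3) dual_ballD(3,5)[OF G'] by auto
    ultimately show "(\<lambda>g. (1 - t) * u g + t * v g) \<in> ?S"
      by blast
  next
    fix v g assume "v \<in> ?S" and g: "g \<in> G"
    then obtain x where "norm x \<le> 1" "v g = g x" by auto
    then show "\<bar>v g\<bar> \<le> 1"
      using dual_ballD(2)[OF G'[OF g], of x] quotient_seminormD(2)[OF p, of x] by simp
  next
    fix a :: "('v \<Rightarrow> real) \<Rightarrow> real" and e :: real assume e: "0 < e"
    define h where "h x = (\<Sum>g\<in>G. a g * g x)" for x
    have h: "h \<in> dual_ball p (\<Sum>g\<in>G. \<bar>a g\<bar> * 1)"
      unfolding h_def by (rule dual_ball_sum[OF G(1) G'])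
    define r where "r = (SUP x\<in>?B. \<bar>h x\<bar>)"
    have bdd: "bdd_above ((\<lambda>x. \<bar>h x\<bar>) ` ?B)"
    proof (rule bdd_aboveI2)
      fix x assume x: "x \<in> ?B"
      have "\<bar>h x\<bar> \<le> (\<Sum>g\<in>G. \<bar>a g\<bar>) * p x" using dual_ballD(2)[OF h, of x] by simp
      also have "\<dots> \<le> (\<Sum>g\<in>G. \<bar>a g\<bar>) * 1"
        using x quotient_seminormD(2)[OF p, of x] by (intro mult_left_mono) (auto simp: sum_nonneg)
      finally show "\<bar>h x\<bar> \<le> (\<Sum>g\<in>G. \<bar>a g\<bar>) * 1" .
    qed
    have r_ge: "\<bar>h x\<bar> \<le> r" if "norm x \<le> 1" for x
      unfolding r_def by (rule cSUP_upper) (use that bdd in auto)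
    have r0: "0 \<le> r" using r_ge[of 0] by simp
    have "\<bar>h x\<bar> \<le> r * p x" for x
    proof -
      obtain y where y: "p (x - y) = 0" "norm y \<le> p x" using quotient_seminormD(3)[OF p] by blast
      have "h x = h y" using dual_ballD(4)[OF h, of x y] dual_ballD(2)[OF h, of "x - y"] y(1) by simp
      also have "\<bar>h y\<bar> \<le> r * norm y"
      proof (cases "y = 0")
        case True
        then show ?thesis by (simp add: dual_ballD(6)[OF h])
      next
        case False
        have "\<bar>h ((1 / norm y) *\<^sub>R y)\<bar> \<le> r" by (rule r_ge) simp
        then show ?thesis using False unfolding dual_ballD(5)[OF h] by (simp add: abs_mult field_simps)
      qed
      also have "\<dots> \<le> r * p x" using y(2) r0 by (rule mult_left_mono)
      finally show ?thesis .
    qed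
    then have "h \<in> dual_ball p r" using h by (simp add: dual_ball_def)
    then have "\<phi> h \<le> r" using bidual_ballD(3)[OF \<phi> r0, of h] by simp
    then have "(\<Sum>g\<in>G. a g * \<phi> g) \<le> r"
      using bidual_sum[OF \<phi> G(1), where g = "\<lambda>g. g" and r = "\<lambda>_. 1" and a = a] G' by (simp add: h_def[abs_def])
    moreover have "\<exists>x\<in>?B. r - e < \<bar>h x\<bar>"
    proof (rule ccontr)
      assume "\<not> ?thesis"
      then have "r \<le> r - e" unfolding r_def
        by (intro cSUP_least) (auto simp: r_def not_less intro: exI[of _ 0])
      with e show False by simp
    qed
    then obtain x where "norm x \<le> 1" "r - e < \<bar>h x\<bar>" by auto
    then obtain y where y: "norm y \<le> 1" "r - e < h y"
      using dual_ballD(4)[OF h, of 0 x] dual_ballD(6)[OF h]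
      by (cases "0 \<le> h x") (auto simp: abs_if, metis diff_0 norm_minus_cancel)
    ultimately have "(\<Sum>g\<in>G. a g * \<phi> g) - e < h y" by simp
    also have "h y = (\<Sum>g\<in>G. a g * (if g \<in> G then g y else 0))" by (simp add: h_def)
    finally show "\<exists>v\<in>?S.
        (\<Sum>g\<in>G. a g * \<phi> g) - e < (\<Sum>g\<in>G. a g * v g)"
      using y(1) by (intro bexI[of _ "\<lambda>g. if g \<in> G then g y else 0"]) auto
  qed
  then show thesis using that by auto
qed

text \<open>Goldstine's theorem one level up, for the functionals on the dual given by \<open>\<phi>\<close> and by finitely
  many points. That \<open>\<phi>\<close> has distance at least \<open>\<theta>\<close> from the space says exactly that prescribing
  \<open>\<theta>\<close> at \<open>\<phi>\<close> and \<open>0\<close> at the points is consistent with norm one.\<close>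
lemma functional_separating_bidual_point:
  fixes p :: "'v::real_vector \<Rightarrow> real"
  assumes p: "is_seminorm p" and \<phi>: "\<phi> \<in> bidual_ball p 1" and \<theta>: "0 < \<theta>"
    and dist: "\<And>x. \<exists>g\<in>dual_ball p 1. \<theta> < \<bar>\<phi> g - g x\<bar>"
    and A: "finite A" and \<epsilon>: "0 < \<epsilon>"
  obtains g where "g \<in> dual_ball p 1" "\<bar>\<phi> g - \<theta>\<bar> < \<epsilon>" "\<And>x. x \<in> A \<Longrightarrow> \<bar>g x\<bar> < \<epsilon>"
proof -
  define val where "val g i = (case i of None \<Rightarrow> \<phi> g | Some x \<Rightarrow> g x)"
    for g :: "'v \<Rightarrow> real" and i :: "'v option"
  let ?I = "insert None (Some ` A)" and ?c = "\<lambda>i :: 'v option. case i of None \<Rightarrow> \<theta> | Some _ \<Rightarrow> 0"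
  have sum_I: "(\<Sum>i\<in>?I. f i) = f None + (\<Sum>x\<in>A. f (Some x))" for f :: "'v option \<Rightarrow> real"
    using A by (simp add: sum.reindex)
  have "\<exists>v\<in>val ` dual_ball p 1. \<forall>i\<in>?I. \<bar>v i - ?c i\<bar> < \<epsilon>"
  proof (rule least_squares_approximation[OF _ _ _ _ _ \<epsilon>,
        where M = "\<lambda>i. case i of None \<Rightarrow> 1 | Some x \<Rightarrow> p x"])
    show "finite ?I" using A by simp
    show "val ` dual_ball p 1 \<noteq> {}" using dist by blast
  next
    fix u v and t :: real assume "u \<in> val ` dual_ball p 1" "v \<in> val ` dual_ball p 1"
      and t: "0 \<le> t" "t \<le> 1"
    then obtain g h where gh: "g \<in> dual_ball p 1" "h \<in> dual_ball p 1" "u = val g" "v = val h"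
      by blast
    let ?k = "\<lambda>x. (1 - t) * g x + t * h x"
    have "?k \<in> dual_ball p 1"
      using dual_ball_add[OF dual_ball_scale[OF gh(1), of "1 - t"] dual_ball_scale[OF gh(2), of t]] t
      by simp
    moreover have "(\<lambda>i. (1 - t) * u i + t * v i) = val ?k"
      using bidual_ballD(1)[OF \<phi> dual_ball_scale[OF gh(1), of "1 - t"] dual_ball_scale[OF gh(2), of t]]
        bidual_ballD(2)[OF \<phi> gh(1)] bidual_ballD(2)[OF \<phi> gh(2)]
      by (auto simp: gh val_def split: option.split)
    ultimately show "(\<lambda>i. (1 - t) * u i + t * v i) \<in> val ` dual_ball p 1" by blast
  next
    fix v i assume "v \<in> val ` dual_ball p 1"
    then obtain g where g: "g \<in> dual_ball p 1" "v = val g" by blast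
    show "\<bar>v i\<bar> \<le> (case i of None \<Rightarrow> 1 | Some x \<Rightarrow> p x)"
      using bidual_ballD(3)[OF \<phi> _ g(1)] dual_ballD(2)[OF g(1)]
      by (auto simp: g(2) val_def split: option.split)
  next
    fix a :: "'v option \<Rightarrow> real" and e :: real assume e: "0 < e"
    define z where "z = (\<Sum>x\<in>A. a (Some x) *\<^sub>R x)"
    have gz: "(\<Sum>x\<in>A. a (Some x) * g x) = g z" if "g \<in> dual_ball p 1" for g
      by (simp add: z_def dual_ballD[OF that])
    have "\<exists>g\<in>dual_ball p 1. a None * \<theta> - e < a None * \<phi> g + g z"
    proof (cases "a None = 0")
      case True
      have "(\<lambda>_. 0) \<in> dual_ball p 1"
        using is_seminormD(5)[OF p] by (simp add: dual_ball_def linear_zero)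
      with True e show ?thesis by force
    next
      case False
      obtain g where g: "g \<in> dual_ball p 1" "\<theta> < \<bar>\<phi> g - g (- (1 / a None) *\<^sub>R z)\<bar>"
        using dist by blast
      define s where "s = (if 0 \<le> a None * \<phi> g + g z then 1 else - 1 :: real)"
      have sg: "(\<lambda>x. s * g x) \<in> dual_ball p 1"
        using dual_ball_scale[OF g(1), of s] by (simp add: s_def split: if_splits)
      have "a None * \<theta> \<le> \<bar>a None\<bar> * \<theta>" using \<theta> by (intro mult_right_mono) auto
      also have "\<dots> \<le> \<bar>a None\<bar> * \<bar>\<phi> g - g (- (1 / a None) *\<^sub>R z)\<bar>"
        using g(2) by (intro mult_left_mono) auto
      also have "\<dots> = \<bar>a None * \<phi> g + g z\<bar>"
        using False unfolding dual_ballD(5)[OF g(1)] by (simp add: algebra_simps flip: abs_mult)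
      also have "\<dots> = a None * \<phi> (\<lambda>x. s * g x) + s * g z"
        unfolding bidual_ballD(2)[OF \<phi> g(1)] by (simp add: s_def)
      finally show ?thesis using sg e by (intro bexI[of _ "\<lambda>x. s * g x"]) auto
    qed
    then obtain g where g: "g \<in> dual_ball p 1" "a None * \<theta> - e < a None * \<phi> g + g z" by blast
    then show "\<exists>v\<in>val ` dual_ball p 1. (\<Sum>i\<in>?I. a i * ?c i) - e < (\<Sum>i\<in>?I. a i * v i)"
      by (intro bexI[of _ "val g"]) (auto simp: sum_I val_def gz[OF g(1)])
  qed
  then show thesis using that by (auto simp: val_def)
qed

text \<open>Completeness: a bidual functional at distance zero from the space is the limit of points of
  the space, and the quotient norm lifts a Cauchy sequence of classes to a convergent one.\<close>
lemma nonreflexive_bidual_distance: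
  fixes p :: "'v::banach \<Rightarrow> real"
  assumes p: "quotient_seminorm p" and nonrefl: "\<not> seminorm_reflexive p"
  obtains \<phi> \<theta> where "\<phi> \<in> bidual_ball p 1" "0 < \<theta>"
    "\<And>x. \<exists>g\<in>dual_ball p 1. \<theta> < \<bar>\<phi> g - g x\<bar>"
proof -
  note sp = quotient_seminormD(1)[OF p]
  obtain C \<psi> where \<psi>: "\<psi> \<in> bidual_ball p C" and not_repr: "\<And>x. \<exists>r. \<exists>g\<in>dual_ball p r. \<psi> g \<noteq> g x"
    using nonrefl unfolding seminorm_reflexive_def by blast
  define D where "D = max C 1"
  have D: "0 < D" "C \<le> D" by (auto simp: D_def)
  define \<phi> where "\<phi> g = \<psi> g / D" for g
  have \<phi>: "\<phi> \<in> bidual_ball p 1"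
    unfolding bidual_ball_def
  proof (intro CollectI conjI allI ballI impI)
    fix r g assume r: "(0::real) \<le> r" and g: "g \<in> dual_ball p r"
    have "\<bar>\<psi> g\<bar> \<le> D * r"
      using bidual_ballD(3)[OF \<psi> r g] mult_right_mono[OF D(2) r] by simp
    then show "\<bar>\<phi> g\<bar> \<le> 1 * r" using D by (simp add: \<phi>_def field_simps)
  qed (simp_all add: \<phi>_def bidual_ballD[OF \<psi>] add_divide_distrib)
  have "\<exists>\<theta>>0. \<forall>x. \<exists>g\<in>dual_ball p 1. \<theta> < \<bar>\<phi> g - g x\<bar>"
  proof (rule ccontr)
    assume "\<not> ?thesis"
    then have "\<exists>x. \<forall>g\<in>dual_ball p 1. \<bar>\<phi> g - g x\<bar> \<le> (1 / 2) ^ n" for n :: nat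
      by (metis not_less zero_less_divide_1_iff zero_less_numeral zero_less_power)
    then obtain x where x: "\<And>n g. g \<in> dual_ball p 1 \<Longrightarrow> \<bar>\<phi> g - g (x n)\<bar> \<le> (1 / 2) ^ n"
      by metis
    have step: "p (x (Suc n) - x n) \<le> 2 * (1 / 2) ^ n" for n
    proof -
      obtain g where g: "g \<in> dual_ball p 1" "g (x (Suc n) - x n) = p (x (Suc n) - x n)"
        by (rule Hahn_Banach_norming[OF sp])
      then show ?thesis
        using x[OF g(1), of n] x[OF g(1), of "Suc n"] zero_le_power[of "1 / 2 :: real" n]
        unfolding dual_ballD(4)[OF g(1)] power_Suc by linarith
    qed
    have "\<forall>n. \<exists>y. p (x (Suc n) - x n - y) = 0 \<and> norm y \<le> p (x (Suc n) - x n)"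
      using quotient_seminormD(3)[OF p] by blast
    then obtain y where y: "\<And>n. p (x (Suc n) - x n - y n) = 0" "\<And>n. norm (y n) \<le> p (x (Suc n) - x n)"
      by metis
    have geometric: "summable (\<lambda>n. 2 * (1 / 2 :: real) ^ n)"
      by (intro summable_mult summable_geometric) simp
    have "summable y"
      by (rule summable_comparison_test'[OF geometric, of 0]) (rule order_trans[OF y(2) step])
    define z where "z = x 0 + suminf y"
    have S: "(\<lambda>n. x 0 + (\<Sum>k<n. y k)) \<longlonglongrightarrow> z"
      unfolding z_def by (intro tendsto_intros summable_LIMSEQ \<open>summable y\<close>)
    have repr: "\<phi> g = g z" if g: "g \<in> dual_ball p 1" for g
    proof (rule LIMSEQ_unique)
      have "(\<lambda>n. \<phi> g - g (x n)) \<longlonglongrightarrow> 0"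
        by (rule Lim_null_comparison[OF _ LIMSEQ_power_zero[of "1 / 2 :: real"]]) (use x[OF g] in auto)
      from tendsto_diff[OF tendsto_const[of "\<phi> g"] this] show "(\<lambda>n. g (x n)) \<longlonglongrightarrow> \<phi> g" by simp
      have gy: "g (y n) = g (x (Suc n)) - g (x n)" for n
        using dual_ballD(2)[OF g, of "x (Suc n) - x n - y n"] unfolding y(1) dual_ballD(4)[OF g] by simp
      have gx: "g (x n) = g (x 0 + (\<Sum>k<n. y k))" for n
        using sum_lessThan_telescope[of "\<lambda>i. g (x i)" n] by (simp add: dual_ballD(3,7)[OF g] gy)
      have "\<bar>g (x n) - g z\<bar> \<le> norm (x 0 + (\<Sum>k<n. y k) - z)" for n
        using dual_ballD(2)[OF g, of "x 0 + (\<Sum>k<n. y k) - z"]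
          quotient_seminormD(2)[OF p, of "x 0 + (\<Sum>k<n. y k) - z"]
        unfolding gx dual_ballD(4)[OF g] by simp
      moreover have "(\<lambda>n. norm (x 0 + (\<Sum>k<n. y k) - z)) \<longlonglongrightarrow> 0"
        using S[THEN LIM_zero, THEN tendsto_norm_zero] .
      ultimately have "(\<lambda>n. g (x n) - g z) \<longlonglongrightarrow> 0"
        by (intro Lim_null_comparison[where f = "\<lambda>n. g (x n) - g z"] always_eventually) auto
      then show "(\<lambda>n. g (x n)) \<longlonglongrightarrow> g z" by (rule LIM_zero_cancel)
    qed
    have "\<psi> g = g (D *\<^sub>R z)" if g: "g \<in> dual_ball p r" for g r
    proof -
      define s where "s = max r 1"
      have s: "0 < s" by (simp add: s_def)
      have "(\<lambda>x. 1 / s * g x) \<in> dual_ball p (\<bar>1 / s\<bar> * s)"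
        by (intro dual_ball_scale dual_ball_mono[OF sp _ g]) (simp add: s_def)
      then have "\<phi> (\<lambda>x. 1 / s * g x) = 1 / s * g z" using repr[of "\<lambda>x. 1 / s * g x"] s by simp
      then have "\<psi> g / (s * D) = g z / s"
        unfolding \<phi>_def bidual_ballD(2)[OF \<psi> g] by simp
      then show ?thesis using s D by (simp add: dual_ballD(5)[OF g] field_simps)
    qed
    with not_repr show False by blast
  qed
  with \<phi> show thesis using that by blast
qed

text \<open>Points and functionals are chosen alternately: the functional \<open>g n\<close> is small on the earlier
  points and close to \<open>\<theta>\<close> at \<open>\<phi>\<close>, and the point \<open>x n\<close> imitates \<open>\<phi>\<close> on the functionals chosen so far.\<close>
lemma James_sequence:
  fixes p :: "'v::banach \<Rightarrow> real"
  assumes p: "quotient_seminorm p" and nonrefl: "\<not> seminorm_reflexive p"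
  obtains x g \<theta> where "0 < \<theta>" "\<And>n. norm (x n) \<le> 1" "\<And>n. g n \<in> dual_ball p 1"
    "\<And>k n::nat. k < n \<Longrightarrow> \<bar>g n (x k)\<bar> \<le> \<theta> / 4" "\<And>k n. n \<le> k \<Longrightarrow> 3 * \<theta> / 4 \<le> g n (x k)"
proof -
  obtain \<phi> \<theta> where \<phi>: "\<phi> \<in> bidual_ball p 1" and \<theta>: "0 < \<theta>"
    and dist: "\<And>x. \<exists>g\<in>dual_ball p 1. \<theta> < \<bar>\<phi> g - g x\<bar>"
    using nonreflexive_bidual_distance[OF p nonrefl] by blast
  \<comment> \<open>\<open>g n (x k)\<close> for \<open>n \<le> k\<close> is within two errors \<open>\<epsilon>\<close> of \<open>\<theta>\<close>, via \<open>\<phi> (g n)\<close>\<close>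
  define \<epsilon> where "\<epsilon> = \<theta> / 8"
  have \<epsilon>: "0 < \<epsilon>" using \<theta> by (simp add: \<epsilon>_def)
  have "\<exists>s. \<forall>n::nat. norm (fst (s n)) \<le> 1 \<and> snd (s n) \<in> dual_ball p 1 \<and>
      (\<forall>k<n. \<bar>snd (s n) (fst (s k))\<bar> < \<epsilon>) \<and> \<bar>\<phi> (snd (s n)) - \<theta>\<bar> < \<epsilon> \<and>
      (\<forall>k<n. \<bar>snd (s k) (fst (s n)) - \<phi> (snd (s k))\<bar> < \<epsilon>) \<and>
      \<bar>snd (s n) (fst (s n)) - \<phi> (snd (s n))\<bar> < \<epsilon>" (is "\<exists>s. \<forall>n. ?Q s n")
  proof (rule dependent_wellorder_choice[where P = "\<lambda>s n r. norm (fst r) \<le> 1 \<and>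
        snd r \<in> dual_ball p 1 \<and> (\<forall>k<n. \<bar>snd r (fst (s k))\<bar> < \<epsilon>) \<and> \<bar>\<phi> (snd r) - \<theta>\<bar> < \<epsilon> \<and>
        (\<forall>k<n. \<bar>snd (s k) (fst r) - \<phi> (snd (s k))\<bar> < \<epsilon>) \<and> \<bar>snd r (fst r) - \<phi> (snd r)\<bar> < \<epsilon>"],
      goal_cases)
    case (2 n s)
    obtain g where g: "g \<in> dual_ball p 1" "\<bar>\<phi> g - \<theta>\<bar> < \<epsilon>"
      "\<And>x. x \<in> (\<lambda>k. fst (s k)) ` {..<n} \<Longrightarrow> \<bar>g x\<bar> < \<epsilon>"
      by (rule functional_separating_bidual_point[OF quotient_seminormD(1)[OF p] \<phi> \<theta> dist _ \<epsilon>,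
          of "(\<lambda>k. fst (s k)) ` {..<n}"]) auto
    have "insert g ((\<lambda>k. snd (s k)) ` {..<n}) \<subseteq> dual_ball p 1" using g(1) 2 by auto
    then obtain x where "norm x \<le> 1"
      "\<And>h. h \<in> insert g ((\<lambda>k. snd (s k)) ` {..<n}) \<Longrightarrow> \<bar>h x - \<phi> h\<bar> < \<epsilon>"
      using Goldstine[OF p \<phi> _ _ \<epsilon>, of "insert g ((\<lambda>k. snd (s k)) ` {..<n})"] by auto
    with g show ?case by (intro exI[of _ "(x, g)"]) auto
  qed auto
  then obtain s where Q: "\<forall>n. ?Q s n" ..
  have s: "norm (fst (s n)) \<le> 1" "snd (s n) \<in> dual_ball p 1" "\<bar>\<phi> (snd (s n)) - \<theta>\<bar> < \<epsilon>"
    "\<bar>snd (s n) (fst (s n)) - \<phi> (snd (s n))\<bar> < \<epsilon>"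
    "k < n \<Longrightarrow> \<bar>snd (s n) (fst (s k))\<bar> < \<epsilon>" "k < n \<Longrightarrow> \<bar>snd (s k) (fst (s n)) - \<phi> (snd (s k))\<bar> < \<epsilon>"
    for k n using Q[rule_format, of n] by simp_all
  show thesis
  proof (rule that[of \<theta> "fst \<circ> s" "snd \<circ> s"])
    show "\<bar>(snd \<circ> s) n ((fst \<circ> s) k)\<bar> \<le> \<theta> / 4" if "k < n" for k n
      using s(5)[OF that] \<theta> by (simp add: \<epsilon>_def)
    show "3 * \<theta> / 4 \<le> (snd \<circ> s) n ((fst \<circ> s) k)" if "n \<le> k" for k n
    proof -
      have "\<bar>snd (s n) (fst (s k)) - \<phi> (snd (s n))\<bar> < \<epsilon>"
        using that s(6)[of n k] s(4)[of n] by (cases "n = k") auto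
      with s(3)[of n] show ?thesis by (simp add: \<epsilon>_def abs_if split: if_splits)
    qed
  qed (use \<theta> s in auto)
qed

text \<open>The functional with the first index of the second block is small on the first block and large on
  the second one.\<close>
lemma James_sequence_separated:
  fixes x :: "nat \<Rightarrow> 'v::real_vector" and n :: "nat \<Rightarrow> nat"
  assumes g: "\<And>n. g n \<in> dual_ball p 1"
    and small: "\<And>k n::nat. k < n \<Longrightarrow> \<bar>g n (x k)\<bar> \<le> \<theta> / 4"
    and large: "\<And>k n. n \<le> k \<Longrightarrow> 3 * \<theta> / 4 \<le> g n (x k)"
    and n: "strict_mono_on {..<2 * k} n"
  shows "\<theta> / 2 * k \<le> p (\<Sum>j<2 * k. (if j < k then 1 else - 1) *\<^sub>R x (n j))"
proof (cases "k = 0")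
  case False
  let ?g = "g (n k)" and ?f = "\<lambda>j. (if j < k then 1 else - 1) * g (n k) (x (n j))"
  have mono: "n i < n j" if "i < j" "j < 2 * k" for i j
    using n that by (auto simp: strict_mono_on_def)
  have "(\<Sum>j<k. ?f j) \<le> (\<Sum>j<k. \<theta> / 4)"
  proof (rule sum_mono)
    fix j assume "j \<in> {..<k}"
    then have "n j < n k" using mono[of j k] False by simp
    from small[OF this] show "?f j \<le> \<theta> / 4" using \<open>j \<in> {..<k}\<close> by simp
  qed
  moreover have "(\<Sum>j\<in>{k..<2 * k}. ?f j) \<le> (\<Sum>j\<in>{k..<2 * k}. - (3 * \<theta> / 4))"
  proof (rule sum_mono)
    fix j assume j: "j \<in> {k..<2 * k}"
    then have "n k \<le> n j" using mono[of k j] by (cases "j = k") auto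
    from large[OF this] show "?f j \<le> - (3 * \<theta> / 4)" using j by simp
  qed
  moreover have "(\<Sum>j<2 * k. ?f j) = (\<Sum>j<k. ?f j) + (\<Sum>j\<in>{k..<2 * k}. ?f j)"
    using sum.atLeastLessThan_concat[of 0 k "2 * k" ?f] by (simp add: lessThan_atLeast0)
  ultimately have "(\<Sum>j<2 * k. ?f j) \<le> - (\<theta> / 2 * k)" by (simp add: algebra_simps)
  moreover have "?g (\<Sum>j<2 * k. (if j < k then 1 else - 1) *\<^sub>R x (n j)) = (\<Sum>j<2 * k. ?f j)"
    by (simp only: dual_ballD(5,7)[OF g])
  ultimately show ?thesis
    using dual_ballD(2)[OF g, of "n k" "\<Sum>j<2 * k. (if j < k then 1 else - 1) *\<^sub>R x (n j)"] by simp
qed (use dual_ballD(2)[OF g, of 0 0] in simp)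

section \<open>Spreading models\<close>

text \<open>The condition on the norms of combinations in the definition of a spreading model, for a single
  coefficient vector and without the model: \<open>L\<close> is the norm of the combination in it.\<close>
definition spreading_limit ::
    "('v::real_vector \<Rightarrow> real) \<Rightarrow> (nat \<Rightarrow> 'v) \<Rightarrow> nat \<Rightarrow> (nat \<Rightarrow> real) \<Rightarrow> real \<Rightarrow> bool" where
  "spreading_limit p x k a L \<longleftrightarrow>
     (\<forall>\<delta>>0. \<exists>m. \<forall>n :: nat \<Rightarrow> nat. strict_mono_on {..<k} n \<and> (\<forall>j<k. m \<le> n j) \<longrightarrow>
        \<bar>p (\<Sum>j<k. a j *\<^sub>R x (n j)) - L\<bar> < \<delta>)"

lemma spreading_limitD:
  assumes "spreading_limit p x k a L" "0 < \<delta>"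
  obtains m where "\<And>n. strict_mono_on {..<k} n \<Longrightarrow> (\<And>j. j < k \<Longrightarrow> m \<le> n j) \<Longrightarrow>
    \<bar>p (\<Sum>j<k. a j *\<^sub>R x (n j)) - L\<bar> < \<delta>"
  using assms unfolding spreading_limit_def by metis

lemma strict_mono_on_lessThanI:
  fixes n :: "nat \<Rightarrow> nat"
  assumes "\<And>i. Suc i < k \<Longrightarrow> n i < n (Suc i)"
  shows "strict_mono_on {..<k} n"
proof -
  have "j < k \<Longrightarrow> i < j \<Longrightarrow> n i < n j" for i j
  proof (induction j)
    case (Suc j)
    then show ?case using assms[of j] by (cases "i = j") auto
  qed simp
  then show ?thesis by (auto simp: strict_mono_on_def)
qed

lemma sorted_wrt_map_upt:
  fixes n :: "nat \<Rightarrow> nat"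
  shows "sorted_wrt (<) (map n [0..<k]) \<longleftrightarrow> strict_mono_on {..<k} n"
  by (auto simp: sorted_wrt_iff_nth_less strict_mono_on_def)

lemma spreading_limit_Cauchy:
  assumes Cauchy: "\<And>\<delta>. 0 < \<delta> \<Longrightarrow> \<exists>m. \<forall>n n'.
      strict_mono_on {..<k} n \<longrightarrow> (\<forall>j<k. m \<le> n j) \<longrightarrow>
      strict_mono_on {..<k} n' \<longrightarrow> (\<forall>j<k. m \<le> n' j) \<longrightarrow>
      \<bar>p (\<Sum>j<k. a j *\<^sub>R x (n j)) - p (\<Sum>j<k. a j *\<^sub>R x (n' j))\<bar> < \<delta>"
  shows "\<exists>L. spreading_limit p x k a L"
proof -
  define v where "v m = p (\<Sum>j<k. a j *\<^sub>R x (m + j))" for m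
  define close where "close m \<delta> \<longleftrightarrow> (\<forall>n n'.
      strict_mono_on {..<k} n \<longrightarrow> (\<forall>j<k. m \<le> n j) \<longrightarrow>
      strict_mono_on {..<k} n' \<longrightarrow> (\<forall>j<k. m \<le> n' j) \<longrightarrow>
      \<bar>p (\<Sum>j<k. a j *\<^sub>R x (n j)) - p (\<Sum>j<k. a j *\<^sub>R x (n' j))\<bar> < \<delta>)" for m \<delta>
  note Cauchy = Cauchy[folded close_def]
  have closeD: "\<bar>p (\<Sum>j<k. a j *\<^sub>R x (n j)) - p (\<Sum>j<k. a j *\<^sub>R x (n' j))\<bar> < \<delta>"
    if "close m \<delta>" "strict_mono_on {..<k} n" "\<forall>j<k. m \<le> n j"
      "strict_mono_on {..<k} n'" "\<forall>j<k. m \<le> n' j" for m \<delta> n n'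
    using that unfolding close_def by blast
  have mono: "strict_mono_on {..<k} (\<lambda>j. m + j)" for m :: nat by (auto simp: strict_mono_on_def)
  have "Cauchy v"
    unfolding Cauchy_def
  proof (intro allI impI)
    fix e :: real assume "0 < e"
    then obtain m where m: "close m e" using Cauchy by blast
    have "dist (v i) (v j) < e" if "m \<le> i" "m \<le> j" for i j
      using closeD[OF m mono _ mono, of i j] that by (auto simp: v_def dist_real_def)
    then show "\<exists>M. \<forall>i\<ge>M. \<forall>j\<ge>M. dist (v i) (v j) < e" by blast
  qed
  then obtain L where L: "v \<longlonglongrightarrow> L" using Cauchy_convergent_iff convergent_def by blast
  have "spreading_limit p x k a L"
    unfolding spreading_limit_def
  proof (intro allI impI)
    fix \<delta> :: real assume \<delta>: "0 < \<delta>"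
    then obtain m where m: "close m (\<delta> / 2)" using Cauchy[of "\<delta> / 2"] by auto
    obtain M where M: "\<And>i. M \<le> i \<Longrightarrow> \<bar>v i - L\<bar> < \<delta> / 2"
      using LIMSEQ_D[OF L, of "\<delta> / 2"] \<delta> by auto
    have "\<bar>p (\<Sum>j<k. a j *\<^sub>R x (n j)) - L\<bar> < \<delta>"
      if "strict_mono_on {..<k} n" "\<forall>j<k. m \<le> n j" for n
    proof -
      have "\<forall>j<k. m \<le> max m M + j" by auto
      from closeD[OF m that mono this] M[of "max m M"] show ?thesis
        unfolding v_def by linarith
    qed
    then show "\<exists>m. \<forall>n. strict_mono_on {..<k} n \<and> (\<forall>j<k. m \<le> n j) \<longrightarrow>
        \<bar>p (\<Sum>j<k. a j *\<^sub>R x (n j)) - L\<bar> < \<delta>" by blast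
  qed
  then show ?thesis ..
qed

text \<open>Colour the \<open>k\<close>-subsets by the value of \<open>G\<close> rounded down to multiples of \<open>\<delta>\<close>.\<close>
lemma Ramsey_small_oscillation:
  fixes G :: "nat list \<Rightarrow> real"
  assumes B: "\<And>l. \<bar>G l\<bar> \<le> B" and \<delta>: "0 < \<delta>"
  obtains r :: "nat \<Rightarrow> nat" where "strict_mono r"
    "\<And>l l'. length l = k \<Longrightarrow> sorted_wrt (<) l \<Longrightarrow> length l' = k \<Longrightarrow> sorted_wrt (<) l' \<Longrightarrow>
      \<bar>G (map r l) - G (map r l')\<bar> < \<delta>"
proof -
  define f where "f X = nat \<lfloor>(G (sorted_list_of_set X) + B) / \<delta>\<rfloor>" for X
  have pos: "0 \<le> (G l + B) / \<delta>" "(G l + B) / \<delta> \<le> 2 * B / \<delta>" for l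
    using B[of l] \<delta> by (auto intro!: divide_nonneg_pos divide_right_mono)
  have "f X < Suc (nat \<lfloor>2 * B / \<delta>\<rfloor>)" for X
    unfolding f_def less_Suc_eq_le by (intro nat_mono floor_mono pos)
  then obtain Y t where Y: "infinite Y" "\<And>X. X \<subseteq> Y \<Longrightarrow> finite X \<Longrightarrow> card X = k \<Longrightarrow> f X = t"
    using Ramsey[of "UNIV :: nat set" k f "Suc (nat \<lfloor>2 * B / \<delta>\<rfloor>)"] by auto
  define r where "r = enumerate Y"
  have r: "strict_mono r" unfolding r_def using Y(1) by (rule strict_mono_enumerate)
  have floor: "\<lfloor>(G (map r l) + B) / \<delta>\<rfloor> = int t" if l: "length l = k" "sorted_wrt (<) l" for l
  proof -
    have sorted: "sorted_wrt (<) (map r l)"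
      using l(2) r by (auto simp: sorted_wrt_map strict_mono_def elim: sorted_wrt_mono_rel[rotated])
    then have eq: "sorted_list_of_set (set (map r l)) = map r l"
      by (intro sorted_list_of_set.idem_if_sorted_distinct) (simp_all only: strict_sorted_iff)
    have "f (set (map r l)) = t"
    proof (rule Y(2))
      show "set (map r l) \<subseteq> Y" using enumerate_in_set[OF Y(1)] by (auto simp: r_def)
      have "distinct (map r l)" using sorted by (simp only: strict_sorted_iff)
      then show "card (set (map r l)) = k" using l(1) by (simp only: distinct_card length_map)
    qed simp
    then have "nat \<lfloor>(G (map r l) + B) / \<delta>\<rfloor> = t" unfolding f_def eq .
    then show ?thesis using pos(1)[of "map r l"] by (metis nat_0_le zero_le_floor)
  qed
  show thesis
  proof (rule that[OF r])
    fix l l' :: "nat list"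
    assume "length l = k" "sorted_wrt (<) l" "length l' = k" "sorted_wrt (<) l'"
    then have "\<lfloor>(G (map r l) + B) / \<delta>\<rfloor> = \<lfloor>(G (map r l') + B) / \<delta>\<rfloor>" by (simp add: floor)
    then have "\<bar>(G (map r l) + B) / \<delta> - (G (map r l') + B) / \<delta>\<bar> < 1" by linarith
    also have "(G (map r l) + B) / \<delta> - (G (map r l') + B) / \<delta> = (G (map r l) - G (map r l')) / \<delta>"
      by (simp flip: diff_divide_distrib)
    finally show "\<bar>G (map r l) - G (map r l')\<bar> < \<delta>" using \<delta> by simp
  qed
qed

text \<open>The Brunel-Sucheston theorem: diagonalise over countably many rational coefficient vectors and
  tolerances; real coefficients follow by approximation.\<close>
lemma Brunel_Sucheston:
  fixes x :: "nat \<Rightarrow> 'v::real_vector"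
  assumes p: "is_seminorm p" and C: "\<And>n. p (x n) \<le> C"
  obtains s :: "nat \<Rightarrow> nat" where "strict_mono s" "\<And>k a. \<exists>L. spreading_limit p (x \<circ> s) k a L"
proof -
  have C0: "0 \<le> C" using is_seminormD(5)[OF p, of "x 0"] C[of 0] by simp
  define V where "V q l = p (\<Sum>j<length q. of_rat (q ! j) *\<^sub>R x (l ! j))" for q :: "rat list" and l
  have V_bound: "\<bar>V q l\<bar> \<le> (\<Sum>j<length q. \<bar>of_rat (q ! j)\<bar> * C)" for q l
  proof -
    have "V q l \<le> (\<Sum>j<length q. p (of_rat (q ! j) *\<^sub>R x (l ! j)))"
      unfolding V_def by (rule is_seminorm_sum[OF p])
    also have "\<dots> \<le> (\<Sum>j<length q. \<bar>of_rat (q ! j)\<bar> * C)"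
      unfolding is_seminormD(2)[OF p] by (intro sum_mono mult_left_mono C) simp
    finally show ?thesis using is_seminormD(5)[OF p] by (simp add: V_def)
  qed
  define P where "P i s \<longleftrightarrow> (case from_nat i of (q, N) \<Rightarrow>
      \<forall>l l'. length l = length q \<longrightarrow> sorted_wrt (<) l \<longrightarrow> length l' = length q \<longrightarrow> sorted_wrt (<) l' \<longrightarrow>
        \<bar>V q (map s l) - V q (map s l')\<bar> < 1 / real (Suc N))" for i :: nat and s :: "nat \<Rightarrow> nat"
  have sorted_map: "sorted_wrt (<) (map r l)" if "strict_mono r" "sorted_wrt (<) l"
    for r :: "nat \<Rightarrow> nat" and l
    using that by (auto simp: sorted_wrt_map strict_mono_def elim: sorted_wrt_mono_rel[rotated])
  have PD: "\<bar>V q (map s l) - V q (map s l')\<bar> < 1 / real (Suc N)"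
    if "P (to_nat (q, N)) s" "length l = length q" "sorted_wrt (<) l" "length l' = length q"
      "sorted_wrt (<) l'" for s q N l l'
    using that unfolding P_def by simp
  interpret subseqs P
  proof
    fix i :: nat and s :: "nat \<Rightarrow> nat" assume s: "strict_mono s"
    obtain q N where qN: "from_nat i = (q :: rat list, N :: nat)" by fastforce
    have pos: "0 < 1 / real (Suc N)" by simp
    obtain r :: "nat \<Rightarrow> nat" where "strict_mono r" "\<And>l l'. length l = length q \<Longrightarrow> sorted_wrt (<) l \<Longrightarrow>
        length l' = length q \<Longrightarrow> sorted_wrt (<) l' \<Longrightarrow>
        \<bar>V q (map s (map r l)) - V q (map s (map r l'))\<bar> < 1 / real (Suc N)"
      by (rule Ramsey_small_oscillation[of "\<lambda>l. V q (map s l)", OF V_bound pos, of "length q"]) blast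
    then show "\<exists>r. strict_mono r \<and> P i (s \<circ> r)" unfolding P_def qN by auto
  qed
  have P_diag: "P i (diagseq \<circ> (+) (Suc i))" for i
  proof (rule diagseq_holds)
    fix r s :: "nat \<Rightarrow> nat" and n :: nat assume "strict_mono r" "P n s"
    then show "P n (s \<circ> r)" using sorted_map[of r] unfolding P_def
      by (auto split: prod.splits simp flip: map_map)
  qed
  have tail: "\<bar>V q (map diagseq l) - V q (map diagseq l')\<bar> < 1 / real (Suc N)"
    if "length l = length q" "sorted_wrt (<) l" "length l' = length q" "sorted_wrt (<) l'"
      "\<forall>n\<in>set l \<union> set l'. Suc (to_nat (q, N)) \<le> n" for q N l l'
  proof -
    let ?i = "Suc (to_nat (q, N))"
    have shift: "map ((+) ?i) (map (\<lambda>n. n - ?i) h) = h" if "\<forall>n\<in>set h. ?i \<le> n" for h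
      using that by (auto intro!: map_idI)
    have sorted: "sorted_wrt (<) (map (\<lambda>n. n - ?i) h)" if "sorted_wrt (<) h" "\<forall>n\<in>set h. ?i \<le> n" for h
      using that by (auto simp: sorted_wrt_iff_nth_less intro!: diff_less_mono)
    have "\<bar>V q (map (diagseq \<circ> (+) ?i) (map (\<lambda>n. n - ?i) l)) -
        V q (map (diagseq \<circ> (+) ?i) (map (\<lambda>n. n - ?i) l'))\<bar> < 1 / real (Suc N)"
      by (rule PD[OF P_diag]) (use sorted that in auto)
    moreover have "map ((+) ?i) (map (\<lambda>n. n - ?i) l) = l" "map ((+) ?i) (map (\<lambda>n. n - ?i) l') = l'"
      by (rule shift; use that in blast)+
    ultimately show ?thesis by (simp only: map_map[symmetric])
  qed
  have "\<exists>L. spreading_limit p (x \<circ> diagseq) k a L" for k a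
  proof (rule spreading_limit_Cauchy)
    fix \<delta> :: real assume \<delta>: "0 < \<delta>"
    define e where "e = \<delta> / (4 * (C + 1) * (real k + 1))"
    have e: "0 < e" using \<delta> C0 by (simp add: e_def)
    have "\<exists>q. \<bar>of_rat q - a j\<bar> < e" for j
    proof -
      obtain q where "a j < of_rat q" "of_rat q < a j + e" using of_rat_dense[of "a j" "a j + e"] e by auto
      then show ?thesis by (intro exI[of _ q]) auto
    qed
    then obtain b where b: "\<And>j. \<bar>of_rat (b j) - a j\<bar> < e" by metis
    obtain N where N: "1 / real (Suc N) < \<delta> / 2" using \<delta> nat_approx_posE[of "\<delta> / 2"] by auto
    let ?q = "map b [0..<k]"
    have close: "\<bar>p (\<Sum>j<k. a j *\<^sub>R (x \<circ> diagseq) (n j)) - V ?q (map diagseq (map n [0..<k]))\<bar> \<le> \<delta> / 4"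
      for n
    proof -
      have V: "V ?q (map diagseq (map n [0..<k])) = p (\<Sum>j<k. of_rat (b j) *\<^sub>R (x \<circ> diagseq) (n j))"
        unfolding V_def by (auto intro!: arg_cong[of _ _ p] sum.cong)
      have "p ((\<Sum>j<k. a j *\<^sub>R (x \<circ> diagseq) (n j)) - (\<Sum>j<k. of_rat (b j) *\<^sub>R (x \<circ> diagseq) (n j)))
          = p (\<Sum>j<k. (a j - of_rat (b j)) *\<^sub>R (x \<circ> diagseq) (n j))"
        by (simp add: scaleR_diff_left sum_subtractf)
      also have "\<dots> \<le> (\<Sum>j<k. \<bar>a j - of_rat (b j)\<bar> * p ((x \<circ> diagseq) (n j)))"
        using is_seminorm_sum[OF p] unfolding is_seminormD(2)[OF p, symmetric] .
      also have "\<dots> \<le> (\<Sum>j<k. e * (C + 1))"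
      proof (intro sum_mono mult_mono)
        show "\<bar>a j - of_rat (b j)\<bar> \<le> e" for j using b[of j] by (simp add: abs_minus_commute)
        show "p ((x \<circ> diagseq) (n j)) \<le> C + 1" for j using C[of "diagseq (n j)"] by simp
      qed (use e is_seminormD(5)[OF p] in auto)
      also have "\<dots> = real k * (e * (C + 1))" by simp
      also have "e * (C + 1) = \<delta> / 4 / (real k + 1)"
        unfolding e_def using C0 by (simp add: divide_simps) (simp add: algebra_simps)
      also have "real k * (\<delta> / 4 / (real k + 1)) \<le> \<delta> / 4" using \<delta> by (simp add: field_simps)
      finally show ?thesis unfolding V using is_seminormD(8)[OF p] order_trans by blast
    qed
    show "\<exists>m. \<forall>n n'. strict_mono_on {..<k} n \<longrightarrow> (\<forall>j<k. m \<le> n j) \<longrightarrow>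
        strict_mono_on {..<k} n' \<longrightarrow> (\<forall>j<k. m \<le> n' j) \<longrightarrow>
        \<bar>p (\<Sum>j<k. a j *\<^sub>R (x \<circ> diagseq) (n j)) - p (\<Sum>j<k. a j *\<^sub>R (x \<circ> diagseq) (n' j))\<bar> < \<delta>"
    proof (intro exI[of _ "Suc (to_nat (?q, N))"] allI impI)
      fix n n' :: "nat \<Rightarrow> nat"
      assume n: "strict_mono_on {..<k} n" "\<forall>j<k. Suc (to_nat (?q, N)) \<le> n j"
        "strict_mono_on {..<k} n'" "\<forall>j<k. Suc (to_nat (?q, N)) \<le> n' j"
      have "\<bar>V ?q (map diagseq (map n [0..<k])) - V ?q (map diagseq (map n' [0..<k]))\<bar> < 1 / real (Suc N)"
        by (rule tail) (use n in \<open>auto simp: sorted_wrt_map_upt\<close>)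
      with close[of n] close[of n'] N
      show "\<bar>p (\<Sum>j<k. a j *\<^sub>R (x \<circ> diagseq) (n j)) - p (\<Sum>j<k. a j *\<^sub>R (x \<circ> diagseq) (n' j))\<bar> < \<delta>"
        by linarith
    qed
  qed
  with subseq_diagseq show thesis by (rule that)
qed

section \<open>The alternative between an \<open>\<ell>\<^sub>1\<close> spreading model and small interlaced differences\<close>

lemma spreading_limit_ge:
  assumes "spreading_limit p x k a L"
    and "\<And>n. strict_mono_on {..<k} n \<Longrightarrow> c \<le> p (\<Sum>j<k. a j *\<^sub>R x (n j))"
  shows "c \<le> L"
proof (rule field_le_epsilon)
  fix \<delta> :: real assume "0 < \<delta>"
  with assms(1) obtain m where m: "\<And>n. strict_mono_on {..<k} n \<Longrightarrow> (\<And>j. j < k \<Longrightarrow> m \<le> n j) \<Longrightarrow>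
    \<bar>p (\<Sum>j<k. a j *\<^sub>R x (n j)) - L\<bar> < \<delta>"
    by (rule spreading_limitD) blast
  have "strict_mono_on {..<k} (\<lambda>j. m + j)" by (auto simp: strict_mono_on_def)
  from m[OF this] assms(2)[OF this] show "c \<le> L + \<delta>" by force
qed

text \<open>The coefficients of the differences of consecutive entries: \<open>a 0, - a 0, a 1, - a 1, \<dots>\<close>.\<close>
definition paired :: "(nat \<Rightarrow> real) \<Rightarrow> nat \<Rightarrow> real" where
  "paired a i = (if even i then a (i div 2) else - a (i div 2))"

lemma paired_sum:
  fixes x :: "nat \<Rightarrow> 'v::real_vector"
  shows "(\<Sum>i<2 * k. paired a i *\<^sub>R x (if even i then t (i div 2) else t' (i div 2)))
    = (\<Sum>j<k. a j *\<^sub>R (x (t j) - x (t' j)))"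
  by (induction k) (simp_all add: paired_def scaleR_diff_right)

lemma paired_spreading_limitD:
  assumes "spreading_limit p x (2 * k) (paired a) L" "0 < \<delta>"
  obtains m where "\<And>t t'. (\<And>j. j < k \<Longrightarrow> m \<le> t j \<and> t j < t' j) \<Longrightarrow>
    (\<And>j. Suc j < k \<Longrightarrow> t' j < t (Suc j)) \<Longrightarrow>
    \<bar>p (\<Sum>j<k. a j *\<^sub>R (x (t j) - x (t' j))) - L\<bar> < \<delta>"
proof -
  obtain m where m: "\<And>n. strict_mono_on {..<2 * k} n \<Longrightarrow> (\<And>j. j < 2 * k \<Longrightarrow> m \<le> n j) \<Longrightarrow>
    \<bar>p (\<Sum>j<2 * k. paired a j *\<^sub>R x (n j)) - L\<bar> < \<delta>"
    using assms by (rule spreading_limitD) blast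
  show thesis
  proof (rule that[of m])
    fix t t' :: "nat \<Rightarrow> nat"
    assume t: "\<And>j. j < k \<Longrightarrow> m \<le> t j \<and> t j < t' j" "\<And>j. Suc j < k \<Longrightarrow> t' j < t (Suc j)"
    let ?n = "\<lambda>i. if even i then t (i div 2) else t' (i div 2)"
    have "\<bar>p (\<Sum>j<2 * k. paired a j *\<^sub>R x (?n j)) - L\<bar> < \<delta>"
    proof (rule m)
      show "strict_mono_on {..<2 * k} ?n"
      proof (rule strict_mono_on_lessThanI)
        fix i assume i: "Suc i < 2 * k"
        show "?n i < ?n (Suc i)"
        proof (cases "even i")
          case True
          then show ?thesis using t(1)[of "i div 2"] i by auto
        next
          case False
          then obtain j where "i = 2 * j + 1" by (rule oddE)
          then show ?thesis using t(2)[of j] i by auto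
        qed
      qed
      show "m \<le> ?n j" if "j < 2 * k" for j
      proof -
        have "j div 2 < k" using that by auto
        from t(1)[OF this] show ?thesis by simp
      qed
    qed
    then show "\<bar>p (\<Sum>j<k. a j *\<^sub>R (x (t j) - x (t' j))) - L\<bar> < \<delta>"
      by (simp only: paired_sum)
  qed
qed

text \<open>Deleting differences does not increase the limit. A deleted difference is replaced by the
  \<open>N\<close> consecutive ones of a block; they telescope, so that their average has norm at most
  \<open>2 / N\<close>, while each of the \<open>N\<close> averaged vectors has nearly the original norm.\<close>
lemma paired_limit_restrict:
  fixes x :: "nat \<Rightarrow> 'v::real_vector"
  assumes p: "is_seminorm p" and x: "\<And>n. p (x n) \<le> 1"
    and L: "spreading_limit p x (2 * k) (paired a) L"
    and L': "spreading_limit p x (2 * k) (paired (\<lambda>j. if j \<in> J then a j else 0)) L'"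
  shows "L' \<le> L"
proof (rule field_le_epsilon)
  fix e :: real assume e: "0 < e"
  define A where "A = (\<Sum>j<k. \<bar>a j\<bar> * 2)"
  have A: "0 \<le> A" by (simp add: A_def sum_nonneg)
  obtain N :: nat where N: "0 < N" "A / N \<le> e / 3"
  proof -
    obtain N :: nat where N: "A / (e / 3) < N" using reals_Archimedean2 by blast
    moreover have "0 \<le> A / (e / 3)" using A e by simp
    ultimately have "0 < N" by (cases N) auto
    moreover from this N have "A / N \<le> e / 3" using e by (simp add: field_simps)
    ultimately show thesis by (rule that)
  qed
  have e3: "0 < e / 3" using e by simp
  obtain m1 where m1: "\<And>t t'. (\<And>j. j < k \<Longrightarrow> m1 \<le> t j \<and> t j < t' j) \<Longrightarrow>
    (\<And>j. Suc j < k \<Longrightarrow> t' j < t (Suc j)) \<Longrightarrow>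
    \<bar>p (\<Sum>j<k. a j *\<^sub>R (x (t j) - x (t' j))) - L\<bar> < e / 3"
    by (rule paired_spreading_limitD[OF L e3]) blast
  obtain m2 where m2: "\<And>t t'. (\<And>j. j < k \<Longrightarrow> m2 \<le> t j \<and> t j < t' j) \<Longrightarrow>
    (\<And>j. Suc j < k \<Longrightarrow> t' j < t (Suc j)) \<Longrightarrow>
    \<bar>p (\<Sum>j<k. (if j \<in> J then a j else 0) *\<^sub>R (x (t j) - x (t' j))) - L'\<bar> < e / 3"
    by (rule paired_spreading_limitD[OF L' e3]) blast
  \<comment> \<open>\<open>b j\<close> starts the \<open>j\<close>-th block of \<open>N + 1\<close> indices; \<open>w r\<close> uses its \<open>r\<close>-th difference if \<open>j\<close> is deleted\<close>
  define b where "b j = m1 + m2 + j * (N + 1)" for j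
  define t where "t r j = b j + (if j \<in> J then 0 else r)" for r j
  define w where "w r = (\<Sum>j<k. a j *\<^sub>R (x (t r j) - x (Suc (t r j))))" for r
  define w' where "w' = (\<Sum>j<k. (if j \<in> J then a j else 0) *\<^sub>R (x (b j) - x (Suc (b j))))"
  have w: "p (w r) \<le> L + e / 3" if "r < N" for r
  proof -
    have "\<bar>p (w r) - L\<bar> < e / 3"
      unfolding w_def by (rule m1) (use that in \<open>auto simp: t_def b_def\<close>)
    then show ?thesis by linarith
  qed
  have w': "L' - e / 3 \<le> p w'"
  proof -
    have "\<bar>p w' - L'\<bar> < e / 3"
      unfolding w'_def by (rule m2) (use N(1) in \<open>auto simp: b_def\<close>)
    then show ?thesis by linarith
  qed
  have block: "(\<Sum>r<N. x (t r j) - x (Suc (t r j))) =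
      real N *\<^sub>R (if j \<in> J then x (b j) - x (Suc (b j)) else 0) +
      (if j \<in> J then 0 else x (b j) - x (b j + N))" for j
    using sum_lessThan_telescope'[of "\<lambda>r. x (b j + r)" N] by (simp add: t_def scaleR_conv_of_real sum_constant_scaleR)
  have "(\<Sum>r<N. w r) = (\<Sum>j<k. a j *\<^sub>R (\<Sum>r<N. x (t r j) - x (Suc (t r j))))"
    unfolding w_def scaleR_sum_right by (rule sum.swap)
  also have "\<dots> = (\<Sum>j<k. real N *\<^sub>R ((if j \<in> J then a j else 0) *\<^sub>R (x (b j) - x (Suc (b j)))) +
      a j *\<^sub>R (if j \<in> J then 0 else x (b j) - x (b j + N)))"
    unfolding block by (rule sum.cong) (auto simp: scaleR_add_right)
  also have "\<dots> = real N *\<^sub>R w' + (\<Sum>j<k. a j *\<^sub>R (if j \<in> J then 0 else x (b j) - x (b j + N)))"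
    by (simp add: sum.distrib w'_def scaleR_sum_right)
  finally have eq: "real N *\<^sub>R w' = (\<Sum>r<N. w r) - (\<Sum>j<k. a j *\<^sub>R (if j \<in> J then 0 else x (b j) - x (b j + N)))"
    by simp
  have "real N * p w' \<le> p (\<Sum>r<N. w r) + p (\<Sum>j<k. a j *\<^sub>R (if j \<in> J then 0 else x (b j) - x (b j + N)))"
    using is_seminormD(6)[OF p, of "\<Sum>r<N. w r"
        "\<Sum>j<k. a j *\<^sub>R (if j \<in> J then 0 else x (b j) - x (b j + N))"]
      is_seminormD(2)[OF p, of "real N" w'] unfolding eq by simp
  also have "p (\<Sum>r<N. w r) \<le> (\<Sum>r<N. L + e / 3)"
    by (rule order_trans[OF is_seminorm_sum[OF p] sum_mono]) (use w in auto)
  also have "p (\<Sum>j<k. a j *\<^sub>R (if j \<in> J then 0 else x (b j) - x (b j + N))) \<le> A"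
    unfolding A_def
  proof (rule order_trans[OF is_seminorm_sum[OF p] sum_mono])
    fix j
    have "p (if j \<in> J then 0 else x (b j) - x (b j + N)) \<le> 2"
      using is_seminormD(6)[OF p, of "x (b j)" "x (b j + N)"] x[of "b j"] x[of "b j + N"]
      by (simp add: is_seminormD(3)[OF p])
    then show "p (a j *\<^sub>R (if j \<in> J then 0 else x (b j) - x (b j + N))) \<le> \<bar>a j\<bar> * 2"
      unfolding is_seminormD(2)[OF p] by (rule mult_left_mono) simp
  qed
  finally have "real N * p w' \<le> real N * (L + e / 3) + A" by simp
  then have "p w' \<le> L + e / 3 + A / N" using N(1) by (simp add: field_simps)
  with w' N(2) show "L' \<le> L + e" by linarith
qed

lemma paired_limit_minus:
  assumes p: "is_seminorm p"
  shows "spreading_limit p x (2 * k) (paired (\<lambda>j. - a j)) L \<longleftrightarrow> spreading_limit p x (2 * k) (paired a) L"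
proof -
  have "p (\<Sum>j<2 * k. paired (\<lambda>j. - a j) j *\<^sub>R x (n j)) = p (\<Sum>j<2 * k. paired a j *\<^sub>R x (n j))"
    for n :: "nat \<Rightarrow> nat"
  proof -
    have "(\<Sum>j<2 * k. paired (\<lambda>j. - a j) j *\<^sub>R x (n j)) = - (\<Sum>j<2 * k. paired a j *\<^sub>R x (n j))"
      unfolding sum_negf[symmetric] by (rule sum.cong) (auto simp: paired_def)
    then show ?thesis by (simp add: is_seminormD(4)[OF p])
  qed
  then show ?thesis by (simp add: spreading_limit_def)
qed

text \<open>If the sum of the first \<open>K\<close> differences has norm at least \<open>c K / 2\<close>, then a norming functional
  of it is at least \<open>c / 4\<close> on at least \<open>c K / 8\<close> of them; by spreading, these can be used in place
  of the given \<open>k\<close> differences.\<close>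
lemma paired_limit_nonneg_ge:
  fixes x :: "nat \<Rightarrow> 'v::real_vector"
  assumes p: "is_seminorm p" and x: "\<And>n. p (x n) \<le> 1"
    and alt: "\<And>k. spreading_limit p x (2 * k) (paired (\<lambda>_. 1)) (I k)"
    and I: "\<And>k. c * k \<le> I k" and c: "0 < c"
    and L: "spreading_limit p x (2 * k) (paired a) L" and a: "\<And>j. 0 \<le> a j"
  shows "c / 4 * (\<Sum>j<k. a j) \<le> L"
proof (rule field_le_epsilon)
  fix e :: real assume e: "0 < e"
  obtain m1 where m1: "\<And>t t'. (\<And>j. j < k \<Longrightarrow> m1 \<le> t j \<and> t j < t' j) \<Longrightarrow>
    (\<And>j. Suc j < k \<Longrightarrow> t' j < t (Suc j)) \<Longrightarrow>
    \<bar>p (\<Sum>j<k. a j *\<^sub>R (x (t j) - x (t' j))) - L\<bar> < e"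
    by (rule paired_spreading_limitD[OF L e]) blast
  \<comment> \<open>large enough that \<open>c * K / 8\<close>, the guaranteed number of good differences, is at least \<open>k\<close>\<close>
  define K where "K = Suc (nat \<lceil>8 * k / c\<rceil>)"
  have "8 * k / c \<le> K" unfolding K_def by linarith
  then have K: "0 < K" "8 * k \<le> c * K" using c by (simp_all add: K_def field_simps)
  have "0 < c * K / 2" using K c by simp
  then obtain m2 where m2: "\<And>t t'. (\<And>j. j < K \<Longrightarrow> m2 \<le> t j \<and> t j < t' j) \<Longrightarrow>
    (\<And>j. Suc j < K \<Longrightarrow> t' j < t (Suc j)) \<Longrightarrow>
    \<bar>p (\<Sum>j<K. 1 *\<^sub>R (x (t j) - x (t' j))) - I K\<bar> < c * K / 2"
    by (rule paired_spreading_limitD[OF alt]) blast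
  define t where "t i = m1 + m2 + 2 * i" for i
  define u where "u i = x (t i) - x (Suc (t i))" for i
  have "c * K / 2 \<le> p (\<Sum>i<K. u i)"
    using m2[of t "\<lambda>j. Suc (t j)"] I[of K] by (auto simp: t_def u_def abs_if split: if_splits)
  obtain g where g: "g \<in> dual_ball p 1" "g (\<Sum>i<K. u i) = p (\<Sum>i<K. u i)"
    by (rule Hahn_Banach_norming[OF p])
  have gu: "g (u i) \<le> 2" for i
    using dual_ballD(2)[OF g(1), of "u i"] is_seminormD(6)[OF p, of "x (t i)" "x (Suc (t i))"]
      x[of "t i"] x[of "Suc (t i)"] by (simp add: u_def)
  define A where "A = {i. i < K \<and> c / 4 \<le> g (u i)}"
  have A: "finite A" by (simp add: A_def)
  have "c * K / 2 \<le> (\<Sum>i<K. g (u i))"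
    using \<open>c * K / 2 \<le> p (\<Sum>i<K. u i)\<close> by (simp add: dual_ballD(7)[OF g(1)] flip: g(2))
  also have "\<dots> \<le> (\<Sum>i<K. (if i \<in> A then 2 else 0) + c / 4)"
    using gu c by (intro sum_mono) (auto simp: A_def add_increasing2)
  also have "\<dots> = 2 * card A + K * (c / 4)"
  proof -
    have "{..<K} \<inter> A = A" by (auto simp: A_def)
    then show ?thesis by (simp add: sum.distrib sum.If_cases)
  qed
  finally have "c * K \<le> 8 * card A" by (simp add: field_simps)
  with K(2) have card: "k \<le> card A" by linarith
  let ?e = "\<lambda>j. sorted_list_of_set A ! j"
  have e_in: "?e j \<in> A" if "j < k" for j
    using nth_mem[of j "sorted_list_of_set A"] that card A by simp
  have e_less: "?e j < ?e (Suc j)" if "Suc j < k" for j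
    using sorted_wrt_nth_less[OF strict_sorted_list_of_set[of A], of j "Suc j"] that card by simp
  let ?v = "\<Sum>j<k. a j *\<^sub>R u (?e j)"
  have "c / 4 * (\<Sum>j<k. a j) = (\<Sum>j<k. a j * (c / 4))" by (simp add: sum_distrib_left mult.commute)
  also have "\<dots> \<le> (\<Sum>j<k. a j * g (u (?e j)))"
    using e_in a by (intro sum_mono mult_left_mono) (auto simp: A_def)
  also have "\<dots> = g ?v" by (simp add: dual_ballD(5,7)[OF g(1)])
  also have "\<dots> \<le> p ?v" using dual_ballD(2)[OF g(1), of ?v] by simp
  also have "\<bar>p ?v - L\<bar> < e"
    unfolding u_def
  proof (rule m1)
    show "Suc (t (?e j)) < t (?e (Suc j))" if "Suc j < k" for j
      using e_less[OF that] by (simp add: t_def)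
  qed (simp add: t_def)
  then have "p ?v \<le> L + e" by simp
  finally show "c / 4 * (\<Sum>j<k. a j) \<le> L + e" .
qed

text \<open>Deleting differences leaves the positive part of the coefficients, or the negative one.\<close>
lemma paired_limit_ge_l1:
  fixes x :: "nat \<Rightarrow> 'v::real_vector"
  assumes p: "is_seminorm p" and x: "\<And>n. p (x n) \<le> 1"
    and spreading: "\<And>k a. \<exists>L. spreading_limit p x k a L"
    and alt: "\<And>k. spreading_limit p x (2 * k) (paired (\<lambda>_. 1)) (I k)"
    and I: "\<And>k. c * k \<le> I k" and c: "0 < c"
    and L: "spreading_limit p x (2 * k) (paired a) L"
  shows "c / 8 * (\<Sum>j<k. \<bar>a j\<bar>) \<le> L"
proof -
  have *: "c / 4 * (\<Sum>j<k. if 0 \<le> b j then b j else 0) \<le> L"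
    if b: "spreading_limit p x (2 * k) (paired b) L" for b
  proof -
    obtain L' where L': "spreading_limit p x (2 * k) (paired (\<lambda>j. if j \<in> {j. 0 \<le> b j} then b j else 0)) L'"
      using spreading by blast
    have "c / 4 * (\<Sum>j<k. if j \<in> {j. 0 \<le> b j} then b j else 0) \<le> L'"
      by (rule paired_limit_nonneg_ge[OF p x alt I c L']) simp
    also have "L' \<le> L" by (rule paired_limit_restrict[OF p x b L'])
    finally show ?thesis by simp
  qed
  have "(\<Sum>j<k. \<bar>a j\<bar>) = (\<Sum>j<k. if 0 \<le> a j then a j else 0) + (\<Sum>j<k. if 0 \<le> - a j then - a j else 0)"
    unfolding sum.distrib[symmetric] by (rule sum.cong) auto
  then show ?thesis
    using *[OF L] *[of "\<lambda>j. - a j"] L by (simp add: paired_limit_minus[OF p] distrib_left)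
qed

lemma sum_evens_odds:
  fixes y :: "'i \<Rightarrow> 'v::real_vector"
  shows "sum_list (map y (evens l)) - sum_list (map y (odds l)) = (\<Sum>j<length l. paired (\<lambda>_. 1) j *\<^sub>R y (l ! j))"
proof (induction l)
  case (Cons z l)
  have "paired (\<lambda>_. 1) (Suc j) = - paired (\<lambda>_. 1) j" for j by (simp add: paired_def)
  then have "(\<Sum>j<length (z # l). paired (\<lambda>_. 1) j *\<^sub>R y ((z # l) ! j)) =
      y z - (\<Sum>j<length l. paired (\<lambda>_. 1) j *\<^sub>R y (l ! j))"
    by (simp add: sum.lessThan_Suc_shift paired_def[of _ 0] sum_negf del: sum.lessThan_Suc)
  with Cons show ?case by (simp add: algebra_simps)
qed simp

lemma sum_take_drop:
  fixes y :: "'i \<Rightarrow> 'v::real_vector"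
  assumes l: "length l = 2 * k"
  shows "sum_list (map y (take k l)) - sum_list (map y (drop k l))
    = (\<Sum>j<2 * k. (if j < k then 1 else - 1) *\<^sub>R y (l ! j))"
proof -
  let ?f = "\<lambda>j. (if j < k then 1 else - 1) *\<^sub>R y (l ! j)"
  have "sum_list (map y (take k l)) = (\<Sum>j\<in>{0..<k}. ?f j)"
    using l by (simp add: sum_list_sum_nth)
  moreover have "sum_list (map y (drop k l)) = - (\<Sum>j\<in>{k..<2 * k}. ?f j)"
    using l sum.shift_bounds_nat_ivl[of ?f 0 k k]
    by (simp add: sum_list_sum_nth sum_negf mult_2 add.commute)
  ultimately show ?thesis
    using sum.atLeastLessThan_concat[of 0 k "2 * k" ?f] by (simp add: lessThan_atLeast0)
qed

text \<open>The two alternatives are \<open>I k \<ge> c k\<close> for all \<open>k\<close>, where \<open>I k\<close> is the limit norm of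
  \<open>k\<close> interlaced differences, and its negation. In the second case \<open>I k\<close> is small compared with the
  limit norm \<open>D k \<ge> \<theta> k / 2\<close> of separated differences, and scaling makes \<open>D k\<close> equal to \<open>t\<close>.\<close>
lemma nonreflexive_alternative:
  fixes p :: "'v::banach \<Rightarrow> real"
  assumes p: "quotient_seminorm p" and nonrefl: "\<not> seminorm_reflexive p"
  obtains
    (l1) u c where "0 < c" "\<And>n. norm (u n) \<le> 2"
      "\<And>k a. \<exists>L. spreading_limit p u k a L \<and> c * (\<Sum>j<k. \<bar>a j\<bar>) \<le> L"
  | (small) "\<And>t \<eta>. 0 < t \<Longrightarrow> 0 < \<eta> \<Longrightarrow> \<exists>k y C. (\<forall>n. norm (y n) \<le> C) \<and>
      (\<forall>l :: nat list. length l = 2 * k \<longrightarrow> sorted_wrt (<) l \<longrightarrow>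
        p (sum_list (map y (evens l)) - sum_list (map y (odds l))) < \<eta> \<and>
        \<bar>p (sum_list (map y (take k l)) - sum_list (map y (drop k l))) - t\<bar> < \<eta>)"
proof -
  note sp = quotient_seminormD(1)[OF p]
  obtain x0 g \<theta> where \<theta>: "0 < \<theta>" and x0: "\<And>n. norm (x0 n) \<le> 1" and g: "\<And>n. g n \<in> dual_ball p 1"
    "\<And>k n::nat. k < n \<Longrightarrow> \<bar>g n (x0 k)\<bar> \<le> \<theta> / 4" "\<And>k n. n \<le> k \<Longrightarrow> 3 * \<theta> / 4 \<le> g n (x0 k)"
    using James_sequence[OF p nonrefl] by metis
  have px0: "p (x0 n) \<le> 1" for n using quotient_seminormD(2)[OF p, of "x0 n"] x0[of n] by simp
  obtain s where s: "strict_mono s" "\<And>k a. \<exists>L. spreading_limit p (x0 \<circ> s) k a L"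
    by (rule Brunel_Sucheston[of p x0 1]) (use sp px0 in auto)
  define x where "x = x0 \<circ> s"
  have x: "norm (x n) \<le> 1" "p (x n) \<le> 1" for n by (simp_all add: x_def x0 px0)
  have spreading: "\<exists>L. spreading_limit p x k a L" for k a using s(2) by (simp add: x_def)
  obtain I where I: "\<And>k. spreading_limit p x (2 * k) (paired (\<lambda>_. 1)) (I k)"
    using spreading[of "2 * _" "paired (\<lambda>_. 1)"] by metis
  show thesis
  proof (cases "\<exists>c>0. \<forall>k. c * real k \<le> I k")
    case True
    then obtain c where c: "0 < c" "\<And>k. c * real k \<le> I k" by blast
    define u where "u n = x (2 * n) - x (2 * n + 1)" for n
    have norm_u: "norm (u n) \<le> 2" for n
      using norm_triangle_ineq4[of "x (2 * n)" "x (2 * n + 1)"] x(1)[of "2 * n"] x(1)[of "2 * n + 1"]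
      by (simp add: u_def)
    have "\<exists>L. spreading_limit p u k a L \<and> c / 8 * (\<Sum>j<k. \<bar>a j\<bar>) \<le> L" for k a
    proof -
      obtain L where L: "spreading_limit p x (2 * k) (paired a) L" using spreading by blast
      have "spreading_limit p u k a L"
        unfolding spreading_limit_def
      proof (intro allI impI)
        fix \<delta> :: real assume "0 < \<delta>"
        with L obtain m where m: "\<And>t t'. (\<And>j. j < k \<Longrightarrow> m \<le> t j \<and> t j < t' j) \<Longrightarrow>
          (\<And>j. Suc j < k \<Longrightarrow> t' j < t (Suc j)) \<Longrightarrow>
          \<bar>p (\<Sum>j<k. a j *\<^sub>R (x (t j) - x (t' j))) - L\<bar> < \<delta>"
          by (rule paired_spreading_limitD) blast
        have "\<bar>p (\<Sum>j<k. a j *\<^sub>R u (n j)) - L\<bar> < \<delta>"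
          if "strict_mono_on {..<k} n \<and> (\<forall>j<k. m \<le> n j)" for n
        proof -
          have "n j < n (Suc j)" if "Suc j < k" for j
            using \<open>strict_mono_on {..<k} n \<and> (\<forall>j<k. m \<le> n j)\<close> that by (auto simp: strict_mono_on_def)
          then show ?thesis
            unfolding u_def by (intro m) (use that in \<open>force+\<close>)
        qed
        then show "\<exists>m. \<forall>n. strict_mono_on {..<k} n \<and> (\<forall>j<k. m \<le> n j) \<longrightarrow>
            \<bar>p (\<Sum>j<k. a j *\<^sub>R u (n j)) - L\<bar> < \<delta>" by blast
      qed
      with paired_limit_ge_l1[OF sp x(2) spreading I c(2,1) L] show ?thesis by blast
    qed
    with c(1) norm_u show thesis by (intro l1[of "c / 8" u]) auto
  next
    case False
    have "\<exists>k y C. (\<forall>n. norm (y n) \<le> C) \<and>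
      (\<forall>l :: nat list. length l = 2 * k \<longrightarrow> sorted_wrt (<) l \<longrightarrow>
        p (sum_list (map y (evens l)) - sum_list (map y (odds l))) < \<eta> \<and>
        \<bar>p (sum_list (map y (take k l)) - sum_list (map y (drop k l))) - t\<bar> < \<eta>)"
      if t: "0 < t" and \<eta>: "0 < \<eta>" for t \<eta>
    proof -
      have "0 < \<eta> * \<theta> / (4 * t)" using t \<eta> \<theta> by simp
      then obtain k where k: "I k < \<eta> * \<theta> / (4 * t) * real k" using False not_less by blast
      have "0 \<le> I k" using spreading_limit_ge[OF I] is_seminormD(5)[OF sp] by blast
      with k have k0: "0 < k" by (cases k) auto
      let ?d = "\<lambda>j. if j < k then 1 else - 1 :: real"
      obtain D where D: "spreading_limit p x (2 * k) ?d D" using spreading by blast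
      have "\<theta> / 2 * k \<le> D"
      proof (rule spreading_limit_ge[OF D])
        fix n :: "nat \<Rightarrow> nat" assume "strict_mono_on {..<2 * k} n"
        then have "strict_mono_on {..<2 * k} (s \<circ> n)"
          using s(1) by (auto simp: strict_mono_on_def strict_mono_def)
        from James_sequence_separated[of g p x0 \<theta>, OF g this]
        show "\<theta> / 2 * k \<le> p (\<Sum>j<2 * k. ?d j *\<^sub>R x (n j))" by (simp add: x_def)
      qed
      moreover have "0 < \<theta> / 2 * k" using \<theta> k0 by simp
      ultimately have D0: "0 < D" "\<theta> * k \<le> 2 * D" by auto
      define r where "r = t / D"
      have r: "0 < r" using t D0 by (simp add: r_def)
      have "r * I k < r * (\<eta> * \<theta> / (4 * t) * real k)" using k r by (rule mult_strict_left_mono)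
      also have "\<dots> = \<eta> / (4 * D) * (\<theta> * k)" using t D0 by (simp add: r_def)
      also have "\<dots> \<le> \<eta> / (4 * D) * (2 * D)" using D0 \<eta> by (intro mult_left_mono) auto
      also have "\<dots> = \<eta> / 2" using D0 by simp
      finally have rI: "r * I k < \<eta> / 2" .
      have pos: "0 < \<eta> / (2 * r)" using \<eta> r by simp
      obtain m1 where m1: "\<And>n. strict_mono_on {..<2 * k} n \<Longrightarrow> (\<And>j. j < 2 * k \<Longrightarrow> m1 \<le> n j) \<Longrightarrow>
        \<bar>p (\<Sum>j<2 * k. paired (\<lambda>_. 1) j *\<^sub>R x (n j)) - I k\<bar> < \<eta> / (2 * r)"
        by (rule spreading_limitD[OF I pos]) blast
      obtain m2 where m2: "\<And>n. strict_mono_on {..<2 * k} n \<Longrightarrow> (\<And>j. j < 2 * k \<Longrightarrow> m2 \<le> n j) \<Longrightarrow>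
        \<bar>p (\<Sum>j<2 * k. ?d j *\<^sub>R x (n j)) - D\<bar> < \<eta> / (2 * r)"
        by (rule spreading_limitD[OF D pos]) blast
      define y where "y n = r *\<^sub>R x (m1 + m2 + n)" for n
      have "norm (y n) \<le> r" for n
        using mult_left_le[OF x(1)[of "m1 + m2 + n"] less_imp_le[OF r]] r by (simp add: y_def)
      moreover have "p (sum_list (map y (evens l)) - sum_list (map y (odds l))) < \<eta> \<and>
          \<bar>p (sum_list (map y (take k l)) - sum_list (map y (drop k l))) - t\<bar> < \<eta>"
        if l: "length l = 2 * k" "sorted_wrt (<) l" for l
      proof -
        let ?n = "\<lambda>j. m1 + m2 + l ! j"
        have n: "strict_mono_on {..<2 * k} ?n"
          using l by (auto simp: strict_mono_on_def sorted_wrt_iff_nth_less)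
        have scale: "p (\<Sum>j<2 * k. b j *\<^sub>R y (l ! j)) = r * p (\<Sum>j<2 * k. b j *\<^sub>R x (?n j))" for b
        proof -
          have "(\<Sum>j<2 * k. b j *\<^sub>R y (l ! j)) = r *\<^sub>R (\<Sum>j<2 * k. b j *\<^sub>R x (?n j))"
            by (simp add: y_def scaleR_sum_right mult.commute)
          then show ?thesis using r by (simp add: is_seminormD(2)[OF sp])
        qed
        have "\<bar>p (\<Sum>j<2 * k. paired (\<lambda>_. 1) j *\<^sub>R x (?n j)) - I k\<bar> < \<eta> / (2 * r)"
          by (rule m1[OF n]) simp
        then have "r * p (\<Sum>j<2 * k. paired (\<lambda>_. 1) j *\<^sub>R x (?n j)) < r * (I k + \<eta> / (2 * r))"
          using r by simp
        also have "\<dots> < \<eta>" using rI r by (simp add: distrib_left)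
        finally have 1: "r * p (\<Sum>j<2 * k. paired (\<lambda>_. 1) j *\<^sub>R x (?n j)) < \<eta>" .
        have "\<bar>p (\<Sum>j<2 * k. ?d j *\<^sub>R x (?n j)) - D\<bar> < \<eta> / (2 * r)"
          by (rule m2[OF n]) simp
        then have "r * \<bar>p (\<Sum>j<2 * k. ?d j *\<^sub>R x (?n j)) - D\<bar> < r * (\<eta> / (2 * r))"
          using r by (rule mult_strict_left_mono)
        also have "\<dots> \<le> \<eta>" using r \<eta> by simp
        also have "r * \<bar>p (\<Sum>j<2 * k. ?d j *\<^sub>R x (?n j)) - D\<bar> = \<bar>r * (p (\<Sum>j<2 * k. ?d j *\<^sub>R x (?n j)) - D)\<bar>"
          using r by (simp add: abs_mult)
        also have "r * (p (\<Sum>j<2 * k. ?d j *\<^sub>R x (?n j)) - D) = r * p (\<Sum>j<2 * k. ?d j *\<^sub>R x (?n j)) - t"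
          using D0 by (simp add: right_diff_distrib r_def)
        finally have 2: "\<bar>r * p (\<Sum>j<2 * k. ?d j *\<^sub>R x (?n j)) - t\<bar> < \<eta>" .
        show ?thesis
          unfolding sum_evens_odds sum_take_drop[OF l(1)] l(1) scale using 1 2 by blast
      qed
      ultimately show ?thesis by blast
    qed
    then show thesis by (rule small)
  qed
qed

section \<open>Ultrapowers as quotients of spaces of bounded families\<close>

text \<open>A space presented as the image of a seminormed type under a norm-preserving linear map has
  the same dual and bidual as the seminorm.\<close>
lemma reflexive_space_iff_seminorm_reflexive:
  fixes p :: "'v::real_vector \<Rightarrow> real" and \<pi> :: "'v \<Rightarrow> 'w"
  assumes p: "is_seminorm p" and carrier: "ncarrier V = range \<pi>"
    and add: "\<And>x y. nadd V (\<pi> x) (\<pi> y) = \<pi> (x + y)"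
    and scale: "\<And>c x. nscale V c (\<pi> x) = \<pi> (c *\<^sub>R x)"
    and norm: "\<And>x. nnorm V (\<pi> x) = p x"
  shows "reflexive_space V \<longleftrightarrow> seminorm_reflexive p"
proof -
  let ?D = "dual_space V"
  define push where "push g = restrict (\<lambda>v. g (SOME x. \<pi> x = v)) (range \<pi>)" for g :: "'v \<Rightarrow> real"
  have push_\<pi>: "push g (\<pi> x) = g x" if g: "g \<in> dual_ball p r" for g r x
  proof -
    define y where "y = (SOME y. \<pi> y = \<pi> x)"
    have y: "\<pi> y = \<pi> x" unfolding y_def by (rule someI[of _ x]) simp
    have "\<pi> (y - x) = \<pi> (x - x)"
      using add[of y "- x"] add[of x "- x"] y by simp
    then have "p (y - x) = 0" using norm[of "y - x"] norm[of "x - x"] is_seminormD(3)[OF p] by simp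
    then have "g y = g x" using dual_ballD(2,4)[OF g] by (metis abs_le_zero_iff mult_zero_right right_minus_eq)
    then show ?thesis by (simp add: push_def y_def)
  qed
  have D: "ncarrier ?D = {f. bounded_functional V f}" by (simp add: dual_space_def)
  have push_D: "push g \<in> ncarrier ?D" if g: "g \<in> dual_ball p r" for g r
  proof -
    have "push g \<in> extensional (range \<pi>)" by (simp add: push_def)
    moreover have "\<exists>C. \<forall>x. \<bar>g x\<bar> \<le> C * p x" using dual_ballD(2)[OF g] by blast
    ultimately show ?thesis
      by (simp add: D bounded_functional_def carrier add scale norm push_\<pi>[OF g] dual_ballD[OF g])
  qed
  have pull: "\<exists>r. f \<circ> \<pi> \<in> dual_ball p r" if "f \<in> ncarrier ?D" for f
  proof -
    have "bounded_functional V f" using that by (simp add: D)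
    then obtain C where "\<And>x y. f (\<pi> (x + y)) = f (\<pi> x) + f (\<pi> y)" "\<And>c x. f (\<pi> (c *\<^sub>R x)) = c * f (\<pi> x)"
      "\<And>x. \<bar>f (\<pi> x)\<bar> \<le> C * p x"
      unfolding bounded_functional_def carrier by (auto simp: add scale norm)
    then have "f \<circ> \<pi> \<in> dual_ball p C" by (auto simp: dual_ball_def intro!: linearI)
    then show ?thesis ..
  qed
  have push_pull: "push (f \<circ> \<pi>) = f" if f: "f \<in> ncarrier ?D" for f
  proof (rule extensionalityI)
    show "push (f \<circ> \<pi>) \<in> extensional (range \<pi>)" by (simp add: push_def)
    show "f \<in> extensional (range \<pi>)" using f by (simp add: D bounded_functional_def carrier)
    show "push (f \<circ> \<pi>) v = f v" if "v \<in> range \<pi>" for v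
      using that pull[OF f] push_\<pi> by auto
  qed
  have nnorm_D: "nnorm ?D f = (SUP x\<in>{x. p x \<le> 1}. \<bar>f (\<pi> x)\<bar>)" for f
  proof -
    have "{v \<in> range \<pi>. nnorm V v \<le> 1} = \<pi> ` {x. p x \<le> 1}" by (auto simp: norm)
    then show ?thesis by (simp add: dual_space_def carrier image_image)
  qed
  have bound: "\<bar>g x\<bar> \<le> r" if "g \<in> dual_ball p r" "0 \<le> r" "p x \<le> 1" for g r x
    using dual_ballD(2)[OF that(1), of x] mult_left_mono[OF that(3,2)] by simp
  have ne: "{x. p x \<le> 1} \<noteq> {}" using is_seminormD(3)[OF p] by (auto intro: exI[of _ 0])
  have nnorm_le: "nnorm ?D (push g) \<le> r" if g: "g \<in> dual_ball p r" "0 \<le> r" for g r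
    unfolding nnorm_D by (rule cSUP_least[OF ne]) (use bound[OF g] push_\<pi>[OF g(1)] in auto)
  have le_nnorm: "g \<in> dual_ball p (nnorm ?D (push g)) \<and> 0 \<le> nnorm ?D (push g)"
    if g: "g \<in> dual_ball p r" for g r
  proof -
    have g': "g \<in> dual_ball p (max r 0)" by (rule dual_ball_mono[OF p _ g]) simp
    have ge: "\<bar>g x\<bar> \<le> nnorm ?D (push g)" if "p x \<le> 1" for x
      unfolding nnorm_D push_\<pi>[OF g]
      by (rule cSUP_upper) (use that bound[OF g'] in \<open>auto intro!: bdd_aboveI\<close>)
    have "\<bar>g x\<bar> \<le> nnorm ?D (push g) * p x" for x
    proof (cases "p x = 0")
      case True
      then show ?thesis using dual_ballD(2)[OF g, of x] by simp
    next
      case False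
      then have px: "0 < p x" using is_seminormD(5)[OF p, of x] by simp
      have "\<bar>g ((1 / p x) *\<^sub>R x)\<bar> \<le> nnorm ?D (push g)"
        by (rule ge) (use px in \<open>simp add: is_seminormD(2)[OF p]\<close>)
      then show ?thesis using px unfolding dual_ballD(5)[OF g] by (simp add: abs_mult field_simps)
    qed
    then show ?thesis
      using g ge[of 0] by (auto simp: dual_ball_def is_seminormD(3)[OF p] linear_0)
  qed
  have push_add: "push (\<lambda>x. g x + h x) = nadd ?D (push g) (push h)"
    if g: "g \<in> dual_ball p r" and h: "h \<in> dual_ball p s" for g h r s
  proof (rule extensionalityI[of _ "range \<pi>"])
    show "push (\<lambda>x. g x + h x) v = nadd ?D (push g) (push h) v" if "v \<in> range \<pi>" for v
      using that by (auto simp: dual_space_def carrier push_\<pi>[OF g] push_\<pi>[OF h] push_\<pi>[OF dual_ball_add[OF g h]])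
  qed (simp_all add: push_def dual_space_def carrier)
  have push_scale: "push (\<lambda>x. c * g x) = nscale ?D c (push g)" if g: "g \<in> dual_ball p r" for g r c
  proof (rule extensionalityI[of _ "range \<pi>"])
    show "push (\<lambda>x. c * g x) v = nscale ?D c (push g) v" if "v \<in> range \<pi>" for v
      using that by (auto simp: dual_space_def carrier push_\<pi>[OF g] push_\<pi>[OF dual_ball_scale[OF g]])
  qed (simp_all add: push_def dual_space_def carrier)
  have pull_push: "push g \<circ> \<pi> = g" if "g \<in> dual_ball p r" for g r
    using push_\<pi>[OF that] by auto
  show ?thesis
  proof
    assume R: "reflexive_space V"
    show "seminorm_reflexive p"
      unfolding seminorm_reflexive_def
    proof (intro allI ballI)
      fix C \<phi> assume \<phi>: "\<phi> \<in> bidual_ball p C"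
      define \<psi> where "\<psi> = restrict (\<lambda>f. \<phi> (f \<circ> \<pi>)) (ncarrier ?D)"
      have \<psi>: "\<psi> (push g) = \<phi> g" if "g \<in> dual_ball p r" for g r
        using push_D[OF that] pull_push[OF that] by (simp add: \<psi>_def)
      have "bounded_functional ?D \<psi>"
        unfolding bounded_functional_def
      proof (intro conjI ballI allI exI[of _ C])
        show "\<psi> \<in> extensional (ncarrier ?D)" by (simp add: \<psi>_def)
      next
        fix f h assume "f \<in> ncarrier ?D" "h \<in> ncarrier ?D"
        then obtain r s where fh: "f \<circ> \<pi> \<in> dual_ball p r" "f = push (f \<circ> \<pi>)"
          "h \<circ> \<pi> \<in> dual_ball p s" "h = push (h \<circ> \<pi>)" using pull push_pull by metis
        have "\<psi> (nadd ?D (push (f \<circ> \<pi>)) (push (h \<circ> \<pi>))) = \<psi> (push (f \<circ> \<pi>)) + \<psi> (push (h \<circ> \<pi>))"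
          unfolding push_add[OF fh(1,3), symmetric] \<psi>[OF dual_ball_add[OF fh(1,3)]] \<psi>[OF fh(1)] \<psi>[OF fh(3)]
          by (rule bidual_ballD(1)[OF \<phi> fh(1,3)])
        then show "\<psi> (nadd ?D f h) = \<psi> f + \<psi> h" using fh(2,4) by simp
      next
        fix c f assume "f \<in> ncarrier ?D"
        then obtain r where f: "f \<circ> \<pi> \<in> dual_ball p r" "f = push (f \<circ> \<pi>)" using pull push_pull by metis
        have "\<psi> (nscale ?D c (push (f \<circ> \<pi>))) = c * \<psi> (push (f \<circ> \<pi>))"
          unfolding push_scale[OF f(1), symmetric] \<psi>[OF dual_ball_scale[OF f(1)]] \<psi>[OF f(1)]
          by (rule bidual_ballD(2)[OF \<phi> f(1)])
        then show "\<psi> (nscale ?D c f) = c * \<psi> f" using f(2) by simp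
      next
        fix f assume "f \<in> ncarrier ?D"
        then obtain r where f: "f \<circ> \<pi> \<in> dual_ball p r" "f = push (f \<circ> \<pi>)" using pull push_pull by metis
        have "\<bar>\<psi> (push (f \<circ> \<pi>))\<bar> \<le> C * nnorm ?D (push (f \<circ> \<pi>))"
          unfolding \<psi>[OF f(1)] using le_nnorm[OF f(1)] bidual_ballD(3)[OF \<phi>] by blast
        then show "\<bar>\<psi> f\<bar> \<le> C * nnorm ?D f" using f(2) by simp
      qed
      then have "\<psi> \<in> ncarrier (dual_space ?D)" by (simp add: dual_space_def[of ?D])
      then obtain v where "v \<in> range \<pi>" "\<And>f. f \<in> ncarrier ?D \<Longrightarrow> \<psi> f = f v"
        using R unfolding reflexive_space_def carrier by blast
      then obtain x where x: "\<And>f. f \<in> ncarrier ?D \<Longrightarrow> \<psi> f = f (\<pi> x)" by blast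
      have "\<phi> g = g x" if "g \<in> dual_ball p r" for g r
        using x[OF push_D[OF that]] by (simp add: \<psi>[OF that] push_\<pi>[OF that])
      then show "\<exists>x. \<forall>r. \<forall>g\<in>dual_ball p r. \<phi> g = g x" by blast
    qed
  next
    assume R: "seminorm_reflexive p"
    show "reflexive_space V"
      unfolding reflexive_space_def
    proof
      fix \<psi> assume "\<psi> \<in> ncarrier (dual_space ?D)"
      then have "bounded_functional ?D \<psi>" by (simp add: dual_space_def[of ?D])
      then obtain C where \<psi>:
        "\<And>f h. f \<in> ncarrier ?D \<Longrightarrow> h \<in> ncarrier ?D \<Longrightarrow> \<psi> (nadd ?D f h) = \<psi> f + \<psi> h"
        "\<And>c f. f \<in> ncarrier ?D \<Longrightarrow> \<psi> (nscale ?D c f) = c * \<psi> f"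
        "\<And>f. f \<in> ncarrier ?D \<Longrightarrow> \<bar>\<psi> f\<bar> \<le> C * nnorm ?D f"
        unfolding bounded_functional_def by blast
      have "(\<lambda>g. \<psi> (push g)) \<in> bidual_ball p (max C 0)"
        unfolding bidual_ball_def
      proof (intro CollectI conjI allI ballI impI)
        fix g h r s assume gh: "g \<in> dual_ball p r" "h \<in> dual_ball p s"
        show "\<psi> (push (\<lambda>x. g x + h x)) = \<psi> (push g) + \<psi> (push h)"
          unfolding push_add[OF gh] by (rule \<psi>(1)[OF push_D[OF gh(1)] push_D[OF gh(2)]])
      next
        fix g r and c :: real assume g: "g \<in> dual_ball p r"
        show "\<psi> (push (\<lambda>x. c * g x)) = c * \<psi> (push g)"
          unfolding push_scale[OF g] by (rule \<psi>(2)[OF push_D[OF g]])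
      next
        fix g and r :: real assume r: "0 \<le> r" and g: "g \<in> dual_ball p r"
        have "\<bar>\<psi> (push g)\<bar> \<le> C * nnorm ?D (push g)" by (rule \<psi>(3)[OF push_D[OF g]])
        also have "\<dots> \<le> max C 0 * r"
          using nnorm_le[OF g r] le_nnorm[OF g] by (intro mult_mono) auto
        finally show "\<bar>\<psi> (push g)\<bar> \<le> max C 0 * r" .
      qed
      from R[unfolded seminorm_reflexive_def, rule_format, OF this]
      obtain x where x: "\<And>g r. g \<in> dual_ball p r \<Longrightarrow> \<psi> (push g) = g x"
        by blast
      have "\<psi> f = f (\<pi> x)" if "f \<in> ncarrier ?D" for f
        using pull[OF that] x push_pull[OF that] by fastforce
      then show "\<exists>v\<in>ncarrier V. \<forall>f\<in>ncarrier ?D. \<psi> f = f v" unfolding carrier by blast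
    qed
  qed
qed

lemma reflexive_iff_seminorm_reflexive:
  "reflexive TYPE('a::real_normed_vector) \<longleftrightarrow> seminorm_reflexive (norm :: 'a \<Rightarrow> real)"
  unfolding reflexive_def
  by (rule reflexive_space_iff_seminorm_reflexive[where \<pi> = "\<lambda>x. x", OF is_seminorm_norm])
     (auto simp: space_of_def)

instance bcontfun :: (metric_space, banach) banach ..

text \<open>Over a discrete index type all bounded families are bounded continuous functions, so this is
  the Banach space \<open>\<ell>\<^sub>\<infinity>\<close> of bounded families.\<close>
definition family :: "('i \<Rightarrow> 'a::real_normed_vector) \<Rightarrow> 'i discrete \<Rightarrow>\<^sub>C 'a" where
  "family x = Bcontfun (\<lambda>d. x (of_discrete d))"

definition member :: "('i discrete \<Rightarrow>\<^sub>C 'a::real_normed_vector) \<Rightarrow> 'i \<Rightarrow> 'a" where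
  "member z i = z (discrete i)"

lemma member_simps [simp]:
  "member (y + z) i = member y i + member z i" "member (y - z) i = member y i - member z i"
  "member (c *\<^sub>R z) i = c *\<^sub>R member z i" "member 0 i = 0"
  by (simp_all add: member_def)

lemma member_sum: "member (\<Sum>j\<in>A. f j) i = (\<Sum>j\<in>A. member (f j) i)"
  by (induction A rule: infinite_finite_induct) simp_all

lemma member_sum_list: "member (sum_list (map f l)) i = sum_list (map (\<lambda>j. member (f j) i) l)"
  by (induction l) simp_all

lemma norm_member_le: "norm (member z i) \<le> norm z"
  by (simp add: member_def norm_bounded)

lemma bounded_member: "bounded (range (member z))"
  using norm_member_le[of z] by (auto simp: bounded_iff)

lemma member_family:
  assumes "bounded (range x)"
  shows "member (family x) = x"
proof -
  have "continuous_on UNIV (\<lambda>d. x (of_discrete d))"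
    by (auto simp: continuous_on_open_vimage open_discrete)
  moreover have "bounded (range (\<lambda>d. x (of_discrete d)))"
    using assms by (rule bounded_subset) auto
  ultimately have "(\<lambda>d. x (of_discrete d)) \<in> bcontfun" by (simp add: bcontfun_def)
  then show ?thesis by (simp add: fun_eq_iff member_def family_def Bcontfun_inverse discrete_inverse)
qed

definition ultra_seminorm :: "'i filter \<Rightarrow> ('i discrete \<Rightarrow>\<^sub>C 'a::real_normed_vector) \<Rightarrow> real" where
  "ultra_seminorm U z = nnorm (ultrapower U) (ultrapower_rel U `` {member z})"

lemma ultra_seminorm_tendsto:
  "is_ultrafilter U \<Longrightarrow> ((\<lambda>i. norm (member z i)) \<longlongrightarrow> ultra_seminorm U z) U"
  unfolding ultra_seminorm_def by (rule nnorm_ultrapower[OF _ bounded_member])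

text \<open>A family of limit norm \<open>c\<close> is lifted isometrically by retracting its members to the
  ball of radius \<open>c\<close>.\<close>
lemma quotient_seminorm_ultra_seminorm:
  assumes U: "is_ultrafilter U"
  shows "quotient_seminorm (ultra_seminorm U :: ('i discrete \<Rightarrow>\<^sub>C 'a::real_normed_vector) \<Rightarrow> real)"
  unfolding quotient_seminorm_def is_seminorm_def
proof (intro conjI allI)
  note lim = ultra_seminorm_tendsto[OF U]
  have nontriv: "U \<noteq> bot" using U by (simp add: is_ultrafilter_def)
  fix y z :: "'i discrete \<Rightarrow>\<^sub>C 'a" and c :: real
  show "ultra_seminorm U (y + z) \<le> ultra_seminorm U y + ultra_seminorm U z"
    by (rule tendsto_le[OF nontriv tendsto_add[OF lim[of y] lim[of z]] lim])
       (simp add: norm_triangle_ineq)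
  show "ultra_seminorm U (c *\<^sub>R z) = \<bar>c\<bar> * ultra_seminorm U z"
    using tendsto_unique[OF nontriv lim[of "c *\<^sub>R z"]] tendsto_mult_left[OF lim[of z], of "\<bar>c\<bar>"] by simp
  show "ultra_seminorm U z \<le> norm z"
    by (rule tendsto_upperbound[OF lim _ nontriv]) (simp add: norm_member_le)
  define r where "r = ultra_seminorm U z"
  have r: "0 \<le> r" unfolding r_def by (rule tendsto_lowerbound[OF lim _ nontriv]) simp
  define w where "w i = min 1 (r / norm (member z i)) *\<^sub>R member z i" for i
  have norm_w: "norm (w i) \<le> r" for i
    using r by (cases "member z i = 0") (auto simp: w_def min_def field_simps)
  then have "bounded (range w)" by (auto simp: bounded_iff)
  note w = member_family[OF this]
  have "norm (family w) \<le> r"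
  proof (rule norm_bound)
    fix d
    have "apply_bcontfun (family w) d = w (of_discrete d)"
      using fun_cong[OF w, of "of_discrete d"] by (simp add: member_def of_discrete_inverse)
    then show "norm (apply_bcontfun (family w) d) \<le> r" using norm_w by simp
  qed
  moreover have "ultra_seminorm U (z - family w) = 0"
  proof (rule tendsto_unique[OF nontriv lim])
    have "norm (member (z - family w) i) \<le> \<bar>norm (member z i) - r\<bar>" for i
    proof -
      have eq: "member (z - family w) i = (1 - min 1 (r / norm (member z i))) *\<^sub>R member z i"
        by (simp add: w w_def algebra_simps)
      show ?thesis
        unfolding eq norm_scaleR
        using r by (cases "member z i = 0") (auto simp: min_def field_simps abs_if)
    qed
    moreover have "((\<lambda>i. \<bar>norm (member z i) - r\<bar>) \<longlongrightarrow> 0) U"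
      using tendsto_rabs_zero[OF LIM_zero[OF lim[of z]]] by (simp add: r_def)
    ultimately show "((\<lambda>i. norm (member (z - family w) i)) \<longlongrightarrow> 0) U"
      by (intro Lim_null_comparison[of "\<lambda>i. norm (member (z - family w) i)"] always_eventually) auto
  qed
  ultimately show "\<exists>y. ultra_seminorm U (z - y) = 0 \<and> norm y \<le> ultra_seminorm U z"
    by (auto simp: r_def)
qed

lemma reflexive_ultrapower_iff:
  fixes U :: "'i filter"
  assumes U: "is_ultrafilter U"
  shows "reflexive_space (ultrapower U :: ('i \<Rightarrow> 'a::real_normed_vector) set nspace) \<longleftrightarrow>
    seminorm_reflexive (ultra_seminorm U :: ('i discrete \<Rightarrow>\<^sub>C 'a) \<Rightarrow> real)"
proof (rule reflexive_space_iff_seminorm_reflexive[where \<pi> = "\<lambda>z. ultrapower_rel U `` {member z}"])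
  let ?\<pi> = "\<lambda>z :: 'i discrete \<Rightarrow>\<^sub>C 'a. ultrapower_rel U `` {member z}"
  show "is_seminorm (ultra_seminorm U :: ('i discrete \<Rightarrow>\<^sub>C 'a) \<Rightarrow> real)"
    by (rule quotient_seminormD(1)[OF quotient_seminorm_ultra_seminorm[OF U]])
  have "ultrapower_rel U `` {x} \<in> range ?\<pi>" if "bounded (range x)" for x :: "'i \<Rightarrow> 'a"
    using member_family[OF that] by (metis rangeI)
  then show "ncarrier (ultrapower U :: ('i \<Rightarrow> 'a) set nspace) = range ?\<pi>"
    using bounded_member by (auto simp: ultrapower_def quotient_def)
  fix y z :: "'i discrete \<Rightarrow>\<^sub>C 'a" and c :: real
  show "nadd (ultrapower U) (?\<pi> y) (?\<pi> z) = ?\<pi> (y + z)"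
    unfolding nadd_ultrapower[OF bounded_member bounded_member] by (simp flip: member_simps(1))
  show "nscale (ultrapower U) c (?\<pi> z) = ?\<pi> (c *\<^sub>R z)"
    unfolding nscale_ultrapower[OF bounded_member] by (simp flip: member_simps(3))
  show "nnorm (ultrapower U) (?\<pi> z) = ultra_seminorm U z"
    by (simp add: ultra_seminorm_def)
qed

section \<open>Coarse solvent and almost uncollapsed maps\<close>

text \<open>Both hypotheses yield a map which moves points at small distance by at most \<open>W\<close> and points at
  distance about \<open>t\<close> by more than \<open>2 W\<close>.\<close>
definition separating_map :: "('a::real_normed_vector \<Rightarrow> 'b::real_normed_vector) \<Rightarrow>
    real \<Rightarrow> real \<Rightarrow> real \<Rightarrow> real \<Rightarrow> bool" where
  "separating_map f t \<eta> W V \<longleftrightarrow> 0 < t \<and> 0 < \<eta> \<and> 2 * W < V \<and>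
     (\<forall>x y. norm (x - y) \<le> \<eta> \<longrightarrow> norm (f x - f y) \<le> W) \<and>
     (\<forall>x y. \<bar>norm (x - y) - t\<bar> \<le> \<eta> \<longrightarrow> V \<le> norm (f x - f y))"

text \<open>Solvency for an integer \<open>n > 2 W\<close>, where \<open>W\<close> bounds the map at distance one, gives an interval
  \<open>[R, R + 1]\<close> of distances at which image points are more than \<open>n\<close> apart.\<close>
lemma coarse_solvent_imp_separating:
  fixes f :: "'a::real_normed_vector \<Rightarrow> 'b::real_normed_vector"
  assumes coarse: "coarse_map f" and solvent: "solvent_map f"
  obtains t \<eta> W V where "separating_map f t \<eta> W V"
proof -
  let ?S = "{ereal (dist (f x) (f y)) |x y. dist x y \<le> 1}"
  have "Sup ?S < \<infinity>" using coarse by (simp add: coarse_map_def expansion_modulus_def)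
  from ereal_dense2[OF this] obtain W where W: "Sup ?S < ereal W" by blast
  have le_W: "norm (f x - f y) \<le> W" if "norm (x - y) \<le> 1" for x y
  proof -
    have "ereal (dist (f x) (f y)) \<le> Sup ?S"
      by (rule Sup_upper) (use that in \<open>auto simp: dist_norm\<close>)
    then have "ereal (dist (f x) (f y)) \<le> ereal W" using W by (rule order_trans[OF _ less_imp_le])
    then show ?thesis by (simp add: dist_norm)
  qed
  obtain n :: nat where n: "max (2 * W) 1 < real n" using reals_Archimedean2 by blast
  obtain R where R: "0 < R" "\<And>x y. dist x y \<in> {R..R + real n} \<Longrightarrow> real n < dist (f x) (f y)"
    using solvent unfolding solvent_map_def by blast
  have "separating_map f (R + 1 / 2) (1 / 2) W (real n)"
    unfolding separating_map_def
  proof (intro conjI allI impI)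
    fix x y :: 'a assume "\<bar>norm (x - y) - (R + 1 / 2)\<bar> \<le> 1 / 2"
    then have "R \<le> dist x y" "dist x y \<le> R + 1" unfolding dist_norm by linarith+
    then show "real n \<le> norm (f x - f y)" using R(2)[of x y] n by (simp add: dist_norm)
  qed (use R n le_W in auto)
  then show thesis by (rule that)
qed

text \<open>Uniform continuity lets the exact distance \<open>t\<close> vary a little: move one point radially.\<close>
lemma uniformly_continuous_uncollapsed_imp_separating:
  fixes f :: "'a::real_normed_vector \<Rightarrow> 'b::real_normed_vector"
  assumes cont: "uniformly_continuous_on UNIV f" and uncollapsed: "almost_uncollapsed f"
  obtains t \<eta> W V where "separating_map f t \<eta> W V"
proof -
  obtain t where t: "0 < t" "0 < exact_compression_modulus f t"
    using uncollapsed by (auto simp: almost_uncollapsed_def)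
  let ?S = "{ereal (dist (f x) (f y)) |x y. dist x y = t}"
  obtain \<delta> where \<delta>: "0 < ereal \<delta>" "ereal \<delta> < Inf ?S"
    using ereal_dense2[OF t(2)] by (auto simp: exact_compression_modulus_def)
  have far: "\<delta> \<le> norm (f x - f y)" if "norm (x - y) = t" for x y
  proof -
    have "Inf ?S \<le> ereal (dist (f x) (f y))"
      by (rule Inf_lower) (use that in \<open>auto simp: dist_norm\<close>)
    with \<delta>(2) have "ereal \<delta> < ereal (dist (f x) (f y))" by (rule less_le_trans)
    then show ?thesis by (simp add: dist_norm)
  qed
  have \<delta>0: "0 < \<delta>" using \<delta>(1) by simp
  obtain d where d: "0 < d" "\<And>x y. dist x y < d \<Longrightarrow> dist (f x) (f y) < \<delta> / 4"
    using cont \<delta>0 unfolding uniformly_continuous_on_def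
    by (metis UNIV_I dist_commute divide_pos_pos zero_less_numeral)
  define \<eta> where "\<eta> = min (d / 2) (t / 2)"
  have \<eta>: "0 < \<eta>" "\<eta> < d" "\<eta> < t" using d t by (auto simp: \<eta>_def)
  have near: "norm (f x - f y) \<le> \<delta> / 4" if "norm (x - y) \<le> \<eta>" for x y
    using d(2)[of x y] that \<eta> by (simp add: dist_norm)
  have "separating_map f t \<eta> (\<delta> / 4) (\<delta> * 3 / 4)"
    unfolding separating_map_def
  proof (intro conjI allI impI)
    fix x y :: 'a assume xy: "\<bar>norm (x - y) - t\<bar> \<le> \<eta>"
    then have pos: "0 < norm (x - y)" using \<eta> by linarith
    define z where "z = y + (t / norm (x - y)) *\<^sub>R (x - y)"
    have zy: "norm (z - y) = t" using pos t by (simp add: z_def)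
    have "x - z = (1 - t / norm (x - y)) *\<^sub>R (x - y)" by (simp add: z_def algebra_simps)
    then have "norm (x - z) = \<bar>(1 - t / norm (x - y)) * norm (x - y)\<bar>" by (simp add: abs_mult)
    also have "(1 - t / norm (x - y)) * norm (x - y) = norm (x - y) - t"
      using pos by (simp add: left_diff_distrib)
    finally have "norm (x - z) \<le> \<eta>" using xy by simp
    then have "norm (f x - f z) \<le> \<delta> / 4" "\<delta> \<le> norm (f z - f y)" using far[OF zy] near by blast+
    then show "\<delta> * 3 / 4 \<le> norm (f x - f y)"
      using norm_triangle_ineq[of "f z - f x" "f x - f y"] by (simp add: norm_minus_commute)
  qed (use t \<eta> \<delta>0 near in auto)
  then show thesis by (rule that)
qed

text \<open>A map that is bounded at one scale is bounded on bounded sets, by subdividing segments.\<close>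
lemma separating_map_bounded:
  fixes f :: "'a::real_normed_vector \<Rightarrow> 'b::real_normed_vector"
  assumes "separating_map f t \<eta> W V"
  obtains B where "\<And>x. norm x \<le> C \<Longrightarrow> norm (f x) \<le> B"
proof -
  have \<eta>: "0 < \<eta>" and W: "\<And>x y. norm (x - y) \<le> \<eta> \<Longrightarrow> norm (f x - f y) \<le> W"
    using assms by (auto simp: separating_map_def)
  have *: "norm x \<le> real n * \<eta> \<Longrightarrow> norm (f x - f 0) \<le> real n * W" for n x
  proof (induction n arbitrary: x)
    case (Suc n)
    define y where "y = (real n / real (Suc n)) *\<^sub>R x"
    have "norm y = real n * (norm x / real (Suc n))" by (simp add: y_def)
    also have "\<dots> \<le> real n * \<eta>"
      using Suc.prems by (intro mult_left_mono) (auto simp: field_simps)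
    finally have y: "norm (f y - f 0) \<le> real n * W" by (rule Suc.IH)
    have "x - y = (1 - real n / real (Suc n)) *\<^sub>R x" by (simp add: y_def scaleR_diff_left)
    also have "1 - real n / real (Suc n) = 1 / real (Suc n)" by (simp add: field_simps)
    finally have "x - y = (1 / real (Suc n)) *\<^sub>R x" .
    then have "norm (x - y) = 1 / real (Suc n) * norm x" by (simp only: norm_scaleR) simp
    also have "\<dots> \<le> \<eta>" using Suc.prems by (simp add: field_simps)
    finally have "norm (x - y) \<le> \<eta>" .
    from W[OF this] y norm_triangle_ineq[of "f x - f y" "f y - f 0"] show ?case
      by (simp add: distrib_right)
  qed simp
  define n where "n = nat \<lceil>C / \<eta>\<rceil>"
  have "C / \<eta> \<le> real n" unfolding n_def by linarith
  then have n: "C \<le> real n * \<eta>" using \<eta> by (simp add: field_simps)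
  have "norm (f x) \<le> norm (f 0) + real n * W" if "norm x \<le> C" for x
    using *[of x n] n that norm_triangle_ineq[of "f x - f 0" "f 0"] by simp
  then show thesis by (rule that)
qed

lemma length_evens_odds:
  "length l = 2 * k \<Longrightarrow> length (evens l) = k" "length l = 2 * k \<Longrightarrow> length (odds l) = k"
proof -
  have "length (evens l) + length (odds l) = length l \<and> length (odds l) \<le> length (evens l) \<and>
    length (evens l) \<le> Suc (length (odds l))" by (induction l) auto
  then show "length l = 2 * k \<Longrightarrow> length (evens l) = k" "length l = 2 * k \<Longrightarrow> length (odds l) = k"
    by linarith+
qed

lemma norm_sum_list_le:
  fixes y :: "'i \<Rightarrow> 'v::real_normed_vector"
  assumes "\<And>n. norm (y n) \<le> C"
  shows "norm (sum_list (map y l)) \<le> real (length l) * C"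
proof (induction l)
  case (Cons n l)
  then show ?case
    using norm_triangle_ineq[of "y n" "sum_list (map y l)"] assms[of n] by (simp add: algebra_simps)
qed simp

text \<open>The form of \<open>interlaced_close_imp_separated_close\<close> in which a separating map contradicts it,
  for a function that is only bounded on the lists of length \<open>k\<close>.\<close>
lemma reflexive_target_excludes_separation:
  fixes q :: "'w::real_vector \<Rightarrow> real" and F :: "nat list \<Rightarrow> 'w"
  assumes q: "is_seminorm q" and refl: "seminorm_reflexive q"
    and B: "\<And>l. length l = k \<Longrightarrow> q (F l) \<le> B" and WV: "2 * W < V"
    and near: "\<And>l. length l = 2 * k \<Longrightarrow> sorted_wrt (<) l \<Longrightarrow> q (F (evens l) - F (odds l)) \<le> W"
    and far: "\<And>l. length l = 2 * k \<Longrightarrow> sorted_wrt (<) l \<Longrightarrow> V \<le> q (F (take k l) - F (drop k l))"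
  shows False
proof -
  define G where "G l = (if length l = k then F l else 0)" for l
  have B': "q (G l) \<le> max B 0" for l
    using B[of l] by (auto simp: G_def is_seminormD(3)[OF q])
  have near': "q (G (evens l) - G (odds l)) \<le> W" if "length l = 2 * k" "sorted_wrt (<) l" for l
    using near[OF that] length_evens_odds[OF that(1)] by (simp add: G_def)
  show False
  proof (rule interlaced_close_imp_separated_close[OF q refl B' near'])
    show "0 < V - 2 * W" using WV by simp
    fix l :: "nat list"
    assume l: "length l = 2 * k" "sorted_wrt (<) l" "q (G (take k l) - G (drop k l)) < 2 * W + (V - 2 * W)"
    with far[OF l(1,2)] show False by (simp add: G_def)
  qed
qed

section \<open>Type and \<open>\<ell>\<^sub>1\<close> spreading models\<close>

text \<open>For such \<open>k\<close>-tuples type \<open>q\<close> would give \<open>(c k)\<^sup>q \<le> (2 T)\<^sup>q k\<close>, so that \<open>k\<close> would be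
  bounded because \<open>q > 1\<close>.\<close>
lemma l1_tuples_imp_trivial_type:
  fixes c :: real
  assumes c: "0 < c"
    and tuples: "\<And>k. 0 < k \<Longrightarrow> \<exists>x :: nat \<Rightarrow> 'a::real_normed_vector. (\<forall>j<k. norm (x j) \<le> 2) \<and>
      (\<forall>\<epsilon>\<in>{..<k} \<rightarrow>\<^sub>E {-1, 1}. c * real k \<le> norm (\<Sum>j<k. \<epsilon> j *\<^sub>R x j))"
  shows "trivial_type TYPE('a)"
  unfolding trivial_type_def
proof (intro notI, elim exE conjE)
  fix q :: real assume q: "1 < q" and "has_type q TYPE('a)"
  then obtain T where T: "0 < T" "\<And>n (x :: nat \<Rightarrow> 'a).
      (\<Sum>\<epsilon>\<in>{..<n} \<rightarrow>\<^sub>E {-1, 1}. norm (\<Sum>j<n. \<epsilon> j *\<^sub>R x j) powr q) / 2 ^ n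
        \<le> T powr q * (\<Sum>j<n. norm (x j) powr q)"
    unfolding has_type_def by blast
  have bound: "real k powr (q - 1) \<le> (T * 2 / c) powr q" if k: "0 < k" for k
  proof -
    obtain x :: "nat \<Rightarrow> 'a" where x: "\<And>j. j < k \<Longrightarrow> norm (x j) \<le> 2"
      "\<And>\<epsilon>. \<epsilon> \<in> {..<k} \<rightarrow>\<^sub>E {-1, 1} \<Longrightarrow> c * real k \<le> norm (\<Sum>j<k. \<epsilon> j *\<^sub>R x j)"
      using tuples[OF k] by blast
    have card: "card ({..<k} \<rightarrow>\<^sub>E {-1, 1 :: real}) = 2 ^ k" by (simp add: card_PiE numeral_2_eq_2)
    have "(c * real k) powr q = (\<Sum>\<epsilon>\<in>{..<k} \<rightarrow>\<^sub>E {-1, 1 :: real}. (c * real k) powr q) / 2 ^ k"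
      by (simp add: card)
    also have "\<dots> \<le> (\<Sum>\<epsilon>\<in>{..<k} \<rightarrow>\<^sub>E {-1, 1}. norm (\<Sum>j<k. \<epsilon> j *\<^sub>R x j) powr q) / 2 ^ k"
      using c q x(2) by (intro divide_right_mono sum_mono powr_mono2) auto
    also have "\<dots> \<le> T powr q * (\<Sum>j<k. norm (x j) powr q)" by (rule T(2))
    also have "\<dots> \<le> T powr q * (\<Sum>j<k. 2 powr q)"
      using x(1) q by (intro mult_left_mono sum_mono powr_mono2) auto
    also have "\<dots> = (T * 2) powr q * real k" using T(1) by (simp add: powr_mult)
    finally have "c powr q * real k powr q \<le> (T * 2) powr q * real k" using c by (simp add: powr_mult)
    moreover have "real k powr q = real k powr (q - 1) * real k" using k by (simp add: powr_diff)
    ultimately have "c powr q * real k powr (q - 1) \<le> (T * 2) powr q" using k by simp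
    then show ?thesis using c T(1) by (simp add: powr_divide field_simps)
  qed
  \<comment> \<open>\<open>k\<close> is chosen with \<open>k powr (q - 1)\<close> at least \<open>M + 1\<close>\<close>
  define M where "M = (T * 2 / c) powr q"
  have M: "0 < M" using T(1) c by (simp add: M_def)
  obtain k :: nat where k: "(M + 1) powr (1 / (q - 1)) < real k" using reals_Archimedean2 by blast
  then have "0 < real k" using powr_ge_zero[of "M + 1" "1 / (q - 1)"] by linarith
  have "M + 1 = ((M + 1) powr (1 / (q - 1))) powr (q - 1)" using q M by (simp add: powr_powr)
  also have "\<dots> \<le> real k powr (q - 1)" using k q by (intro powr_mono2) auto
  also have "\<dots> \<le> M" unfolding M_def using bound \<open>0 < real k\<close> by simp
  finally show False by simp
qed

text \<open>Only finitely many sums over signs occur, so one member of the families already has all the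
  lower bounds.\<close>
lemma l1_in_ultrapower_imp_trivial_type:
  fixes u :: "nat \<Rightarrow> 'i discrete \<Rightarrow>\<^sub>C 'a::real_normed_vector"
  assumes U: "is_ultrafilter U" and c: "0 < c" and u: "\<And>n. norm (u n) \<le> 2"
    and l1: "\<And>k a. \<exists>L. spreading_limit (ultra_seminorm U) u k a L \<and> c * (\<Sum>j<k. \<bar>a j\<bar>) \<le> L"
  shows "trivial_type TYPE('a)"
proof (rule l1_tuples_imp_trivial_type)
  show "0 < c / 4" using c by simp
  fix k :: nat assume k: "0 < k"
  let ?E = "{..<k} \<rightarrow>\<^sub>E {-1, 1 :: real}"
  have fin: "finite ?E" by (intro finite_PiE) auto
  have pos: "0 < c * real k / 2" using c k by simp
  have "\<forall>\<epsilon>\<in>?E. \<exists>m. \<forall>n\<ge>m. c * real k / 2 \<le> ultra_seminorm U (\<Sum>j<k. \<epsilon> j *\<^sub>R u (n + j))"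
  proof
    fix \<epsilon> assume \<epsilon>: "\<epsilon> \<in> ?E"
    obtain L where L: "spreading_limit (ultra_seminorm U) u k \<epsilon> L" "c * (\<Sum>j<k. \<bar>\<epsilon> j\<bar>) \<le> L"
      using l1 by blast
    have "\<bar>\<epsilon> j\<bar> = 1" if "j < k" for j using PiE_mem[OF \<epsilon>, of j] that by auto
    with L(2) have ge: "c * real k \<le> L" by simp
    obtain m where m: "\<And>n. strict_mono_on {..<k} n \<Longrightarrow> (\<And>j. j < k \<Longrightarrow> m \<le> n j) \<Longrightarrow>
      \<bar>ultra_seminorm U (\<Sum>j<k. \<epsilon> j *\<^sub>R u (n j)) - L\<bar> < c * real k / 2"
      by (rule spreading_limitD[OF L(1) pos]) blast
    have "c * real k / 2 \<le> ultra_seminorm U (\<Sum>j<k. \<epsilon> j *\<^sub>R u (n + j))" if "m \<le> n" for n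
    proof -
      have "\<bar>ultra_seminorm U (\<Sum>j<k. \<epsilon> j *\<^sub>R u (n + j)) - L\<bar> < c * real k / 2"
        by (rule m) (use that in \<open>auto simp: strict_mono_on_def\<close>)
      with ge show ?thesis by linarith
    qed
    then show "\<exists>m. \<forall>n\<ge>m. c * real k / 2 \<le> ultra_seminorm U (\<Sum>j<k. \<epsilon> j *\<^sub>R u (n + j))"
      by (intro exI[of _ m] allI impI)
  qed
  from bchoice[OF this] obtain m where
    m: "\<forall>\<epsilon>\<in>?E. \<forall>n\<ge>m \<epsilon>. c * real k / 2 \<le> ultra_seminorm U (\<Sum>j<k. \<epsilon> j *\<^sub>R u (n + j))" ..
  define n where "n = Max (insert 0 (m ` ?E))"
  have n: "c * real k / 2 \<le> ultra_seminorm U (\<Sum>j<k. \<epsilon> j *\<^sub>R u (n + j))" if "\<epsilon> \<in> ?E" for \<epsilon>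
    by (rule m[rule_format, OF that]) (use fin that in \<open>auto simp: n_def\<close>)
  have "eventually (\<lambda>i. c / 4 * real k < norm (member (\<Sum>j<k. \<epsilon> j *\<^sub>R u (n + j)) i)) U"
    if \<epsilon>: "\<epsilon> \<in> ?E" for \<epsilon>
    by (rule order_tendstoD(1)[OF ultra_seminorm_tendsto[OF U]]) (use n[OF \<epsilon>] pos in linarith)
  then have ev: "eventually (\<lambda>i. \<forall>\<epsilon>\<in>?E. c / 4 * real k < norm (member (\<Sum>j<k. \<epsilon> j *\<^sub>R u (n + j)) i)) U"
    using fin by (simp add: eventually_ball_finite_distrib)
  have "U \<noteq> bot" using U by (simp add: is_ultrafilter_def)
  from eventually_happens'[OF this ev] obtain i where i: "\<forall>\<epsilon>\<in>?E. c / 4 * real k < norm (member (\<Sum>j<k. \<epsilon> j *\<^sub>R u (n + j)) i)"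
    ..
  show "\<exists>x :: nat \<Rightarrow> 'a. (\<forall>j<k. norm (x j) \<le> 2) \<and>
      (\<forall>\<epsilon>\<in>?E. c / 4 * real k \<le> norm (\<Sum>j<k. \<epsilon> j *\<^sub>R x j))"
  proof (intro exI[of _ "\<lambda>j. member (u (n + j)) i"] conjI allI impI ballI)
    show "norm (member (u (n + j)) i) \<le> 2" for j
      by (rule order_trans[OF norm_member_le u])
    show "c / 4 * real k \<le> norm (\<Sum>j<k. \<epsilon> j *\<^sub>R member (u (n + j)) i)" if "\<epsilon> \<in> ?E" for \<epsilon>
      using i[rule_format, OF that] by (simp add: member_sum)
  qed
qed

text \<open>The seminorm on finitely supported sequences is the limit of the norms
  \<open>\<parallel>\<Sum>j. a j *\<^sub>R u (m + j)\<parallel>\<close> of shifted combinations.\<close>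
lemma has_l1_spreading_modelI:
  fixes u :: "nat \<Rightarrow> 'a::real_normed_vector"
  assumes c: "0 < c" and u: "\<And>n. norm (u n) \<le> C"
    and l1: "\<And>k a. \<exists>L. spreading_limit norm u k a L \<and> c * (\<Sum>j<k. \<bar>a j\<bar>) \<le> L"
  shows "has_l1_spreading_model TYPE('a)"
proof -
  define w where "w a m = (\<Sum>j\<in>Poly_Mapping.keys a. Poly_Mapping.lookup a j *\<^sub>R u (m + j))"
    for a :: "(nat, real) poly_mapping" and m
  have w_eq: "w a m = (\<Sum>j<k. Poly_Mapping.lookup a j *\<^sub>R u (m + j))"
    if "Poly_Mapping.keys a \<subseteq> {..<k}" for a m k
    unfolding w_def by (rule sum.mono_neutral_left) (use that in \<open>auto simp: in_keys_iff\<close>)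
  have keys: "\<exists>k. \<forall>a\<in>A. Poly_Mapping.keys a \<subseteq> {..<k}" if "finite A" for A :: "(nat, real) poly_mapping set"
  proof -
    have "finite (\<Union>a\<in>A. Poly_Mapping.keys a)" using that by simp
    then obtain k where "(\<Union>a\<in>A. Poly_Mapping.keys a) \<subseteq> {..<k}" using finite_nat_iff_bounded by blast
    then show ?thesis by blast
  qed
  define \<nu> where "\<nu> a = lim (\<lambda>m. norm (w a m))" for a
  have limit: "\<exists>L. (\<lambda>m. norm (w a m)) \<longlonglongrightarrow> L \<and> spreading_limit norm u k (Poly_Mapping.lookup a) L \<and>
      c * (\<Sum>j<k. \<bar>Poly_Mapping.lookup a j\<bar>) \<le> L" if k: "Poly_Mapping.keys a \<subseteq> {..<k}" for a k
  proof -
    obtain L where L: "spreading_limit norm u k (Poly_Mapping.lookup a) L"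
      "c * (\<Sum>j<k. \<bar>Poly_Mapping.lookup a j\<bar>) \<le> L" using l1 by blast
    have "(\<lambda>m. norm (w a m)) \<longlonglongrightarrow> L"
    proof (rule LIMSEQ_I)
      fix \<delta> :: real assume "0 < \<delta>"
      with L(1) obtain m0 where m0: "\<And>n. strict_mono_on {..<k} n \<Longrightarrow> (\<And>j. j < k \<Longrightarrow> m0 \<le> n j) \<Longrightarrow>
          \<bar>norm (\<Sum>j<k. Poly_Mapping.lookup a j *\<^sub>R u (n j)) - L\<bar> < \<delta>"
        by (rule spreading_limitD) blast
      have "\<bar>norm (w a m) - L\<bar> < \<delta>" if "m0 \<le> m" for m
        unfolding w_eq[OF k] by (rule m0) (use that in \<open>auto simp: strict_mono_on_def\<close>)
      then show "\<exists>m0. \<forall>m\<ge>m0. norm (norm (w a m) - L) < \<delta>" by auto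
    qed
    with L show ?thesis by blast
  qed
  have \<nu>: "(\<lambda>m. norm (w a m)) \<longlonglongrightarrow> \<nu> a" for a
  proof -
    obtain k where "Poly_Mapping.keys a \<subseteq> {..<k}" using keys[of "{a}"] by auto
    from limit[OF this] obtain L where "(\<lambda>m. norm (w a m)) \<longlonglongrightarrow> L" by blast
    then show ?thesis unfolding \<nu>_def by (simp add: limI)
  qed
  have \<nu>_spreading: "spreading_limit norm u k (Poly_Mapping.lookup a) (\<nu> a)"
    "c * (\<Sum>j<k. \<bar>Poly_Mapping.lookup a j\<bar>) \<le> \<nu> a" if "Poly_Mapping.keys a \<subseteq> {..<k}" for a k
    using limit[OF that] LIMSEQ_unique[OF \<nu>[of a]] by blast+
  have w_add: "w (a + b) m = w a m + w b m" for a b m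
  proof -
    obtain k where k: "\<forall>d\<in>{a, b, a + b}. Poly_Mapping.keys d \<subseteq> {..<k}" using keys[of "{a, b, a + b}"] by auto
    then show ?thesis by (simp add: w_eq[of _ k] lookup_add scaleR_add_left sum.distrib)
  qed
  have lookup_scaleR: "Poly_Mapping.lookup (r *\<^sub>R a) j = r * Poly_Mapping.lookup a j"
    for r j and a :: "(nat, real) poly_mapping"
  proof -
    have "finite {i. r *\<^sub>R Poly_Mapping.lookup a i \<noteq> 0}"
      by (rule finite_subset[OF _ finite_lookup[of a]]) auto
    then show ?thesis by (simp add: scaleR_poly_mapping_def Abs_poly_mapping_inverse)
  qed
  have w_scale: "w (r *\<^sub>R a) m = r *\<^sub>R w a m" for r a m
  proof -
    obtain k where k: "\<forall>d\<in>{a, r *\<^sub>R a}. Poly_Mapping.keys d \<subseteq> {..<k}" using keys[of "{a, r *\<^sub>R a}"] by auto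
    then show ?thesis by (simp add: w_eq[of _ k] lookup_scaleR scaleR_sum_right)
  qed
  have "is_seminorm \<nu>"
    unfolding is_seminorm_def
  proof (intro conjI allI)
    fix a b :: "(nat, real) poly_mapping" and r :: real
    show "\<nu> (a + b) \<le> \<nu> a + \<nu> b"
      by (rule tendsto_le[OF sequentially_bot tendsto_add[OF \<nu>[of a] \<nu>[of b]] \<nu>])
         (simp add: w_add norm_triangle_ineq)
    show "\<nu> (r *\<^sub>R a) = \<bar>r\<bar> * \<nu> a"
      using LIMSEQ_unique[OF \<nu>[of "r *\<^sub>R a"]] tendsto_mult_left[OF \<nu>[of a], of "\<bar>r\<bar>"]
      by (simp add: w_scale)
  qed
  define e where "e j = Poly_Mapping.single j (1 :: real)" for j :: nat
  have lookup_e: "Poly_Mapping.lookup (\<Sum>j<k. a j *\<^sub>R e j) i = (if i < k then a i else 0)" for k i and a :: "nat \<Rightarrow> real"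
  proof -
    have "Poly_Mapping.lookup (\<Sum>j<k. a j *\<^sub>R e j) i = (\<Sum>j<k. if i = j then a i else 0)"
      unfolding lookup_sum lookup_scaleR by (rule sum.cong) (auto simp: e_def lookup_single when_def)
    then show ?thesis by simp
  qed
  have keys_e: "Poly_Mapping.keys (\<Sum>j<k. a j *\<^sub>R e j) \<subseteq> {..<k}" for k and a :: "nat \<Rightarrow> real"
    by (auto simp: in_keys_iff lookup_e split: if_splits)
  have "spreading_limit norm u k a (\<nu> (\<Sum>j<k. a j *\<^sub>R e j))" for k a
    using \<nu>_spreading(1)[OF keys_e] by (simp add: spreading_limit_def lookup_e)
  then have "generates_spreading_model u \<nu> e"
    using \<open>is_seminorm \<nu>\<close> u unfolding generates_spreading_model_def spreading_limit_def
    by (auto simp: bounded_iff)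
  moreover have "equivalent_l1_basis \<nu> e"
    unfolding equivalent_l1_basis_def
    using c \<nu>_spreading(2)[OF keys_e] by (auto simp: lookup_e)
  ultimately show ?thesis unfolding has_l1_spreading_model_def by blast
qed

section \<open>Transfer of reflexivity and super-reflexivity\<close>

text \<open>In the second alternative, scaled to the distances at which \<open>f\<close> separates points, the images
  under \<open>f\<close> of the sums over tuples contradict reflexivity of the target.\<close>
lemma reflexive_or_l1_spreading_model:
  fixes f :: "'a::banach \<Rightarrow> 'b::real_normed_vector"
  assumes f: "separating_map f t \<eta> W V" and refl: "reflexive TYPE('b)"
  shows "reflexive TYPE('a) \<or> has_l1_spreading_model TYPE('a)"
proof (intro disj_imp[THEN iffD2] impI)
  assume "\<not> reflexive TYPE('a)"
  then have nonrefl: "\<not> seminorm_reflexive (norm :: 'a \<Rightarrow> real)"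
    by (simp add: reflexive_iff_seminorm_reflexive)
  from f have t: "0 < t" "0 < \<eta>" "2 * W < V"
    and close: "\<And>x y. norm (x - y) \<le> \<eta> \<Longrightarrow> norm (f x - f y) \<le> W"
    and apart: "\<And>x y. \<bar>norm (x - y) - t\<bar> \<le> \<eta> \<Longrightarrow> V \<le> norm (f x - f y)"
    by (auto simp: separating_map_def)
  show "has_l1_spreading_model TYPE('a)"
    using quotient_seminorm_norm nonrefl
  proof (cases rule: nonreflexive_alternative)
    case (l1 u c)
    then show ?thesis by (intro has_l1_spreading_modelI)
  next
    case small
    obtain k C and y :: "nat \<Rightarrow> 'a" where y: "\<forall>n. norm (y n) \<le> C" "\<forall>l :: nat list. length l = 2 * k \<longrightarrow> sorted_wrt (<) l \<longrightarrow>
        norm (sum_list (map y (evens l)) - sum_list (map y (odds l))) < \<eta> \<and>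
        \<bar>norm (sum_list (map y (take k l)) - sum_list (map y (drop k l))) - t\<bar> < \<eta>"
      using small[OF t(1,2)] by blast
    note y = y[rule_format]
    obtain B where B: "\<And>x. norm x \<le> real k * C \<Longrightarrow> norm (f x) \<le> B"
      using separating_map_bounded[OF f] by blast
    have False
    proof (rule reflexive_target_excludes_separation[OF is_seminorm_norm _ _ t(3)])
      show "seminorm_reflexive (norm :: 'b \<Rightarrow> real)"
        using refl by (simp add: reflexive_iff_seminorm_reflexive)
      show "norm (f (sum_list (map y l))) \<le> B" if "length l = k" for l
        using B norm_sum_list_le[of y C l] y(1) that by simp
      show "norm (f (sum_list (map y (evens l))) - f (sum_list (map y (odds l)))) \<le> W"
        if "length l = 2 * k" "sorted_wrt (<) l" for l
        using close y(2)[OF that] by simp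
      show "V \<le> norm (f (sum_list (map y (take k l))) - f (sum_list (map y (drop k l))))"
        if "length l = 2 * k" "sorted_wrt (<) l" for l
        using apart y(2)[OF that] by simp
    qed
    then show ?thesis ..
  qed
qed

lemma ultrafilter_to_infinity:
  obtains V :: "'j::infinite filter" and h :: "'j \<Rightarrow> nat" where
    "is_ultrafilter V" "filterlim h at_top V"
proof -
  obtain e :: "nat \<Rightarrow> 'j" where e: "inj e"
    using infinite_countable_subset[OF infinite_UNIV] by blast
  have "filtermap e sequentially \<noteq> bot" by (simp add: filtermap_bot_iff)
  then obtain V where V: "is_ultrafilter V" "V \<le> filtermap e sequentially"
    by (rule ultrafilter_finer)
  have "filterlim (inv e) at_top (filtermap e sequentially)"
    using e by (simp add: filterlim_filtermap inv_f_f filterlim_ident)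
  then have "filterlim (inv e) at_top V" using V(2) by (rule filterlim_mono[OF _ order_refl])
  with V(1) show thesis by (rule that)
qed

text \<open>The small interlaced differences live in an ultrapower of \<open>X\<close>, where there is no map to
  \<open>Y\<close>. The finitely many inequalities for tuples with entries below \<open>N\<close> hold in a suitable member
  of the families, that is, in \<open>X\<close>. Mapping these members to \<open>Y\<close> for \<open>N\<close> tending to infinity along an
  ultrafilter gives a family of tuples in an ultrapower of \<open>Y\<close> to which reflexivity applies.\<close>
lemma super_reflexive_or_trivial_type:
  fixes f :: "'a::banach \<Rightarrow> 'b::real_normed_vector"
  assumes f: "separating_map f t \<eta> W V" and super: "super_reflexive TYPE('j::infinite) TYPE('b)"
  shows "super_reflexive TYPE('i) TYPE('a) \<or> trivial_type TYPE('a)"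
proof (intro disj_imp[THEN iffD2] impI)
  assume "\<not> super_reflexive TYPE('i) TYPE('a)"
  then obtain U :: "'i filter" where U: "is_ultrafilter U"
    and nonrefl: "\<not> seminorm_reflexive (ultra_seminorm U :: ('i discrete \<Rightarrow>\<^sub>C 'a) \<Rightarrow> real)"
    by (auto simp: super_reflexive_def reflexive_ultrapower_iff)
  from f have t: "0 < t" "0 < \<eta>" "2 * W < V"
    and close: "\<And>x y. norm (x - y) \<le> \<eta> \<Longrightarrow> norm (f x - f y) \<le> W"
    and apart: "\<And>x y. \<bar>norm (x - y) - t\<bar> \<le> \<eta> \<Longrightarrow> V \<le> norm (f x - f y)"
    by (auto simp: separating_map_def)
  have nontriv: "U \<noteq> bot" using U by (simp add: is_ultrafilter_def)
  show "trivial_type TYPE('a)"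
    using quotient_seminorm_ultra_seminorm[OF U] nonrefl
  proof (cases rule: nonreflexive_alternative)
    case (l1 u c)
    then show ?thesis by (intro l1_in_ultrapower_imp_trivial_type[OF U])
  next
    case small
    obtain k C and y :: "nat \<Rightarrow> 'i discrete \<Rightarrow>\<^sub>C 'a" where y: "\<forall>n. norm (y n) \<le> C" "\<forall>l :: nat list. length l = 2 * k \<longrightarrow> sorted_wrt (<) l \<longrightarrow>
        ultra_seminorm U (sum_list (map y (evens l)) - sum_list (map y (odds l))) < \<eta> \<and>
        \<bar>ultra_seminorm U (sum_list (map y (take k l)) - sum_list (map y (drop k l))) - t\<bar> < \<eta>"
      using small[OF t(1,2)] by blast
    note y = y[rule_format]
    define Q where "Q z l \<longleftrightarrow> norm (sum_list (map z (evens l)) - sum_list (map z (odds l))) < \<eta> \<and>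
        \<bar>norm (sum_list (map z (take k l)) - sum_list (map z (drop k l))) - t\<bar> < \<eta>"
      for z :: "nat \<Rightarrow> 'a" and l
    define A where "A N = {l :: nat list. length l = 2 * k \<and> sorted_wrt (<) l \<and> set l \<subseteq> {..<N}}" for N
    have A: "finite (A N)" for N
      by (rule finite_subset[OF _ finite_lists_length_eq[of "{..<N}" "2 * k"]]) (auto simp: A_def)
    have "eventually (\<lambda>i. Q (\<lambda>n. member (y n) i) l) U" if "l \<in> A N" for l N
    proof -
      have l: "length l = 2 * k" "sorted_wrt (<) l" using that by (auto simp: A_def)
      have "((\<lambda>i. \<bar>norm (member (sum_list (map y (take k l)) - sum_list (map y (drop k l))) i) - t\<bar>)
          \<longlongrightarrow> \<bar>ultra_seminorm U (sum_list (map y (take k l)) - sum_list (map y (drop k l))) - t\<bar>) U"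
        by (intro tendsto_intros ultra_seminorm_tendsto U)
      from order_tendstoD(2)[OF this, of \<eta>]
        order_tendstoD(2)[OF ultra_seminorm_tendsto[OF U, of "sum_list (map y (evens l)) - sum_list (map y (odds l))"], of \<eta>]
      show ?thesis using y(2)[OF l] by (simp add: Q_def member_sum_list eventually_conj_iff)
    qed
    then have "eventually (\<lambda>i. \<forall>l\<in>A N. Q (\<lambda>n. member (y n) i) l) U" for N
      using A by (simp add: eventually_ball_finite_distrib)
    then have "\<forall>N. \<exists>i. \<forall>l\<in>A N. Q (\<lambda>n. member (y n) i) l"
      using eventually_happens'[OF nontriv] by blast
    from choice[OF this] obtain i where i: "\<forall>N. \<forall>l\<in>A N. Q (\<lambda>n. member (y n) (i N)) l" ..
    define z where "z N n = member (y n) (i N)" for N n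
    have z: "norm (z N n) \<le> C" for N n
      unfolding z_def by (rule order_trans[OF norm_member_le y(1)])
    obtain B where B: "\<And>x. norm x \<le> real k * C \<Longrightarrow> norm (f x) \<le> B"
      using separating_map_bounded[OF f] by blast
    have fz: "norm (f (sum_list (map (z N) l))) \<le> B" if "length l = k" for N l
      using B norm_sum_list_le[of "z N" C l] z that by simp
    obtain \<U> :: "'j filter" and h :: "'j \<Rightarrow> nat" where \<U>: "is_ultrafilter \<U>" and h: "filterlim h at_top \<U>"
      by (rule ultrafilter_to_infinity)
    have nontriv': "\<U> \<noteq> bot" using \<U> by (simp add: is_ultrafilter_def)
    note lim = ultra_seminorm_tendsto[OF \<U>]
    define F where "F l = (family (\<lambda>j. f (sum_list (map (z (h j)) l))) :: 'j discrete \<Rightarrow>\<^sub>C 'b)" for l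
    have F: "member (F l) j = f (sum_list (map (z (h j)) l))" if "length l = k" for l j
    proof -
      have "bounded (range (\<lambda>j. f (sum_list (map (z (h j)) l))))"
        using fz[OF that] by (auto simp: bounded_iff)
      then show ?thesis unfolding F_def by (simp add: member_family)
    qed
    have good: "eventually (\<lambda>j. Q (z (h j)) l) \<U>" if l: "length l = 2 * k" "sorted_wrt (<) l" for l
    proof -
      have "eventually (\<lambda>j. Suc (sum_list l) \<le> h j) \<U>" using h by (simp add: filterlim_at_top)
      then show ?thesis
      proof eventually_elim
        case (elim j)
        then have "l \<in> A (h j)" using l member_le_sum_list[of _ l] by (force simp: A_def)
        then show ?case using i unfolding z_def by blast
      qed
    qed
    have False
    proof (rule reflexive_target_excludes_separation[where q = "ultra_seminorm \<U>" and F = F, OF _ _ _ t(3)])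
      show "is_seminorm (ultra_seminorm \<U> :: ('j discrete \<Rightarrow>\<^sub>C 'b) \<Rightarrow> real)"
        by (rule quotient_seminormD(1)[OF quotient_seminorm_ultra_seminorm[OF \<U>]])
      show "seminorm_reflexive (ultra_seminorm \<U> :: ('j discrete \<Rightarrow>\<^sub>C 'b) \<Rightarrow> real)"
        using super \<U> by (simp add: super_reflexive_def reflexive_ultrapower_iff)
      show "ultra_seminorm \<U> (F l) \<le> B" if "length l = k" for l
        by (rule tendsto_upperbound[OF lim _ nontriv']) (simp add: F[OF that] fz[OF that])
    next
      fix l :: "nat list" assume l: "length l = 2 * k" "sorted_wrt (<) l"
      show "ultra_seminorm \<U> (F (evens l) - F (odds l)) \<le> W"
      proof (rule tendsto_upperbound[OF lim _ nontriv'])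
        show "eventually (\<lambda>j. norm (member (F (evens l) - F (odds l)) j) \<le> W) \<U>"
          using good[OF l]
          by eventually_elim (auto simp: Q_def F length_evens_odds[OF l(1)] intro!: close)
      qed
      show "V \<le> ultra_seminorm \<U> (F (take k l) - F (drop k l))"
      proof (rule tendsto_lowerbound[OF lim _ nontriv'])
        show "eventually (\<lambda>j. V \<le> norm (member (F (take k l) - F (drop k l)) j)) \<U>"
          using good[OF l] by eventually_elim (auto simp: Q_def F l(1) intro!: apart)
      qed
    qed
    then show ?thesis ..
  qed
qed

theorem theorem1p5:
  assumes "(\<exists>f :: 'a::banach \<Rightarrow> 'b::banach. coarse_map f \<and> solvent_map f) \<or>
           (\<exists>f :: 'a \<Rightarrow> 'b. uniformly_continuous_on UNIV f \<and> almost_uncollapsed f)"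
  shows "(reflexive TYPE('b) \<longrightarrow>
            reflexive TYPE('a) \<or> has_l1_spreading_model TYPE('a)) \<and>
         (super_reflexive TYPE('j::infinite) TYPE('b) \<longrightarrow>
            super_reflexive TYPE('i) TYPE('a) \<or> trivial_type TYPE('a))"
proof -
  obtain f :: "'a \<Rightarrow> 'b" and t \<eta> W V where "separating_map f t \<eta> W V"
    using assms coarse_solvent_imp_separating uniformly_continuous_uncollapsed_imp_separating by metis
  then show ?thesis
    using reflexive_or_l1_spreading_model super_reflexive_or_trivial_type by blast
qed

end
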